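(* Let $n\ge 2$ and designate each of $1,\ldots,n-1$ as a left point or a right point. Let $\Theta$ be the lattice congruence on the weak order on $B_n$ generated by contracting: $s_0s_1$ and $s_0s_1s_0$ if $1$ is a right point, or $s_1s_0$ and $s_1s_0s_1$ if $1$ is a left point; and, for each $2\le i\le n-1$, $s_{i-1}s_i$ if $i$ is a right point, or $s_is_{i-1}$ if $i$ is a left point (this is the Cambrian congruence associated to the designation). Then $\delta^\circ$ restricts to a bijection from the set of signed permutations not contracted by $\Theta$ (the Cambrian lattice) to the set of type-B noncrossing arc diagrams consisting of arcs that never pass left of a left point and never pass right of a right point.
   Context: $B_n$: signed permutations of $\{\pm1,\ldots,\pm n\}$ ($\pi(-i)=-\pi(i)$), one-line notation $\pi_1\cdots\pi_n$, long one-line notation $\pi_{-n}\cdots\pi_{-1}\pi_1\cdots\pi_n$. Weak order: $\sigma$ covers $\pi$ iff either $\pi_{-1}<\pi_1$ and $\sigma$ swaps $\pi_{-1},\pi_1$, or $\pi_i<\pi_{i+1}$ ($1\le i\le n-1$) and $\sigma$ swaps $\pi_i,\pi_{i+1}$ and $\pi_{-i-1},\pi_{-i}$; a finite lattice. A lattice congruence is an equivalence relation compatible with $\wedge,\vee$; it contracts $x$ if $x$ is congruent to a strictly smaller element; the congruence generated by a set of elements is the finest congruence contracting them. The specified elements, in one-line notation: $s_0s_1=2(-1)3\cdots n$, $s_0s_1s_0=(-2)(-1)3\cdots n$, $s_1s_0=(-2)13\cdots n$, $s_1s_0s_1=1(-2)3\cdots n$, $s_{i-1}s_i=1\cdots(i-2)\,i\,(i+1)(i-1)(i+2)\cdots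 n$, $s_is_{i-1}=1\cdots(i-2)(i+1)(i-1)\,i\,(i+2)\cdots n$. Symmetric model: $2n$ points labeled $-n,\ldots,-1,1,\ldots,n$ bottom to top on a vertical line, symmetric under $x\mapsto -x$. For $\pi\in B_n$, $\delta(\pi)$ has, for each pair of consecutive positions $a,b$ (order $-n<\cdots<-1<1<\cdots<n$) with $\pi_a>\pi_b$, an arc (monotone downward curve avoiding other labeled points) from $\pi_a$ to $\pi_b$ passing right of each $\pi_c$ with $\pi_b<\pi_c<\pi_a$, $c$ before $a$, and left of such $\pi_c$ with $c$ after $b$. Orbifold model: the orbifold plane is $\mathbb R^2/(x\sim-x)$, pictured as the open upper half-plane plus, for each $r\ge0$, a semicircle point (closed lower semicircle of radius $r$; $r=0$ is the orbifold point $\times$); numbered points $1,\ldots,n$ lie above $\times$ on the vertical axis, increasing upward. Type-B arcs (up to combinatorial equivalence): ordinary arcs (monotone downward from numbered $q$ to numbered $p<q$, passing left or right of points between), orbifold arcs (monotone downward from numbered $p$ to $\times$), long arcs (containing exactly one semicircle point, not $\times$, with disjoint left piece descending from left endpoint $p$ and right piece descending from right endpoint $q\ne p$). For ordinary/orbifold $\alpha$, $L(\alpha),R(\alpha)$: numbered points strictly between its endpoints left/right of $\alpha$. For long $\alpha$: $L(\alpha)$ = points in $(0,p)$ left of the left piece, $R(\alpha)$ = points in $(0,q)$ right of the right piece. An arc passes right of a numbered point $i$ if $i$ lies to the left of some part of it: for ordinary/orbifold arcs, $i\in L(\alpha)$; for long arcs, $i\in L(\alpha)$ or ($i<q$ and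 $i\notin R(\alpha)$). It passes left of $i$ if $i$ lies to the right of some part: for ordinary/orbifold, $i\in R(\alpha)$; for long, $i\in R(\alpha)$ or ($i<p$ and $i\notin L(\alpha)$). A type-B noncrossing arc diagram is a set of type-B arcs pairwise not intersecting except possibly at numbered endpoints, with no two sharing an endpoint from which both go downward or both go upward. $\phi$ maps points above the horizontal axis to themselves, points below to their negatives, and a point $x$ on the axis to the semicircle point of radius $|x|$; $\delta^\circ(\pi)=\phi(\delta(\pi))$. *)

theory Defs
  imports Complex_Main "HOL-Library.Product_Plus" "HOL-Combinatorics.Permutations"
    "HOL-Algebra.Lattice"
begin

section \<open>Signed permutations and the weak order\<close>

definition labels :: "nat \<Rightarrow> int set" where
  "labels n = {- int n..int n} - {0}"

text \<open>As usual for \<open>permutes\<close>, a signed permutation is the identity outside its domain.\<close>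

definition signed_perms :: "nat \<Rightarrow> (int \<Rightarrow> int) set" where
  "signed_perms n = {\<pi>. \<pi> permutes labels n \<and> (\<forall>i. \<pi> (- i) = - \<pi> i)}"

definition one_line :: "int list \<Rightarrow> int \<Rightarrow> int" where
  "one_line xs i =
     (if 1 \<le> i \<and> i \<le> int (length xs) then xs ! (nat i - 1)
      else if - int (length xs) \<le> i \<and> i \<le> -1 then - (xs ! (nat (- i) - 1))
      else i)"

text \<open>The entries \<open>\<pi> i\<close> are listed by position, so swapping the entries in two positions is
  composition with a transposition on the right.\<close>

definition weak_cover :: "nat \<Rightarrow> (int \<Rightarrow> int) \<Rightarrow> (int \<Rightarrow> int) \<Rightarrow> bool" where
  "weak_cover n \<pi> \<sigma> \<longleftrightarrow> \<pi> \<in> signed_perms n \<and>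
     (\<pi> (-1) < \<pi> 1 \<and> \<sigma> = \<pi> \<circ> transpose (-1) 1 \<or>
      (\<exists>i. 1 \<le> i \<and> i \<le> int n - 1 \<and> \<pi> i < \<pi> (i + 1) \<and>
           \<sigma> = \<pi> \<circ> transpose i (i + 1) \<circ> transpose (- i - 1) (- i)))"

definition weak_order_B :: "nat \<Rightarrow> (int \<Rightarrow> int) gorder" where
  "weak_order_B n = \<lparr>carrier = signed_perms n, eq = (=), le = (weak_cover n)\<^sup>*\<^sup>*\<rparr>"

section \<open>Lattice congruences\<close>

definition lattice_congruence :: "('a, 'b) gorder_scheme \<Rightarrow> ('a \<times> 'a) set \<Rightarrow> bool" where
  "lattice_congruence P \<Theta> \<longleftrightarrow> equiv (carrier P) \<Theta> \<and>
     (\<forall>x x' y y'. (x, x') \<in> \<Theta> \<and> (y, y') \<in> \<Theta> \<longrightarrow>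
        (x \<sqinter>\<^bsub>P\<^esub> y, x' \<sqinter>\<^bsub>P\<^esub> y') \<in> \<Theta> \<and> (x \<squnion>\<^bsub>P\<^esub> y, x' \<squnion>\<^bsub>P\<^esub> y') \<in> \<Theta>)"

definition contracts :: "('a, 'b) gorder_scheme \<Rightarrow> ('a \<times> 'a) set \<Rightarrow> 'a \<Rightarrow> bool" where
  "contracts P \<Theta> x \<longleftrightarrow> (\<exists>y \<in> carrier P. (x, y) \<in> \<Theta> \<and> y \<sqsubset>\<^bsub>P\<^esub> x)"

text \<open>Congruences are ordered by inclusion, so the finest one is the least one.\<close>

definition generated_congruence :: "('a, 'b) gorder_scheme \<Rightarrow> 'a set \<Rightarrow> ('a \<times> 'a) set" where
  "generated_congruence P S = (LEAST \<Theta>. lattice_congruence P \<Theta> \<and> (\<forall>x \<in> S. contracts P \<Theta> x))"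

text \<open>In the order of appearance: \<open>s\<^sub>0s\<^sub>1\<close>, \<open>s\<^sub>0s\<^sub>1s\<^sub>0\<close>, \<open>s\<^sub>1s\<^sub>0\<close>, \<open>s\<^sub>1s\<^sub>0s\<^sub>1\<close>,
  \<open>s\<^sub>i\<^sub>-\<^sub>1s\<^sub>i\<close>, \<open>s\<^sub>is\<^sub>i\<^sub>-\<^sub>1\<close>.\<close>

definition cambrian_generators :: "nat \<Rightarrow> int set \<Rightarrow> int set \<Rightarrow> (int \<Rightarrow> int) set" where
  "cambrian_generators n Lpts Rpts =
     (if 1 \<in> Rpts then {one_line ([2, -1] @ [3..int n]), one_line ([-2, -1] @ [3..int n])} else {}) \<union>
     (if 1 \<in> Lpts then {one_line ([-2, 1] @ [3..int n]), one_line ([1, -2] @ [3..int n])} else {}) \<union>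
     {one_line ([1..i - 2] @ [i, i + 1, i - 1] @ [i + 2..int n]) | i.
        2 \<le> i \<and> i \<le> int n - 1 \<and> i \<in> Rpts} \<union>
     {one_line ([1..i - 2] @ [i + 1, i - 1, i] @ [i + 2..int n]) | i.
        2 \<le> i \<and> i \<le> int n - 1 \<and> i \<in> Lpts}"

definition cambrian_congruence ::
    "nat \<Rightarrow> int set \<Rightarrow> int set \<Rightarrow> ((int \<Rightarrow> int) \<times> (int \<Rightarrow> int)) set" where
  "cambrian_congruence n Lpts Rpts =
     generated_congruence (weak_order_B n) (cambrian_generators n Lpts Rpts)"

section \<open>Monotone curves\<close>

text \<open>The point labeled \<open>i\<close> is placed at \<open>(0, i)\<close>. A curve that is monotone in the vertical
  direction is the graph of a continuous function \<open>f\<close> giving the horizontal coordinate at each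
  height, so the curve passes to the right of the point \<open>i\<close> iff \<open>0 < f i\<close>.\<close>

definition curve :: "(real \<Rightarrow> real) \<Rightarrow> int \<Rightarrow> int \<Rightarrow> (real \<times> real) set" where
  "curve f a b = (\<lambda>y. (f y, y)) ` {real_of_int a..real_of_int b}"

definition inner_points :: "nat \<Rightarrow> int \<Rightarrow> int \<Rightarrow> int set" where
  "inner_points n a b = {i \<in> labels n. a < i \<and> i < b}"

definition admissible :: "nat \<Rightarrow> (real \<Rightarrow> real) \<Rightarrow> int \<Rightarrow> int \<Rightarrow> bool" where
  "admissible n f a b \<longleftrightarrow>
     continuous_on {real_of_int a..real_of_int b} f \<and> (\<forall>i \<in> inner_points n a b. f i \<noteq> 0)"

definition points_left_of :: "nat \<Rightarrow> (real \<Rightarrow> real) \<Rightarrow> int \<Rightarrow> int \<Rightarrow> int set" where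
  "points_left_of n f a b = {i \<in> inner_points n a b. 0 < f i}"

definition points_right_of :: "nat \<Rightarrow> (real \<Rightarrow> real) \<Rightarrow> int \<Rightarrow> int \<Rightarrow> int set" where
  "points_right_of n f a b = {i \<in> inner_points n a b. f i < 0}"

section \<open>The symmetric model\<close>

text \<open>Combinatorial type of an arc on the \<open>2n\<close> labeled points: lower endpoint, upper endpoint,
  labeled points to its left, labeled points to its right.\<close>

datatype arc = Arc int int "int set" "int set"

fun represents_arc :: "nat \<Rightarrow> (real \<times> real) set \<Rightarrow> arc \<Rightarrow> bool" where
  "represents_arc n C (Arc p q L R) \<longleftrightarrow> p \<in> labels n \<and> q \<in> labels n \<and> p < q \<and>
     (\<exists>f. admissible n f p q \<and> f p = 0 \<and> f q = 0 \<and>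
          L = points_left_of n f p q \<and> R = points_right_of n f p q \<and> C = curve f p q)"

definition descents :: "nat \<Rightarrow> (int \<Rightarrow> int) \<Rightarrow> (int \<times> int) set" where
  "descents n \<pi> = {(a, b). a \<in> labels n \<and> b \<in> labels n \<and> a < b \<and>
     \<not> (\<exists>c \<in> labels n. a < c \<and> c < b) \<and> \<pi> b < \<pi> a}"

definition delta :: "nat \<Rightarrow> (int \<Rightarrow> int) \<Rightarrow> arc set" where
  "delta n \<pi> = (\<lambda>(a, b). Arc (\<pi> b) (\<pi> a)
       {\<pi> c | c. c \<in> labels n \<and> \<pi> b < \<pi> c \<and> \<pi> c < \<pi> a \<and> c < a}
       {\<pi> c | c. c \<in> labels n \<and> \<pi> b < \<pi> c \<and> \<pi> c < \<pi> a \<and> b < c}) ` descents n \<pi>"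

text \<open>A drawing of a set of arcs chooses one curve of each type; the curves meet only at labeled
  points, and the whole picture is symmetric under \<open>x \<mapsto> - x\<close>.\<close>

definition symmetric_drawing :: "nat \<Rightarrow> arc set \<Rightarrow> (arc \<Rightarrow> (real \<times> real) set) \<Rightarrow> bool" where
  "symmetric_drawing n D c \<longleftrightarrow>
     (\<forall>\<alpha> \<in> D. represents_arc n (c \<alpha>) \<alpha>) \<and>
     (\<forall>\<alpha> \<in> D. \<forall>\<beta> \<in> D. \<alpha> \<noteq> \<beta> \<longrightarrow> c \<alpha> \<inter> c \<beta> \<subseteq> (\<lambda>i. (0, real_of_int i)) ` labels n) \<and>
     (\<forall>\<alpha> \<in> D. uminus ` c \<alpha> \<in> c ` D)"

section \<open>The orbifold model\<close>

text \<open>The picture of the orbifold plane: points \<open>Upper (x, y)\<close> with \<open>0 < y\<close>, and semicircle points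
  \<open>Semi r\<close> with \<open>0 \<le> r\<close>, the orbifold point being \<open>Semi 0\<close>.\<close>

datatype orb_point = Upper "real \<times> real" | Semi real

fun orb_proj :: "real \<times> real \<Rightarrow> orb_point" where
  "orb_proj (x, y) =
     (if 0 < y then Upper (x, y) else if y < 0 then Upper (- (x, y)) else Semi \<bar>x\<bar>)"

text \<open>Combinatorial types of type-B arcs, with the sets \<open>L\<close> and \<open>R\<close> as last two arguments:
  \<open>Ordinary p q L R\<close> joins \<open>q\<close> down to \<open>p\<close>, \<open>Orbifold p L R\<close> joins \<open>p\<close> down to the orbifold
  point, and \<open>Long p q L R\<close> has left endpoint \<open>p\<close> and right endpoint \<open>q\<close>.\<close>

datatype arc_B =
    Ordinary int int "int set" "int set"
  | Orbifold int "int set" "int set"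
  | Long int int "int set" "int set"

text \<open>The pieces of a long arc reach the semicircle point \<open>Semi r\<close> from its two ends \<open>(- r, 0)\<close>
  and \<open>(r, 0)\<close>. As planar curves over heights from \<open>0\<close> on, they are disjoint iff their
  images are disjoint apart from \<open>Semi r\<close>.\<close>

fun represents_arc_B :: "nat \<Rightarrow> orb_point set \<Rightarrow> arc_B \<Rightarrow> bool" where
  "represents_arc_B n C (Ordinary p q L R) \<longleftrightarrow> 1 \<le> p \<and> p < q \<and> q \<le> int n \<and>
     (\<exists>f. admissible n f p q \<and> f p = 0 \<and> f q = 0 \<and>
          L = points_left_of n f p q \<and> R = points_right_of n f p q \<and>
          C = orb_proj ` curve f p q)"
| "represents_arc_B n C (Orbifold p L R) \<longleftrightarrow> 1 \<le> p \<and> p \<le> int n \<and>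
     (\<exists>f. admissible n f 0 p \<and> f 0 = 0 \<and> f p = 0 \<and>
          L = points_left_of n f 0 p \<and> R = points_right_of n f 0 p \<and>
          C = orb_proj ` curve f 0 p)"
| "represents_arc_B n C (Long p q L R) \<longleftrightarrow>
     1 \<le> p \<and> p \<le> int n \<and> 1 \<le> q \<and> q \<le> int n \<and> p \<noteq> q \<and>
     (\<exists>f g r. 0 < r \<and>
          admissible n f 0 p \<and> f 0 = - r \<and> f p = 0 \<and>
          admissible n g 0 q \<and> g 0 = r \<and> g q = 0 \<and>
          curve f 0 p \<inter> curve g 0 q = {} \<and>
          L = points_left_of n f 0 p \<and> R = points_right_of n g 0 q \<and>
          C = orb_proj ` (curve f 0 p \<union> curve g 0 q))"

fun passes_right_of :: "arc_B \<Rightarrow> int \<Rightarrow> bool" where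
  "passes_right_of (Ordinary p q L R) i \<longleftrightarrow> i \<in> L"
| "passes_right_of (Orbifold p L R) i \<longleftrightarrow> i \<in> L"
| "passes_right_of (Long p q L R) i \<longleftrightarrow> i \<in> L \<or> (i < q \<and> i \<notin> R)"

fun passes_left_of :: "arc_B \<Rightarrow> int \<Rightarrow> bool" where
  "passes_left_of (Ordinary p q L R) i \<longleftrightarrow> i \<in> R"
| "passes_left_of (Orbifold p L R) i \<longleftrightarrow> i \<in> R"
| "passes_left_of (Long p q L R) i \<longleftrightarrow> i \<in> R \<or> (i < p \<and> i \<notin> L)"

text \<open>Numbered endpoints from which an arc goes downward, respectively upward.\<close>

fun down_endpoints :: "arc_B \<Rightarrow> int set" where
  "down_endpoints (Ordinary p q L R) = {q}"
| "down_endpoints (Orbifold p L R) = {p}"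
| "down_endpoints (Long p q L R) = {p, q}"

fun up_endpoints :: "arc_B \<Rightarrow> int set" where
  "up_endpoints (Ordinary p q L R) = {p}"
| "up_endpoints (Orbifold p L R) = {}"
| "up_endpoints (Long p q L R) = {}"

text \<open>A diagram is given by the set of types of its arcs. Since a curve contains no numbered points
  besides its endpoints, two curves that meet only at numbered points meet only at common
  endpoints. Equivalent arcs share an endpoint from which both go downward, so no two arcs of a
  diagram have the same type.\<close>

definition noncrossing_diagram_B :: "nat \<Rightarrow> arc_B set \<Rightarrow> bool" where
  "noncrossing_diagram_B n D \<longleftrightarrow>
     (\<exists>c. (\<forall>\<alpha> \<in> D. represents_arc_B n (c \<alpha>) \<alpha>) \<and>
          (\<forall>\<alpha> \<in> D. \<forall>\<beta> \<in> D. \<alpha> \<noteq> \<beta> \<longrightarrow>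
             c \<alpha> \<inter> c \<beta> \<subseteq> (\<lambda>i. Upper (0, real_of_int i)) ` {1..int n})) \<and>
     (\<forall>\<alpha> \<in> D. \<forall>\<beta> \<in> D. \<alpha> \<noteq> \<beta> \<longrightarrow>
        down_endpoints \<alpha> \<inter> down_endpoints \<beta> = {} \<and> up_endpoints \<alpha> \<inter> up_endpoints \<beta> = {})"

text \<open>The diagram consists of the types of the projected curves in a drawing of \<open>delta n \<pi>\<close>; these
  types do not depend on the drawing.\<close>

definition delta_orb :: "nat \<Rightarrow> (int \<Rightarrow> int) \<Rightarrow> arc_B set" where
  "delta_orb n \<pi> = {\<beta>. \<exists>c. symmetric_drawing n (delta n \<pi>) c \<and>
     (\<exists>\<alpha> \<in> delta n \<pi>. represents_arc_B n (orb_proj ` c \<alpha>) \<beta>)}"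

end

theory Submission
  imports Defs
begin

text \<open>
  A signed permutation is encoded by its inversion set, the set of pairs of labels \<open>a < b\<close> with \<open>b\<close>
  before \<open>a\<close>. These are the sets that are transitive, have a transitive complement, and are symmetric
  under \<open>(a, b) \<mapsto> (-b, -a)\<close>; the weak order is inclusion, and the join is the transitive closure of
  the union.

  Extend the designation to negative labels by giving \<open>-i\<close> the side opposite to that of \<open>i\<close>. The set
  of \<open>(a, b)\<close> such that every \<open>(r, l)\<close> with \<open>a \<le> r < l \<le> b\<close>, \<open>r\<close> a right point or \<open>a\<close>, and \<open>l\<close> a left
  point or \<open>b\<close>, is an inversion of \<open>\<pi>\<close> is again an inversion set, and equality of these sets defines a
  lattice congruence that contracts the generators. So the permutations fixed by this projection are
  not contracted. Any other permutation has a descent whose arc passes a point \<open>c\<close> on the wrong side;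
  joining the generator at \<open>c\<close> with the longest element that does not move values across \<open>c\<close> gives
  a congruent pair of large elements, from which the contraction of the descent follows by a few
  meets and joins. The statement for left points is the dual of the one for right points.

  In the fixed permutations every arc is determined by its endpoints. Curves that do not cross keep
  their left-right order by the intermediate value theorem, so noncrossing diagrams become sets of
  pairs satisfying a combinatorial condition at the endpoints, and the transitive closure of the
  inversions forced by these pairs is the inversion set of the required permutation. Conversely,
  drawing the descents as straight segments with label \<open>\<pi> i\<close> at the point \<open>(i, \<pi> i)\<close>, and then
  shifting each horizontal line, yields a symmetric noncrossing drawing.
\<close>

section \<open>Biclosed sets and signed permutations\<close>

text \<open>The half-turn \<open>x\<close> -> \<open>-x\<close> exchanges left and right, which is
  why \<open>-i\<close> gets the side opposite to \<open>i\<close>. With this convention ordinary,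
  orbifold and long arcs need no separate combinatorics: all are arcs on the nonzero labels, taken
  up to (a, b) -> (-b, -a).

  The projection is decreasing, monotone and idempotent, which by itself gives compatibility with
  meets only. Joins come from the opposite projection, formed from complements with the two sides
  exchanged, because it has the same fibers.

  Symmetry is also the obstacle in contracting the bad descents. The large congruent pair at a right
  point \<open>c\<close> settles every pair of labels except those starting at \<open>c\<close> or
  ending at \<open>-c\<close>. A start at \<open>c\<close> is harmless, but when a descent spans
  both \<open>c\<close> and \<open>-c\<close> and both of its values follow \<open>-c\<close>, the
  meet with the large element may lose the descent. There the pair is first cut down by an auxiliary
  element, tailored to the descent, and the descent is recovered by a join through
  \<open>-c\<close>. Since no label lies between \<open>-1\<close> and \<open>1\<close>, the label
  \<open>1\<close> needs a generator that inverts \<open>-2\<close> and \<open>2\<close>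
  directly.\<close>

definition lpairs :: "nat \<Rightarrow> (int \<times> int) set" where
  "lpairs n = {(a, b). a \<in> labels n \<and> b \<in> labels n \<and> a < b}"

definition biclosed :: "nat \<Rightarrow> (int \<times> int) set \<Rightarrow> bool" where
  "biclosed n K \<longleftrightarrow> K \<subseteq> lpairs n \<and> trans K \<and> trans (lpairs n - K) \<and>
     (\<forall>a b. (a, b) \<in> K \<longrightarrow> (- b, - a) \<in> K)"

definition invs :: "nat \<Rightarrow> (int \<Rightarrow> int) \<Rightarrow> (int \<times> int) set" where
  "invs n \<pi> = {(a, b) \<in> lpairs n. inv \<pi> b < inv \<pi> a}"

lemma labels_iff: "i \<in> labels n \<longleftrightarrow> - int n \<le> i \<and> i \<le> int n \<and> i \<noteq> 0"
  by (auto simp: labels_def)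

lemma labels_uminus [simp]: "- i \<in> labels n \<longleftrightarrow> i \<in> labels n"
  by (auto simp: labels_iff)

lemma finite_labels [simp]: "finite (labels n)"
  by (simp add: labels_def)

lemma lpairs_iff: "(a, b) \<in> lpairs n \<longleftrightarrow> a \<in> labels n \<and> b \<in> labels n \<and> a < b"
  by (simp add: lpairs_def)

lemma lpairs_uminus [simp]: "(- b, - a) \<in> lpairs n \<longleftrightarrow> (a, b) \<in> lpairs n"
  by (auto simp: lpairs_iff)

lemma trans_lpairs: "trans (lpairs n)"
  by (auto simp: lpairs_def trans_def)

lemma finite_lpairs: "finite (lpairs n)"
  by (rule finite_subset[of _ "labels n \<times> labels n"]) (auto simp: lpairs_def)

lemma biclosedI:
  assumes "K \<subseteq> lpairs n"
    and "\<And>a b c. (a, b) \<in> K \<Longrightarrow> (b, c) \<in> K \<Longrightarrow> (a, c) \<in> K"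
    and "\<And>a b c. (a, c) \<in> K \<Longrightarrow> b \<in> labels n \<Longrightarrow> a < b \<Longrightarrow> b < c \<Longrightarrow> (a, b) \<in> K \<or> (b, c) \<in> K"
    and "\<And>a b. (a, b) \<in> K \<Longrightarrow> (- b, - a) \<in> K"
  shows "biclosed n K"
proof -
  have "trans (lpairs n - K)"
  proof (rule transI)
    fix a b c assume h: "(a, b) \<in> lpairs n - K" "(b, c) \<in> lpairs n - K"
    then have "b \<in> labels n" "a < b" "b < c" "(a, c) \<in> lpairs n" by (auto simp: lpairs_iff)
    then show "(a, c) \<in> lpairs n - K" using h assms(3)[of a c b] by blast
  qed
  moreover have "trans K" using assms(2) by (rule transI)
  ultimately show ?thesis unfolding biclosed_def using assms(1,4) by blast
qed

lemma biclosed_sub: "biclosed n K \<Longrightarrow> (a, b) \<in> K \<Longrightarrow> a \<in> labels n \<and> b \<in> labels n \<and> a < b"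
  by (auto simp: biclosed_def lpairs_def)

lemma biclosed_trans: "biclosed n K \<Longrightarrow> (a, b) \<in> K \<Longrightarrow> (b, c) \<in> K \<Longrightarrow> (a, c) \<in> K"
  unfolding biclosed_def trans_def by blast

lemma biclosed_cotrans:
  assumes "biclosed n K" "(a, c) \<in> K" "b \<in> labels n" "a < b" "b < c"
  shows "(a, b) \<in> K \<or> (b, c) \<in> K"
proof (rule ccontr)
  assume "\<not> ?thesis"
  then have "(a, b) \<in> lpairs n - K" "(b, c) \<in> lpairs n - K"
    using assms biclosed_sub[OF assms(1,2)] by (auto simp: lpairs_def)
  then have "(a, c) \<in> lpairs n - K"
    using assms(1) unfolding biclosed_def trans_def by blast
  then show False using assms(2) by blast
qed

lemma biclosed_sym: "biclosed n K \<Longrightarrow> (a, b) \<in> K \<Longrightarrow> (- b, - a) \<in> K"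
  by (auto simp: biclosed_def)

lemma biclosed_sym_iff: "biclosed n K \<Longrightarrow> (- b, - a) \<in> K \<longleftrightarrow> (a, b) \<in> K"
  using biclosed_sym[of n K a b] biclosed_sym[of n K "-b" "-a"] by auto

lemma biclosed_compl: "biclosed n K \<Longrightarrow> biclosed n (lpairs n - K)"
  unfolding biclosed_def
  by (auto simp: double_diff) (metis minus_minus)

lemma biclosed_compl_compl: "biclosed n K \<Longrightarrow> lpairs n - (lpairs n - K) = K"
  by (auto simp: biclosed_def)

text \<open>Cotransitivity of a union passes to its transitive closure: a point strictly between the
  ends of a chain either lies on the chain or splits one of its steps.\<close>

lemma trancl_union_biclosed:
  assumes sub: "U \<subseteq> lpairs n"
    and co: "\<And>a b c. (a, c) \<in> U \<Longrightarrow> b \<in> labels n \<Longrightarrow> a < b \<Longrightarrow> b < c \<Longrightarrow> (a, b) \<in> U \<or> (b, c) \<in> U"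
    and sy: "\<And>a b. (a, b) \<in> U \<Longrightarrow> (- b, - a) \<in> U"
  shows "biclosed n (U\<^sup>+)"
proof (rule biclosedI)
  show "U\<^sup>+ \<subseteq> lpairs n"
    using trancl_mono_subset[OF sub] trans_lpairs by (simp add: trancl_id)
  show "(a, b) \<in> U\<^sup>+ \<Longrightarrow> (b, c) \<in> U\<^sup>+ \<Longrightarrow> (a, c) \<in> U\<^sup>+" for a b c
    by (rule trancl_trans)
  show "(a, b) \<in> U\<^sup>+ \<or> (b, c) \<in> U\<^sup>+"
    if "(a, c) \<in> U\<^sup>+" "b \<in> labels n" "a < b" "b < c" for a b c
    using that
  proof (induction rule: trancl_induct)
    case (base c) then show ?case using co by blast
  next
    case (step y z)
    consider "b < y" | "b = y" | "y < b" by linarith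
    then show ?case
    proof cases
      case 1
      with step show ?thesis by (blast intro: trancl_into_trancl)
    next
      case 2
      with step show ?thesis by blast
    next
      case 3
      with step co[of y z b] show ?thesis by (blast intro: trancl_into_trancl)
    qed
  qed
  show "(- b, - a) \<in> U\<^sup>+" if "(a, b) \<in> U\<^sup>+" for a b
    using that
  proof (induction rule: trancl_induct)
    case (base y) then show ?case using sy by blast
  next
    case (step y z) then show ?case using sy by (blast intro: trancl_into_trancl2)
  qed
qed

lemma biclosed_join:
  assumes "biclosed n K" "biclosed n K'"
  shows "biclosed n ((K \<union> K')\<^sup>+)"
proof (rule trancl_union_biclosed)
  show "K \<union> K' \<subseteq> lpairs n" using assms by (auto simp: biclosed_def)
qed (use assms biclosed_cotrans biclosed_sym in blast)+

section \<open>Inversion sets of signed permutations\<close>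

text \<open>These are the pairs inverted by a stable sort of the labels by increasing key, and an
  odd key makes the sort symmetric. Positions give \<open>invs\<close>; a key chosen by hand gives
  an auxiliary element later.\<close>

lemma biclosed_key:
  assumes "\<And>v. v \<in> labels n \<Longrightarrow> key (- v) = - (key v :: int)"
  shows "biclosed n {(a, b) \<in> lpairs n. key b < key a}"
  by (rule biclosedI) (use assms in \<open>auto simp: lpairs_def\<close>)

lemma signed_permsD:
  assumes "\<pi> \<in> signed_perms n"
  shows "\<pi> permutes labels n" "\<pi> (- i) = - \<pi> i" "inv \<pi> permutes labels n"
    "inv \<pi> (- i) = - inv \<pi> i" "\<pi> (inv \<pi> i) = i" "inv \<pi> (\<pi> i) = i"
    "\<pi> i \<in> labels n \<longleftrightarrow> i \<in> labels n" "inv \<pi> i \<in> labels n \<longleftrightarrow> i \<in> labels n"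
    "\<pi> i = \<pi> j \<longleftrightarrow> i = j" "inv \<pi> i = inv \<pi> j \<longleftrightarrow> i = j"
proof -
  show p: "\<pi> permutes labels n" and odd: "\<pi> (- i) = - \<pi> i" for i
    using assms by (auto simp: signed_perms_def)
  show q: "inv \<pi> permutes labels n" using p by (rule permutes_inv)
  show "\<pi> (inv \<pi> i) = i" "inv \<pi> (\<pi> i) = i" for i
    using permutes_inverses[OF p] by auto
  then show "inv \<pi> (- i) = - inv \<pi> i" for i using odd by metis
  show "\<pi> i \<in> labels n \<longleftrightarrow> i \<in> labels n" "inv \<pi> i \<in> labels n \<longleftrightarrow> i \<in> labels n" for i
    using p q by (simp_all add: permutes_in_image)
  show "\<pi> i = \<pi> j \<longleftrightarrow> i = j" "inv \<pi> i = inv \<pi> j \<longleftrightarrow> i = j" for i j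
    using permutes_inj[OF p] permutes_inj[OF q] by (auto dest: injD)
qed

lemma invs_iff: "(a, b) \<in> invs n \<pi> \<longleftrightarrow> a \<in> labels n \<and> b \<in> labels n \<and> a < b \<and> inv \<pi> b < inv \<pi> a"
  by (auto simp: invs_def lpairs_def)

lemma invs_biclosed: "\<pi> \<in> signed_perms n \<Longrightarrow> biclosed n (invs n \<pi>)"
  unfolding invs_def by (rule biclosed_key) (simp add: signed_permsD)

lemma strict_mono_labels_eq_id:
  assumes "f permutes labels n"
    and mono: "\<And>x y. x \<in> labels n \<Longrightarrow> y \<in> labels n \<Longrightarrow> x < y \<Longrightarrow> f x < f y"
  shows "f = id"
proof
  fix x
  show "f x = id x"
  proof (cases "x \<in> labels n")
    case False then show ?thesis using assms(1) by (simp add: permutes_not_in)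
  next
    case True
    define C where "C v = card {y \<in> labels n. y < v}" for v
    have "f ` {y \<in> labels n. y < x} = {y \<in> labels n. y < f x}"
    proof (rule Set.set_eqI, rule iffI)
      fix z assume z: "z \<in> {y \<in> labels n. y < f x}"
      then obtain y where y: "y \<in> labels n" "z = f y"
        using permutes_image[OF assms(1)] by (metis (lifting) imageE mem_Collect_eq)
      have "y < x" using z y True mono[of x y] by (cases y x rule: linorder_cases) auto
      then show "z \<in> f ` {y \<in> labels n. y < x}" using y by blast
    qed (use True mono assms(1) in \<open>auto simp: permutes_in_image\<close>)
    then have "C (f x) = C x"
      unfolding C_def using card_image[OF permutes_inj_on[OF assms(1), of "{y \<in> labels n. y < x}"]]
      by simp
    moreover have "C u < C v" if "u < v" "u \<in> labels n" for u v
      unfolding C_def using that by (intro psubset_card_mono) auto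
    ultimately show ?thesis using True permutes_in_image[OF assms(1), of x]
      by (cases "f x" x rule: linorder_cases) fastforce+
  qed
qed

lemma eq_if_order_preserving:
  assumes "\<pi> \<in> signed_perms n" "\<sigma> \<in> signed_perms n"
    and "\<And>i j. i \<in> labels n \<Longrightarrow> j \<in> labels n \<Longrightarrow> i < j \<Longrightarrow> inv \<sigma> (\<pi> i) < inv \<sigma> (\<pi> j)"
  shows "\<sigma> = \<pi>"
proof -
  have "inv \<sigma> \<circ> \<pi> = id"
    by (rule strict_mono_labels_eq_id[where n = n])
       (use assms in \<open>auto intro!: permutes_compose simp: signed_permsD\<close>)
  then have "inv \<sigma> (\<pi> i) = i" for i by (metis comp_apply id_apply)
  then show ?thesis using signed_permsD(5)[OF assms(2)] by (metis ext)
qed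

lemma invs_inject:
  assumes "\<pi> \<in> signed_perms n" "\<sigma> \<in> signed_perms n" "invs n \<pi> = invs n \<sigma>"
  shows "\<pi> = \<sigma>"
proof -
  have "inv \<sigma> (\<pi> i) < inv \<sigma> (\<pi> j)" if "i \<in> labels n" "j \<in> labels n" "i < j" for i j
  proof -
    have "(\<pi> i, \<pi> j) \<notin> invs n \<sigma>" "\<pi> j < \<pi> i \<Longrightarrow> (\<pi> j, \<pi> i) \<in> invs n \<sigma>"
      using that signed_permsD[OF assms(1)] unfolding assms(3)[symmetric]
      by (auto simp: invs_iff[of _ _ n \<pi>])
    then have eq: "\<pi> i < \<pi> j \<Longrightarrow> \<not> inv \<sigma> (\<pi> j) < inv \<sigma> (\<pi> i)"
      "\<pi> j < \<pi> i \<Longrightarrow> inv \<sigma> (\<pi> i) < inv \<sigma> (\<pi> j)"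
      using that signed_permsD(7)[OF assms(1)] by (auto simp: invs_iff)
    show ?thesis using eq that signed_permsD(9,10)[OF assms(1)] signed_permsD(10)[OF assms(2)]
      by (metis less_irrefl linorder_neqE)
  qed
  then show ?thesis using eq_if_order_preserving assms by metis
qed

text \<open>Reversing the natural order on the pairs of \<open>K\<close> gives a linear order
  \<open>lt\<close> on the labels, read as "comes earlier". Transitivity of \<open>K\<close> and of
  its complement makes \<open>lt\<close> transitive; symmetry of \<open>K\<close> makes negation
  reverse \<open>lt\<close>, so positions can be counted outward from the middle.\<close>

theorem biclosed_realize:
  assumes K: "biclosed n K"
  shows "\<exists>\<pi> \<in> signed_perms n. invs n \<pi> = K"
proof -
  define lt where "lt x y \<longleftrightarrow> x \<in> labels n \<and> y \<in> labels n \<and>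
    (x < y \<and> (x, y) \<notin> K \<or> y < x \<and> (y, x) \<in> K)" for x y
  have lin: "lt x y \<or> lt y x" if "x \<in> labels n" "y \<in> labels n" "x \<noteq> y" for x y
    using that by (auto simp: lt_def)
  have asym: "\<not> lt y x" if "lt x y" for x y using that by (auto simp: lt_def)
  have tr: "lt x z" if "lt x y" "lt y z" for x y z
  proof -
    have ne: "x \<noteq> z" using that asym by blast
    have lab: "x \<in> labels n" "y \<in> labels n" "z \<in> labels n" using that by (auto simp: lt_def)
    have up: "(u, v) \<notin> K" if "lt u v" "u < v" for u v using that by (auto simp: lt_def)
    have down: "(v, u) \<in> K" if "lt u v" "v < u" for u v using that by (auto simp: lt_def)
    have xy: "x \<noteq> y" "y \<noteq> z" using that by (auto simp: lt_def)
    have "(x, z) \<notin> K" if "x < z"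
    proof
      assume xz: "(x, z) \<in> K"
      consider "y < x" | "x < y" "y < z" | "z < y" using xy by linarith
      then show False
      proof cases
        case 1
        then show False using down[OF \<open>lt x y\<close>] up[OF \<open>lt y z\<close>] biclosed_trans[OF K _ xz] that by auto
      next
        case 2
        then show False using up[OF \<open>lt x y\<close>] up[OF \<open>lt y z\<close>] biclosed_cotrans[OF K xz lab(2)] by auto
      next
        case 3
        then show False using up[OF \<open>lt x y\<close>] down[OF \<open>lt y z\<close>] biclosed_trans[OF K xz] that by auto
      qed
    qed
    moreover have "(z, x) \<in> K" if "z < x"
    proof -
      consider "y < z" | "z < y" "y < x" | "x < y" using xy by linarith
      then show ?thesis
      proof cases
        case 1
        then show ?thesis
          using down[OF \<open>lt x y\<close>] up[OF \<open>lt y z\<close>] biclosed_cotrans[OF K _ lab(3), of y x] that by auto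
      next
        case 2
        then show ?thesis
          using down[OF \<open>lt x y\<close>] down[OF \<open>lt y z\<close>] biclosed_trans[OF K, of z y x] by auto
      next
        case 3
        then show ?thesis
          using up[OF \<open>lt x y\<close>] down[OF \<open>lt y z\<close>] biclosed_cotrans[OF K _ lab(1), of z y] that by auto
      qed
    qed
    ultimately show ?thesis using ne lab unfolding lt_def by (cases x z rule: linorder_cases) auto
  qed
  have odd: "lt (- y) (- x) \<longleftrightarrow> lt x y" for x y
    using biclosed_sym_iff[OF K, of x y] biclosed_sym_iff[OF K, of y x] by (auto simp: lt_def)
  \<comment> \<open>The labels that come after their own negatives and so belong at positive
    positions. Exactly one of \<open>x\<close> and \<open>-x\<close> is of this kind.\<close>
  define Q where "Q = {x. lt (- x) x}"
  have Qlab: "Q \<subseteq> labels n" by (auto simp: Q_def lt_def)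
  then have finQ: "finite Q" by (rule finite_subset) simp
  have Q_or: "x \<in> Q \<or> - x \<in> Q" if "x \<in> labels n" for x
    using lin[of x "- x"] that by (auto simp: Q_def labels_iff)
  have Q_not: "- x \<notin> Q" if "x \<in> Q" for x using that asym by (auto simp: Q_def)
  have cardQ: "card Q = n"
  proof -
    have "labels n = Q \<union> uminus ` Q"
    proof (intro Set.set_eqI iffI)
      fix x assume "x \<in> labels n"
      then show "x \<in> Q \<union> uminus ` Q" using Q_or[of x] by (metis UnCI imageI minus_minus)
    qed (use Qlab in \<open>auto simp: subset_iff\<close>)
    moreover have "Q \<inter> uminus ` Q = {}" using Q_not by force
    moreover have "card (labels n) = 2 * n" by (simp add: labels_def)
    ultimately have "2 * n = card Q + card (uminus ` Q)"
      using finQ by (metis card_Un_disjoint finite_imageI)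
    then show ?thesis by (simp add: card_image)
  qed
  define rk where "rk x = int (card {y \<in> Q. y = x \<or> lt y x})" for x
  \<comment> \<open>The last branch concerns only arguments outside \<open>labels n\<close>, where a
    signed permutation is the identity.\<close>
  define pos where "pos x = (if x \<in> Q then rk x else if - x \<in> Q then - rk (- x) else x)" for x
  have rk_bounds: "1 \<le> rk x \<and> rk x \<le> int n" if "x \<in> Q" for x
  proof -
    have "card {y \<in> Q. y = x \<or> lt y x} \<le> card Q" by (rule card_mono[OF finQ]) auto
    moreover have "card {y \<in> Q. y = x \<or> lt y x} > 0" using that finQ by (auto simp: card_gt_0_iff)
    ultimately show ?thesis by (simp add: rk_def cardQ)
  qed
  have rk_mono: "rk x < rk y" if "x \<in> Q" "y \<in> Q" "lt x y" for x y
  proof -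
    have "{z \<in> Q. z = x \<or> lt z x} \<subset> {z \<in> Q. z = y \<or> lt z y}"
    proof (rule psubsetI)
      show "{z \<in> Q. z = x \<or> lt z x} \<subseteq> {z \<in> Q. z = y \<or> lt z y}" using that tr by blast
      have "y \<in> {z \<in> Q. z = y \<or> lt z y}" "y \<notin> {z \<in> Q. z = x \<or> lt z x}"
        using that asym by blast+
      then show "{z \<in> Q. z = x \<or> lt z x} \<noteq> {z \<in> Q. z = y \<or> lt z y}" by metis
    qed
    then show ?thesis unfolding rk_def using finQ by (simp add: psubset_card_mono)
  qed
  have pos_odd: "pos (- x) = - pos x" for x using Q_not by (auto simp: pos_def)
  have pos_lab: "pos x \<in> labels n" if "x \<in> labels n" for x
    using Q_or[OF that] rk_bounds[of x] rk_bounds[of "- x"] by (auto simp: pos_def labels_iff)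
  have pos_mono: "pos x < pos y" if "lt x y" for x y
  proof -
    have lab: "x \<in> labels n" "y \<in> labels n" using that by (auto simp: lt_def)
    consider "x \<in> Q" "y \<in> Q" | "x \<in> Q" "- y \<in> Q" | "- x \<in> Q" "y \<in> Q" | "- x \<in> Q" "- y \<in> Q"
      using Q_or lab by blast
    then show ?thesis
    proof cases
      case 1 then show ?thesis using rk_mono that by (auto simp: pos_def)
    next
      case 2
      then have "lt (- x) x" "lt y (- y)" "lt (- y) (- x)" using that odd by (auto simp: Q_def)
      then show ?thesis using that tr asym by blast
    next
      case 3
      then have "pos (- x) \<ge> 1" "pos y \<ge> 1" using rk_bounds by (auto simp: pos_def)
      then show ?thesis by (simp add: pos_odd)
    next
      case 4
      then have "rk (- y) < rk (- x)" using rk_mono that odd by blast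
      then have "pos (- y) < pos (- x)" using 4 by (auto simp: pos_def)
      then show ?thesis by (simp add: pos_odd)
    qed
  qed
  have inj: "inj_on pos (labels n)"
  proof (rule inj_onI, rule ccontr)
    fix x y assume "x \<in> labels n" "y \<in> labels n" "pos x = pos y" "x \<noteq> y"
    then show False using lin[of x y] pos_mono[of x y] pos_mono[of y x] by auto
  qed
  have "pos ` labels n = labels n"
    by (rule endo_inj_surj[OF finite_labels _ inj]) (use pos_lab in blast)
  then have bij: "bij_betw pos (labels n) (labels n)"
    using inj by (simp add: bij_betw_def)
  have perm: "pos permutes labels n"
    using bij by (rule bij_imp_permutes) (use Qlab in \<open>auto simp: pos_def\<close>)
  let ?\<pi> = "inv pos"
  have mem: "?\<pi> \<in> signed_perms n"
  proof -
    have "inv pos (- i) = - inv pos i" for i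
      using permutes_inverses[OF perm] pos_odd by metis
    then show ?thesis using perm by (simp add: signed_perms_def permutes_inv)
  qed
  have ii: "inv ?\<pi> = pos" using perm by (simp add: permutes_bij inv_inv_eq)
  have "(a, b) \<in> invs n ?\<pi> \<longleftrightarrow> (a, b) \<in> K" for a b
  proof (cases "(a, b) \<in> lpairs n")
    case False then show ?thesis using biclosed_sub[OF K] by (auto simp: invs_def lpairs_def)
  next
    case True
    then have "(a, b) \<in> K \<longleftrightarrow> lt b a" "(a, b) \<notin> K \<longleftrightarrow> lt a b" by (auto simp: lt_def lpairs_def)
    then show ?thesis using True pos_mono[of a b] pos_mono[of b a] by (auto simp: invs_def ii)
  qed
  then have "invs n ?\<pi> = K" by (metis subrelI subset_antisym)
  with mem show ?thesis by blast
qed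

section \<open>The weak order as containment of inversion sets\<close>

definition adj :: "nat \<Rightarrow> int \<Rightarrow> int \<Rightarrow> bool" where
  "adj n a b \<longleftrightarrow> a \<in> labels n \<and> b \<in> labels n \<and> a < b \<and> \<not> (\<exists>c \<in> labels n. a < c \<and> c < b)"

text \<open>One formula for all simple reflections on positions: for \<open>a = -1\<close>,
  \<open>b = 1\<close> the last two branches coincide with the first two, otherwise they perform the
  mirror-image swap.\<close>

definition sw :: "int \<Rightarrow> int \<Rightarrow> int \<Rightarrow> int" where
  "sw a b x = (if x = a then b else if x = b then a else if x = - a then - b
     else if x = - b then - a else x)"

lemma adj_iff: "adj n a b \<longleftrightarrow> a \<in> labels n \<and> b \<in> labels n \<and> (b = a + 1 \<or> a = -1 \<and> b = 1)"
proof
  assume h: "adj n a b"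
  then have le: "a + 1 \<le> b" "a \<noteq> 0" "b \<noteq> 0" by (auto simp: adj_def labels_iff)
  show "a \<in> labels n \<and> b \<in> labels n \<and> (b = a + 1 \<or> a = -1 \<and> b = 1)"
  proof (rule ccontr)
    assume "\<not> ?thesis"
    with h have "b \<noteq> a + 1" "a = -1 \<longrightarrow> b \<noteq> 1" by (auto simp: adj_def)
    with le have "a + 1 < b" "a = -1 \<longrightarrow> 1 < b" by linarith+
    then have "(if a = -1 then 1 else a + 1) \<in> labels n \<and> a < (if a = -1 then 1 else a + 1)
        \<and> (if a = -1 then 1 else a + 1) < b"
      using h by (auto simp: adj_def labels_iff)
    then show False using h unfolding adj_def by blast
  qed
qed (auto simp: adj_def labels_iff)

lemma adj_uminus: "adj n (- b) (- a) \<longleftrightarrow> adj n a b"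
  by (auto simp: adj_iff labels_iff)

lemma strict_mono_labelsI:
  fixes f :: "int \<Rightarrow> int"
  assumes "\<And>a b. adj n a b \<Longrightarrow> f a < f b" "x \<in> labels n" "y \<in> labels n" "x < y"
  shows "f x < f y"
  using assms(2-4)
proof (induction "nat (y - x)" arbitrary: x rule: less_induct)
  case less
  define x' where "x' = (if x = -1 then 1 else x + 1)"
  have x': "adj n x x'" "x' \<in> labels n" "x' \<le> y" "x < x'"
    using less by (auto simp: adj_iff labels_iff x'_def)
  show ?case
  proof (cases "x' = y")
    case True then show ?thesis using assms(1) x' by blast
  next
    case False
    then show ?thesis using less(1)[of x'] less(3) x' assms(1)[OF x'(1)] by force
  qed
qed

lemma sw_sw: "a \<noteq> 0 \<Longrightarrow> b \<noteq> 0 \<Longrightarrow> a \<noteq> b \<Longrightarrow> sw a b (sw a b x) = x"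
  by (auto simp: sw_def)

lemma sw_uminus: "adj n a b \<Longrightarrow> sw a b (- x) = - sw a b x"
  by (auto simp: sw_def adj_iff labels_iff)

lemma sw_flip: "adj n a b \<Longrightarrow> sw (- b) (- a) = sw a b"
  by (auto simp: sw_def adj_iff labels_iff fun_eq_iff)

lemma sw_permutes: "adj n a b \<Longrightarrow> sw a b permutes labels n"
proof (rule bij_imp_permutes)
  assume h: "adj n a b"
  then have inv: "sw a b (sw a b x) = x" for x by (auto simp: adj_def labels_iff intro!: sw_sw)
  show "bij_betw (sw a b) (labels n) (labels n)"
    by (rule bij_betw_byWitness[where f' = "sw a b"])
       (use h inv in \<open>auto simp: sw_def adj_iff labels_iff\<close>)
  show "x \<notin> labels n \<Longrightarrow> sw a b x = x" for x using h by (auto simp: sw_def adj_iff labels_iff)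
qed

lemma inv_sw: "adj n a b \<Longrightarrow> inv (sw a b) = sw a b"
  by (rule inv_equality) (auto simp: adj_def labels_iff intro!: sw_sw)

lemma sw_less:
  assumes "adj n a b" "x \<in> labels n" "y \<in> labels n"
  shows "sw a b x < sw a b y \<longleftrightarrow>
    (x < y \<and> (x, y) \<noteq> (a, b) \<and> (x, y) \<noteq> (- b, - a)) \<or> (y, x) = (a, b) \<or> (y, x) = (- b, - a)"
proof -
  have "b = a + 1 \<and> a \<noteq> 0 \<and> a \<noteq> -1 \<or> a = -1 \<and> b = 1" "x \<noteq> 0" "y \<noteq> 0"
    using assms by (auto simp: adj_iff labels_iff)
  then show ?thesis unfolding sw_def by (smt (verit) prod.inject)
qed

lemma comp_sw_signed_perms:
  assumes "\<pi> \<in> signed_perms n" "adj n a b"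
  shows "\<pi> \<circ> sw a b \<in> signed_perms n" "inv (\<pi> \<circ> sw a b) = sw a b \<circ> inv \<pi>"
proof -
  show "\<pi> \<circ> sw a b \<in> signed_perms n"
    using assms sw_permutes[OF assms(2)] sw_uminus[OF assms(2)]
    by (simp add: signed_perms_def permutes_compose)
  show "inv (\<pi> \<circ> sw a b) = sw a b \<circ> inv \<pi>"
    using o_inv_distrib[OF permutes_bij permutes_bij, OF signed_permsD(1) sw_permutes, OF assms]
    by (simp add: inv_sw[OF assms(2)])
qed

lemma invs_comp_sw:
  assumes p: "\<pi> \<in> signed_perms n" and ab: "adj n a b" and less: "\<pi> a < \<pi> b"
  shows "invs n (\<pi> \<circ> sw a b) = invs n \<pi> \<union> {(\<pi> a, \<pi> b), (- \<pi> b, - \<pi> a)}"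
    and "(\<pi> a, \<pi> b) \<notin> invs n \<pi>"
proof -
  have ab': "a \<in> labels n" "b \<in> labels n" "a < b" using ab by (auto simp: adj_def)
  have "(u, v) \<in> invs n (\<pi> \<circ> sw a b) \<longleftrightarrow> (u, v) \<in> invs n \<pi> \<union> {(\<pi> a, \<pi> b), (- \<pi> b, - \<pi> a)}"
    for u v
  proof (cases "(u, v) \<in> lpairs n")
    case False
    moreover have "(\<pi> a, \<pi> b) \<in> lpairs n" "(- \<pi> b, - \<pi> a) \<in> lpairs n"
      unfolding lpairs_uminus using ab' less by (simp_all add: lpairs_iff signed_permsD(7)[OF p])
    ultimately show ?thesis by (auto simp: invs_def)
  next
    case True
    define x y where "x = inv \<pi> u" and "y = inv \<pi> v"
    have uv: "u = \<pi> x" "v = \<pi> y" using signed_permsD(5)[OF p] by (simp_all add: x_def y_def)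
    have lab: "x \<in> labels n" "y \<in> labels n"
      using True signed_permsD(8)[OF p] by (auto simp: x_def y_def lpairs_iff)
    have eq: "(\<pi> x, \<pi> y) = (\<pi> a, \<pi> b) \<longleftrightarrow> (x, y) = (a, b)"
      "(\<pi> x, \<pi> y) = (- \<pi> b, - \<pi> a) \<longleftrightarrow> (x, y) = (- b, - a)"
      by (simp_all add: signed_permsD(9)[OF p] signed_permsD(2)[OF p, symmetric] del: minus_minus)
    have neq: "(x, y) \<noteq> (b, a)" "(x, y) \<noteq> (- a, - b)"
      using True less by (auto simp: lpairs_iff uv signed_permsD(2)[OF p])
    have "(u, v) \<in> invs n (\<pi> \<circ> sw a b) \<longleftrightarrow> sw a b y < sw a b x"
      using True by (auto simp: invs_def comp_sw_signed_perms[OF p ab] x_def y_def)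
    also have "\<dots> \<longleftrightarrow> y < x \<or> (x, y) = (a, b) \<or> (x, y) = (- b, - a)"
      using sw_less[OF ab lab(2,1)] neq by auto
    also have "\<dots> \<longleftrightarrow> (u, v) \<in> invs n \<pi> \<union> {(\<pi> a, \<pi> b), (- \<pi> b, - \<pi> a)}"
    proof -
      have "(u, v) \<in> invs n \<pi> \<longleftrightarrow> y < x" using True by (simp add: invs_def x_def y_def)
      then show ?thesis unfolding uv using eq by auto
    qed
    finally show ?thesis .
  qed
  then show "invs n (\<pi> \<circ> sw a b) = invs n \<pi> \<union> {(\<pi> a, \<pi> b), (- \<pi> b, - \<pi> a)}"
    by (intro Set.set_eqI) (metis surj_pair)
  show "(\<pi> a, \<pi> b) \<notin> invs n \<pi>"
    using ab' signed_permsD(6)[OF p] by (auto simp: invs_iff)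
qed

lemma lower_cover:
  assumes p: "\<pi> \<in> signed_perms n" and ab: "adj n a b" and less: "\<pi> b < \<pi> a"
  shows "\<exists>\<sigma> \<in> signed_perms n. invs n \<pi> = invs n \<sigma> \<union> {(\<pi> b, \<pi> a), (- \<pi> a, - \<pi> b)} \<and>
    (\<pi> b, \<pi> a) \<notin> invs n \<sigma>"
proof -
  have ab': "a \<noteq> 0" "b \<noteq> 0" "a < b" using ab by (auto simp: adj_def labels_iff)
  let ?\<sigma> = "\<pi> \<circ> sw a b"
  have s: "?\<sigma> \<in> signed_perms n" by (rule comp_sw_signed_perms[OF p ab])
  have "?\<sigma> \<circ> sw a b = \<pi>" using ab' by (auto simp: fun_eq_iff sw_sw)
  moreover have "?\<sigma> a = \<pi> b" "?\<sigma> b = \<pi> a" by (auto simp: sw_def)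
  ultimately show ?thesis using invs_comp_sw[OF s ab] less s by metis
qed

lemma weak_cover_iff:
  assumes "1 \<le> n"
  shows "weak_cover n \<pi> \<sigma> \<longleftrightarrow>
    \<pi> \<in> signed_perms n \<and> (\<exists>a b. adj n a b \<and> \<pi> a < \<pi> b \<and> \<sigma> = \<pi> \<circ> sw a b)"
proof -
  have t1: "transpose (-1) 1 = sw (-1) 1" by (auto simp: fun_eq_iff sw_def transpose_def)
  have t2: "transpose i (i + 1) \<circ> transpose (- i - 1) (- i) = sw i (i + 1)" if "1 \<le> i" for i
    using that by (auto simp: fun_eq_iff sw_def transpose_def)
  have a1: "adj n (-1) 1" using assms by (auto simp: adj_iff labels_iff)
  have a2: "adj n i (i + 1)" if "1 \<le> i" "i \<le> int n - 1" for i
    using that by (auto simp: adj_iff labels_iff)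
  show ?thesis
  proof
    assume "weak_cover n \<pi> \<sigma>"
    then show "\<pi> \<in> signed_perms n \<and> (\<exists>a b. adj n a b \<and> \<pi> a < \<pi> b \<and> \<sigma> = \<pi> \<circ> sw a b)"
      unfolding weak_cover_def using a1 a2 t1 t2 by (metis comp_assoc)
  next
    assume "\<pi> \<in> signed_perms n \<and> (\<exists>a b. adj n a b \<and> \<pi> a < \<pi> b \<and> \<sigma> = \<pi> \<circ> sw a b)"
    then obtain a b where h: "\<pi> \<in> signed_perms n" "adj n a b" "\<pi> a < \<pi> b" "\<sigma> = \<pi> \<circ> sw a b"
      by blast
    consider "a = -1" "b = 1" | "1 \<le> a" "b = a + 1" | "a \<le> - 2" "b = a + 1"
      using h(2) by (auto simp: adj_iff labels_iff) linarith
    then show "weak_cover n \<pi> \<sigma>"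
    proof cases
      case 1
      then show ?thesis using h t1 by (auto simp: weak_cover_def)
    next
      case 2
      then show ?thesis using h t2[of a] unfolding weak_cover_def
        by (metis adj_def add_le_imp_le_diff comp_assoc labels_iff)
    next
      case 3
      then have "sw a b = sw (- b) (- b + 1)" using sw_flip[OF h(2)] by simp
      moreover have "1 \<le> - b" "- b \<le> int n - 1" using h 3 by (auto simp: adj_iff labels_iff)
      moreover have "\<pi> (- b) < \<pi> (- b + 1)"
        using h(3) 3 signed_permsD(2)[OF h(1), of b] signed_permsD(2)[OF h(1), of a] by simp
      ultimately show ?thesis using h t2[of "- b"] unfolding weak_cover_def by (metis comp_assoc)
    qed
  qed
qed

text \<open>For the converse, climb from \<pi> to \<sigma> by induction on the number of missing
  inversions. If \<pi> \<noteq> \<sigma>, two consecutive entries of \<pi> stand in the opposite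
  order in \<sigma>; as the inversions of \<pi> are among those of \<sigma>, they form an ascent,
  and swapping them stays below \<sigma>.\<close>

lemma weak_order_iff:
  assumes n: "1 \<le> n" and p: "\<pi> \<in> signed_perms n"
  shows "(weak_cover n)\<^sup>*\<^sup>* \<pi> \<sigma> \<longleftrightarrow> \<sigma> \<in> signed_perms n \<and> invs n \<pi> \<subseteq> invs n \<sigma>"
proof
  assume "(weak_cover n)\<^sup>*\<^sup>* \<pi> \<sigma>"
  then show "\<sigma> \<in> signed_perms n \<and> invs n \<pi> \<subseteq> invs n \<sigma>"
  proof (induction rule: rtranclp_induct)
    case (step \<sigma> \<tau>)
    then obtain a b where h: "adj n a b" "\<sigma> a < \<sigma> b" "\<tau> = \<sigma> \<circ> sw a b"
      using weak_cover_iff[OF n] by blast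
    have s: "\<sigma> \<in> signed_perms n" using step by blast
    show ?case using comp_sw_signed_perms(1)[OF s h(1)] invs_comp_sw(1)[OF s h(1,2)] step
      unfolding h(3) by blast
  qed (use p in simp)
next
  assume "\<sigma> \<in> signed_perms n \<and> invs n \<pi> \<subseteq> invs n \<sigma>"
  then have s: "\<sigma> \<in> signed_perms n" and sub: "invs n \<pi> \<subseteq> invs n \<sigma>" by auto
  show "(weak_cover n)\<^sup>*\<^sup>* \<pi> \<sigma>"
    using p sub
  proof (induction "card (invs n \<sigma> - invs n \<pi>)" arbitrary: \<pi> rule: less_induct)
    case less
    show ?case
    proof (cases "\<sigma> = \<pi>")
      case False
      then obtain a b where ab: "adj n a b" "\<not> inv \<sigma> (\<pi> a) < inv \<sigma> (\<pi> b)"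
        using eq_if_order_preserving[OF less(2) s]
          strict_mono_labelsI[of n "\<lambda>i. inv \<sigma> (\<pi> i)"] by blast
      have lab: "a \<in> labels n" "b \<in> labels n" "a < b" using ab by (auto simp: adj_def)
      have ne: "inv \<sigma> (\<pi> a) \<noteq> inv \<sigma> (\<pi> b)"
        using lab signed_permsD(9)[OF less(2)] signed_permsD(10)[OF s] by auto
      have asc: "\<pi> a < \<pi> b"
      proof (rule ccontr)
        assume "\<not> \<pi> a < \<pi> b"
        then have "\<pi> b < \<pi> a" using lab signed_permsD(9)[OF less(2), of a b] by auto
        then have "(\<pi> b, \<pi> a) \<in> invs n \<pi>" using lab signed_permsD[OF less(2)] by (auto simp: invs_iff)
        then have "(\<pi> b, \<pi> a) \<in> invs n \<sigma>" using less(3) by blast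
        then show False using ab(2) by (simp add: invs_iff)
      qed
      let ?\<tau> = "\<pi> \<circ> sw a b"
      have in_\<sigma>: "(\<pi> a, \<pi> b) \<in> invs n \<sigma>"
        using asc lab ab(2) ne signed_permsD(7)[OF less(2)] by (auto simp: invs_iff)
      then have sub: "invs n ?\<tau> \<subseteq> invs n \<sigma>"
        using invs_comp_sw(1)[OF less(2) ab(1) asc] less(3) biclosed_sym[OF invs_biclosed[OF s]]
        by auto
      have "invs n \<sigma> - invs n ?\<tau> \<subset> invs n \<sigma> - invs n \<pi>"
        using invs_comp_sw[OF less(2) ab(1) asc] in_\<sigma> by auto
      then have "card (invs n \<sigma> - invs n ?\<tau>) < card (invs n \<sigma> - invs n \<pi>)"
        by (rule psubset_card_mono[rotated])
           (auto simp: invs_def intro: finite_subset[OF _ finite_lpairs])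
      then have "(weak_cover n)\<^sup>*\<^sup>* ?\<tau> \<sigma>"
        using less(1) comp_sw_signed_perms(1)[OF less(2) ab(1)] sub by blast
      moreover have "weak_cover n \<pi> ?\<tau>" using weak_cover_iff[OF n] less(2) ab asc by blast
      ultimately show ?thesis by (meson converse_rtranclp_into_rtranclp)
    qed simp
  qed
qed

section \<open>Joins and meets in the weak order\<close>

lemma weak_order_simps [simp]:
  "carrier (weak_order_B n) = signed_perms n" "eq (weak_order_B n) = (=)"
  by (simp_all add: weak_order_B_def)

lemma weak_order_le:
  "1 \<le> n \<Longrightarrow> x \<in> signed_perms n \<Longrightarrow> x \<sqsubseteq>\<^bsub>weak_order_B n\<^esub> y \<longleftrightarrow> y \<in> signed_perms n \<and> invs n x \<subseteq> invs n y"
  by (simp add: weak_order_B_def weak_order_iff)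

lemma biclosed_join_realize:
  assumes "x \<in> signed_perms n" "y \<in> signed_perms n"
  obtains z where "z \<in> signed_perms n" "invs n z = (invs n x \<union> invs n y)\<^sup>+"
  using biclosed_realize[OF biclosed_join[OF invs_biclosed invs_biclosed]] assms by metis

lemma biclosed_meet_realize:
  assumes "x \<in> signed_perms n" "y \<in> signed_perms n"
  obtains z where "z \<in> signed_perms n"
    "lpairs n - invs n z = ((lpairs n - invs n x) \<union> (lpairs n - invs n y))\<^sup>+"
proof -
  have b: "biclosed n (((lpairs n - invs n x) \<union> (lpairs n - invs n y))\<^sup>+)"
    using assms by (intro biclosed_join biclosed_compl invs_biclosed)
  then show ?thesis
    using that biclosed_realize[OF biclosed_compl[OF b]] biclosed_compl_compl[OF b] by metis
qed

lemma invs_sub: "invs n x \<subseteq> lpairs n"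
  by (auto simp: invs_def)

lemma weak_order_lub:
  assumes n: "1 \<le> n" and "x \<in> signed_perms n" "y \<in> signed_perms n" "z \<in> signed_perms n"
    and z: "invs n z = (invs n x \<union> invs n y)\<^sup>+"
  shows "least (weak_order_B n) z (Order.Upper (weak_order_B n) {x, y})"
proof -
  have "(invs n x \<union> invs n y)\<^sup>+ \<subseteq> invs n w" if "w \<in> signed_perms n" "invs n x \<subseteq> invs n w" "invs n y \<subseteq> invs n w" for w
    using trancl_mono_subset[of "invs n x \<union> invs n y" "invs n w"] that invs_biclosed[of w n]
    by (simp add: biclosed_def trancl_id)
  then show ?thesis
    using assms by (auto simp: least_def Order.Upper_def weak_order_le)
qed

lemma weak_order_glb:
  assumes n: "1 \<le> n" and "x \<in> signed_perms n" "y \<in> signed_perms n" "z \<in> signed_perms n"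
    and z: "lpairs n - invs n z = ((lpairs n - invs n x) \<union> (lpairs n - invs n y))\<^sup>+"
  shows "greatest (weak_order_B n) z (Lower (weak_order_B n) {x, y})"
proof -
  let ?N = "\<lambda>w. lpairs n - invs n w"
  have "?N z \<subseteq> ?N w" if "w \<in> signed_perms n" "invs n w \<subseteq> invs n x" "invs n w \<subseteq> invs n y" for w
    using trancl_mono_subset[of "?N x \<union> ?N y" "?N w"] that invs_biclosed[of w n]
    unfolding z by (auto simp: biclosed_def trancl_id)
  then have "invs n w \<subseteq> invs n z" if "w \<in> signed_perms n" "invs n w \<subseteq> invs n x" "invs n w \<subseteq> invs n y" for w
    using that invs_sub[of n w] by blast
  moreover have "?N x \<subseteq> ?N z" "?N y \<subseteq> ?N z" unfolding z by auto
  then have "invs n z \<subseteq> invs n x" "invs n z \<subseteq> invs n y" using invs_sub[of n z] by blast+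
  ultimately have
    "\<forall>w \<in> signed_perms n. w \<sqsubseteq>\<^bsub>weak_order_B n\<^esub> x \<and> w \<sqsubseteq>\<^bsub>weak_order_B n\<^esub> y \<longrightarrow> w \<sqsubseteq>\<^bsub>weak_order_B n\<^esub> z"
    "z \<sqsubseteq>\<^bsub>weak_order_B n\<^esub> x" "z \<sqsubseteq>\<^bsub>weak_order_B n\<^esub> y"
    using assms(1-4) by (simp_all add: weak_order_le)
  then show ?thesis
    using assms(2-4) by (auto simp: greatest_def Lower_def)
qed

lemma weak_order_lattice:
  assumes n: "1 \<le> n"
  shows "lattice (weak_order_B n)"
proof
  fix x y z a b
  let ?P = "weak_order_B n"
  show "x .=\<^bsub>?P\<^esub> x" if "x \<in> carrier ?P" using that by simp
  show "x .=\<^bsub>?P\<^esub> y \<Longrightarrow> y .=\<^bsub>?P\<^esub> x" by simp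
  show "x .=\<^bsub>?P\<^esub> y \<Longrightarrow> y .=\<^bsub>?P\<^esub> z \<Longrightarrow> x .=\<^bsub>?P\<^esub> z" by simp
  show "x \<sqsubseteq>\<^bsub>?P\<^esub> x" if "x \<in> carrier ?P" using that n by (simp add: weak_order_le)
  show "x .=\<^bsub>?P\<^esub> y" if "x \<sqsubseteq>\<^bsub>?P\<^esub> y" "y \<sqsubseteq>\<^bsub>?P\<^esub> x" "x \<in> carrier ?P" "y \<in> carrier ?P"
    using that n by (auto simp: weak_order_le intro: invs_inject)
  show "x \<sqsubseteq>\<^bsub>?P\<^esub> z" if "x \<sqsubseteq>\<^bsub>?P\<^esub> y" "y \<sqsubseteq>\<^bsub>?P\<^esub> z" "x \<in> carrier ?P" "y \<in> carrier ?P" "z \<in> carrier ?P"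
    using that n by (auto simp: weak_order_le)
  show "x \<sqsubseteq>\<^bsub>?P\<^esub> z \<longleftrightarrow> y \<sqsubseteq>\<^bsub>?P\<^esub> a" if "x .=\<^bsub>?P\<^esub> y" "z .=\<^bsub>?P\<^esub> a" using that by simp
  show "(.=\<^bsub>?P\<^esub>) = (=)" by simp
  show "\<exists>s. least ?P s (Order.Upper ?P {x, y})" if "x \<in> carrier ?P" "y \<in> carrier ?P"
    using that weak_order_lub[OF n] by (metis biclosed_join_realize weak_order_simps(1))
  show "\<exists>s. greatest ?P s (Lower ?P {x, y})" if "x \<in> carrier ?P" "y \<in> carrier ?P"
    using that weak_order_glb[OF n] by (metis biclosed_meet_realize weak_order_simps(1))
qed

lemma weak_order_join:
  assumes n: "1 \<le> n" and "x \<in> signed_perms n" "y \<in> signed_perms n"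
  shows "x \<squnion>\<^bsub>weak_order_B n\<^esub> y \<in> signed_perms n"
    "invs n (x \<squnion>\<^bsub>weak_order_B n\<^esub> y) = (invs n x \<union> invs n y)\<^sup>+"
proof -
  interpret lattice "weak_order_B n" using weak_order_lattice[OF n] .
  obtain z where z: "z \<in> signed_perms n" "invs n z = (invs n x \<union> invs n y)\<^sup>+"
    using biclosed_join_realize assms by metis
  have "x \<squnion>\<^bsub>weak_order_B n\<^esub> y = z"
    by (rule joinI) (use weak_order_lub[OF n assms(2,3) z] least_unique assms in auto)
  then show "x \<squnion>\<^bsub>weak_order_B n\<^esub> y \<in> signed_perms n"
    "invs n (x \<squnion>\<^bsub>weak_order_B n\<^esub> y) = (invs n x \<union> invs n y)\<^sup>+"
    using z by auto
qed

lemma weak_order_meet: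
  assumes n: "1 \<le> n" and "x \<in> signed_perms n" "y \<in> signed_perms n"
  shows "x \<sqinter>\<^bsub>weak_order_B n\<^esub> y \<in> signed_perms n"
    "lpairs n - invs n (x \<sqinter>\<^bsub>weak_order_B n\<^esub> y) = ((lpairs n - invs n x) \<union> (lpairs n - invs n y))\<^sup>+"
proof -
  interpret lattice "weak_order_B n" using weak_order_lattice[OF n] .
  obtain z where z: "z \<in> signed_perms n"
      "lpairs n - invs n z = ((lpairs n - invs n x) \<union> (lpairs n - invs n y))\<^sup>+"
    using biclosed_meet_realize assms by metis
  have "x \<sqinter>\<^bsub>weak_order_B n\<^esub> y = z"
    by (rule meetI) (use weak_order_glb[OF n assms(2,3) z] greatest_unique assms in auto)
  then show "x \<sqinter>\<^bsub>weak_order_B n\<^esub> y \<in> signed_perms n"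
    "lpairs n - invs n (x \<sqinter>\<^bsub>weak_order_B n\<^esub> y) = ((lpairs n - invs n x) \<union> (lpairs n - invs n y))\<^sup>+"
    using z by auto
qed

section \<open>Congruences on lattices of biclosed sets\<close>

text \<open>Complementing every \<open>I x\<close> and exchanging the operations gives another instance, so each
  statement comes with its dual.\<close>

locale inv_lattice =
  fixes n :: nat and B :: "'a set" and I :: "'a \<Rightarrow> (int \<times> int) set" and jn mt :: "'a \<Rightarrow> 'a \<Rightarrow> 'a"
  assumes I_biclosed: "x \<in> B \<Longrightarrow> biclosed n (I x)"
    and I_realize: "biclosed n K \<Longrightarrow> \<exists>x \<in> B. I x = K"
    and I_inject: "x \<in> B \<Longrightarrow> y \<in> B \<Longrightarrow> I x = I y \<Longrightarrow> x = y"
    and jn_mem: "x \<in> B \<Longrightarrow> y \<in> B \<Longrightarrow> jn x y \<in> B"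
    and I_jn: "x \<in> B \<Longrightarrow> y \<in> B \<Longrightarrow> I (jn x y) = (I x \<union> I y)\<^sup>+"
    and mt_mem: "x \<in> B \<Longrightarrow> y \<in> B \<Longrightarrow> mt x y \<in> B"
    and I_mt: "x \<in> B \<Longrightarrow> y \<in> B \<Longrightarrow> lpairs n - I (mt x y) = ((lpairs n - I x) \<union> (lpairs n - I y))\<^sup>+"

text \<open>Used in contrapositive form: a set that contains \<open>a\<close> but not
  \<open>b\<close> and is closed under the steps of \<open>U\<close> rules out a chain from
  \<open>a\<close> to \<open>b\<close>. Steps increase, so only those ending at most at
  \<open>b\<close> need checking.\<close>

lemma trancl_invariant:
  assumes "(a, b) \<in> U\<^sup>+" "U \<subseteq> lpairs n" "a \<in> S"
    and step: "\<And>v w. v \<in> S \<Longrightarrow> (v, w) \<in> U \<Longrightarrow> w \<le> b \<Longrightarrow> w \<in> S"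
  shows "b \<in> S"
proof -
  have "(a, v) \<in> U\<^sup>+ \<Longrightarrow> v \<le> b \<Longrightarrow> v \<in> S" for v
  proof (induction rule: trancl_induct)
    case (base y) then show ?case using step assms(3) by blast
  next
    case (step y z)
    then have "y < z" using assms(2) by (auto simp: lpairs_def)
    then show ?case using step assms(4)[of y z] by simp
  qed
  then show ?thesis using assms(1) by blast
qed

context inv_lattice
begin

lemma dual: "inv_lattice n B (\<lambda>x. lpairs n - I x) mt jn"
proof
  fix x y K assume "x \<in> B"
  then show "biclosed n (lpairs n - I x)" by (simp add: I_biclosed biclosed_compl)
  assume "y \<in> B"
  show "x = y" if "lpairs n - I x = lpairs n - I y"
    using that \<open>x \<in> B\<close> \<open>y \<in> B\<close> by (metis I_inject I_biclosed biclosed_compl_compl)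
  show "mt x y \<in> B" "jn x y \<in> B"
    "lpairs n - I (mt x y) = (lpairs n - I x \<union> (lpairs n - I y))\<^sup>+"
    using \<open>x \<in> B\<close> \<open>y \<in> B\<close> by (simp_all add: mt_mem jn_mem I_mt)
  show "lpairs n - (lpairs n - I (jn x y)) = (lpairs n - (lpairs n - I x) \<union> (lpairs n - (lpairs n - I y)))\<^sup>+"
    using \<open>x \<in> B\<close> \<open>y \<in> B\<close>
    using biclosed_compl_compl[OF biclosed_join[OF I_biclosed I_biclosed]]
    by (simp add: I_jn biclosed_compl_compl[OF I_biclosed])
next
  fix K assume "biclosed n K"
  then show "\<exists>x \<in> B. lpairs n - I x = K"
    by (metis I_realize biclosed_compl biclosed_compl_compl)
qed

lemma I_sub: "x \<in> B \<Longrightarrow> I x \<subseteq> lpairs n"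
  using I_biclosed by (auto simp: biclosed_def)

lemma I_jn_upper: "x \<in> B \<Longrightarrow> y \<in> B \<Longrightarrow> I x \<subseteq> I (jn x y)" "x \<in> B \<Longrightarrow> y \<in> B \<Longrightarrow> I y \<subseteq> I (jn x y)"
  by (auto simp: I_jn)

lemma I_jn_least:
  assumes "x \<in> B" "y \<in> B" "z \<in> B" "I x \<subseteq> I z" "I y \<subseteq> I z"
  shows "I (jn x y) \<subseteq> I z"
  using assms trancl_mono_subset[of "I x \<union> I y" "I z"] I_biclosed[of z]
  by (simp add: I_jn biclosed_def trancl_id)

lemma I_mt_lower: "x \<in> B \<Longrightarrow> y \<in> B \<Longrightarrow> I (mt x y) \<subseteq> I x" "x \<in> B \<Longrightarrow> y \<in> B \<Longrightarrow> I (mt x y) \<subseteq> I y"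
proof -
  assume B: "x \<in> B" "y \<in> B"
  have "lpairs n - I x \<subseteq> lpairs n - I (mt x y)" "lpairs n - I y \<subseteq> lpairs n - I (mt x y)"
    unfolding I_mt[OF B] by auto
  then show "I (mt x y) \<subseteq> I x" "I (mt x y) \<subseteq> I y" using I_sub[OF mt_mem[OF B]] by auto
qed

lemma I_mt_greatest:
  assumes "x \<in> B" "y \<in> B" "z \<in> B" "I z \<subseteq> I x" "I z \<subseteq> I y"
  shows "I z \<subseteq> I (mt x y)"
proof -
  have "lpairs n - I (mt x y) \<subseteq> lpairs n - I z"
    using inv_lattice.I_jn_least[OF dual, of x y z] assms by blast
  then show ?thesis using I_sub[OF assms(3)] by blast
qed

lemma jn_absorb: "x \<in> B \<Longrightarrow> y \<in> B \<Longrightarrow> I y \<subseteq> I x \<Longrightarrow> jn x y = x"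
  by (intro I_inject) (auto simp: jn_mem dest: I_jn_least I_jn_upper)

text \<open>The non-inversions of a meet are chains of non-inversions of the two elements, so an
  inversion of the meet is established by a set \<open>S\<close> that separates \<open>a\<close>
  from \<open>b\<close>.\<close>

lemma mt_memI:
  assumes "x \<in> B" "y \<in> B" "(a, b) \<in> lpairs n" "a \<in> S" "b \<notin> S"
    and "\<And>v w. v \<in> S \<Longrightarrow> (v, w) \<in> lpairs n \<Longrightarrow> w \<le> b \<Longrightarrow> (v, w) \<notin> I x \<or> (v, w) \<notin> I y \<Longrightarrow> w \<in> S"
  shows "(a, b) \<in> I (mt x y)"
proof (rule ccontr)
  assume "(a, b) \<notin> I (mt x y)"
  then have "(a, b) \<in> ((lpairs n - I x) \<union> (lpairs n - I y))\<^sup>+"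
    using I_mt assms by blast
  then have "b \<in> S"
    by (rule trancl_invariant[where S = S]) (use assms in auto)
  then show False using assms(5) by blast
qed

lemma jn_notmemI:
  assumes "x \<in> B" "y \<in> B" "a \<in> S" "b \<notin> S"
    and "\<And>v w. v \<in> S \<Longrightarrow> w \<le> b \<Longrightarrow> (v, w) \<in> I x \<or> (v, w) \<in> I y \<Longrightarrow> w \<in> S"
  shows "(a, b) \<notin> I (jn x y)"
proof
  assume "(a, b) \<in> I (jn x y)"
  then have "(a, b) \<in> (I x \<union> I y)\<^sup>+" using I_jn assms by blast
  then have "b \<in> S"
    by (rule trancl_invariant[where S = S and n = n]) (use assms I_sub in auto)
  then show False using assms(4) by blast
qed

definition cov :: "'a \<Rightarrow> 'a \<Rightarrow> int \<Rightarrow> int \<Rightarrow> bool" where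
  "cov z z' a b \<longleftrightarrow> z \<in> B \<and> z' \<in> B \<and> I z = I z' \<union> {(a, b), (- b, - a)} \<and> (a, b) \<notin> I z'"

text \<open>Of the two pairs into which \<open>v\<close> splits \<open>(a, b)\<close>, at least one
  is inverted because \<open>(a, b)\<close> is inverted in \<open>z\<close>, and at most one because
  \<open>(a, b)\<close> is not inverted in \<open>z'\<close>; the two elements agree on both
  pairs.\<close>

lemma cov_split:
  assumes "cov z z' a b" "v \<in> labels n" "a < v" "v < b"
  shows "(a, v) \<in> I z' \<longleftrightarrow> (a, v) \<in> I z" "(v, b) \<in> I z' \<longleftrightarrow> (v, b) \<in> I z"
    "(v, b) \<in> I z \<longleftrightarrow> (a, v) \<notin> I z"
proof -
  show eq: "(a, v) \<in> I z' \<longleftrightarrow> (a, v) \<in> I z" "(v, b) \<in> I z' \<longleftrightarrow> (v, b) \<in> I z"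
    using assms by (auto simp: cov_def)
  have "(a, b) \<in> I z" "z \<in> B" "z' \<in> B" "(a, b) \<notin> I z'" using assms by (auto simp: cov_def)
  then show "(v, b) \<in> I z \<longleftrightarrow> (a, v) \<notin> I z"
    using biclosed_cotrans[OF I_biclosed, of z a b v] biclosed_trans[OF I_biclosed, of z' a v b] assms eq
    by blast
qed

lemma cov_dual: "cov z z' a b \<Longrightarrow> inv_lattice.cov B (\<lambda>x. lpairs n - I x) z' z a b"
proof -
  assume h: "cov z z' a b"
  then have B: "z \<in> B" "z' \<in> B" and Iz: "I z = I z' \<union> {(a, b), (- b, - a)}" and ab: "(a, b) \<notin> I z'"
    by (auto simp: cov_def)
  have "(- b, - a) \<notin> I z'" using biclosed_sym_iff[OF I_biclosed[OF B(2)], where a = a and b = b] ab by blast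
  moreover have "(a, b) \<in> lpairs n" using I_sub[OF B(1)] Iz by blast
  moreover then have "(- b, - a) \<in> lpairs n" by simp
  ultimately show ?thesis unfolding inv_lattice.cov_def[OF dual] using B Iz ab by blast
qed

end

locale inv_congruence = inv_lattice +
  fixes Th :: "('a \<times> 'a) set"
  assumes Th_equiv: "equiv B Th"
    and Th_jn: "(x, x') \<in> Th \<Longrightarrow> z \<in> B \<Longrightarrow> (jn z x, jn z x') \<in> Th"
    and Th_mt: "(x, x') \<in> Th \<Longrightarrow> z \<in> B \<Longrightarrow> (mt z x, mt z x') \<in> Th"
begin

lemma dual_congruence: "inv_congruence n B (\<lambda>x. lpairs n - I x) mt jn Th"
  by (intro inv_congruence.intro dual inv_congruence_axioms.intro Th_equiv Th_jn Th_mt)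

lemma Th_mem: "(x, y) \<in> Th \<Longrightarrow> x \<in> B \<and> y \<in> B"
  using Th_equiv by (auto simp: equiv_def refl_on_def)

lemma Th_sym: "(x, y) \<in> Th \<Longrightarrow> (y, x) \<in> Th"
  using Th_equiv by (meson equivE symE)

lemma Th_trans: "(x, y) \<in> Th \<Longrightarrow> (y, z) \<in> Th \<Longrightarrow> (x, z) \<in> Th"
  using Th_equiv by (meson equivE transE)

text \<open>The polynomial \<open>w\<close> -> \<open>jn z' (mt z w)\<close> takes values between
  \<open>z'\<close> and \<open>z\<close>, where no other element lies. It sends \<open>x\<close> to
  \<open>z\<close> and \<open>y\<close> to \<open>z'\<close>, and a congruence respects it.\<close>

lemma collapse:
  assumes cov: "cov z z' a b" and xy: "(x, y) \<in> Th"
    and ab: "(a, b) \<in> I (mt z x)" "(a, b) \<notin> I y"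
  shows "(z, z') \<in> Th"
proof -
  have B: "z \<in> B" "z' \<in> B" "x \<in> B" "y \<in> B" using cov Th_mem[OF xy] by (auto simp: cov_def)
  have Iz: "I z = I z' \<union> {(a, b), (- b, - a)}" using cov by (auto simp: cov_def)
  have M: "mt z x \<in> B" "mt z y \<in> B" using B by (auto simp: mt_mem)
  have "jn z' (mt z x) = z"
  proof (rule I_inject)
    have "(- b, - a) \<in> I (mt z x)" using biclosed_sym[OF I_biclosed[OF M(1)] ab(1)] .
    then show "I (jn z' (mt z x)) = I z"
      using I_jn_least[OF B(2) M(1) B(1)] I_jn_upper[OF B(2) M(1)] I_mt_lower[OF B(1) B(3)] ab(1)
      unfolding Iz by blast
  qed (use B M jn_mem in auto)
  moreover have "jn z' (mt z y) = z'"
  proof (rule jn_absorb[OF B(2) M(2)])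
    have "(- b, - a) \<notin> I y" using biclosed_sym_iff[OF I_biclosed[OF B(4)]] ab(2) by blast
    then show "I (mt z y) \<subseteq> I z'" using I_mt_lower[OF B(1) B(4)] ab(2) Iz by blast
  qed
  ultimately show ?thesis using Th_jn[OF Th_mt[OF xy B(1)] B(2)] by simp
qed

end

section \<open>Contraction across a right point\<close>

definition blk :: "int \<Rightarrow> int \<Rightarrow> int" where
  "blk c v = (if v < - c then - 1 else if c < v then 1 else 0)"

lemma biclosed_blk:
  assumes "0 \<le> c"
  shows "biclosed n {(i, j) \<in> lpairs n. blk c i = blk c j}"
proof (rule biclosedI)
  show "(- b, - a) \<in> {(i, j) \<in> lpairs n. blk c i = blk c j}"
    if "(a, b) \<in> {(i, j) \<in> lpairs n. blk c i = blk c j}" for a b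
    using that assms by (auto simp: lpairs_iff blk_def split: if_splits)
  show "(a, b) \<in> {(i, j) \<in> lpairs n. blk c i = blk c j} \<or> (b, d) \<in> {(i, j) \<in> lpairs n. blk c i = blk c j}"
    if "(a, d) \<in> {(i, j) \<in> lpairs n. blk c i = blk c j}" "b \<in> labels n" "a < b" "b < d" for a b d
    using that assms by (auto simp: lpairs_iff blk_def split: if_splits)
qed (auto simp: lpairs_iff)

context inv_congruence
begin

text \<open>The element \<open>y\<close> reverses each of the blocks below \<open>-c\<close>, between \<open>-c\<close> and \<open>c\<close>, and above \<open>c\<close>.
  Joining a contracted generator merges the blocks, except that \<open>c\<close> comes first and \<open>-c\<close> last.\<close>

lemma merged_blocks:
  assumes c: "1 \<le> c" "c < int n" and J: "(J, J') \<in> Th" "I J' \<subseteq> {(i, j) \<in> lpairs n. blk c i = blk c j}"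
    and gen: "if c = 1 then {(-1, 2), (-2, 2)} \<subseteq> I J else (c - 1, c + 1) \<in> I J"
  obtains x y where "(x, y) \<in> Th" "I y = {(i, j) \<in> lpairs n. blk c i = blk c j}"
    "\<And>i j. (i, j) \<in> lpairs n \<Longrightarrow> i \<noteq> c \<Longrightarrow> j \<noteq> - c \<Longrightarrow> (i, j) \<in> I x"
proof -
  obtain y where y: "y \<in> B" "I y = {(i, j) \<in> lpairs n. blk c i = blk c j}"
    using I_realize[OF biclosed_blk[of c n]] c by auto
  have JB: "J \<in> B" "J' \<in> B" using Th_mem J by auto
  define x where "x = jn y J"
  have x: "x \<in> B" using y JB by (simp add: x_def jn_mem)
  have "jn y J' = y" using jn_absorb y JB J(2) by simp
  then have xy: "(x, y) \<in> Th" using Th_jn[OF J(1) y(1)] by (simp add: x_def)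
  have Y: "(i, j) \<in> I x" if "i \<in> labels n" "j \<in> labels n" "i < j" "blk c i = blk c j" for i j
    using that I_jn_upper[OF y(1) JB(1)] y by (auto simp: x_def lpairs_iff)
  have G: "if c = 1 then {(-1, 2), (-2, 2)} \<subseteq> I x else (c - 1, c + 1) \<in> I x"
    using gen I_jn_upper[OF y(1) JB(1)] by (auto simp: x_def)
  have tr: "(u, v) \<in> I x \<Longrightarrow> (v, w) \<in> I x \<Longrightarrow> (u, w) \<in> I x" for u v w
    using biclosed_trans[OF I_biclosed[OF x]] .
  have up: "(i, j) \<in> I x" if "- c \<le> i" "i < c" "c < j" "i \<in> labels n" "j \<in> labels n" for i j
  proof -
    \<comment> \<open>The label just below \<open>c\<close>; for \<open>c = 1\<close> it is
      \<open>-1\<close>, since \<open>0\<close> is not a label.\<close>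
    define e where "e = (if c = 1 then - 1 else c - 1)"
    have "(e, c + 1) \<in> I x" using G by (auto simp: e_def)
    moreover have "i = e \<or> (i, e) \<in> I x"
      using Y[of i e] that c by (force simp: e_def blk_def labels_iff)
    moreover have "j = c + 1 \<or> (c + 1, j) \<in> I x"
      using Y[of "c + 1" j] that c by (force simp: blk_def labels_iff)
    ultimately show ?thesis using tr by blast
  qed
  have down: "(i, j) \<in> I x" if "i < - c" "- c < j" "j \<le> c" "i \<in> labels n" "j \<in> labels n" for i j
    using up[of "- j" "- i"] that biclosed_sym[OF I_biclosed[OF x], of "- j" "- i"] by auto
  \<comment> \<open>Such a pair is composed of two pairs meeting at the label \<open>1\<close>. For
    \<open>c = 1\<close> this label may not begin a pair, so \<open>(-2, 2)\<close> has to be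
    supplied by \<open>J\<close>.\<close>
  have across: "(i, j) \<in> I x" if "i < - c" "c < j" "i \<in> labels n" "j \<in> labels n" for i j
  proof (cases "c = 1")
    case True
    have "i = - 2 \<or> (i, - 2) \<in> I x" using Y[of i "-2"] that True by (force simp: blk_def labels_iff)
    moreover have "j = 2 \<or> (2, j) \<in> I x" using Y[of 2 j] that True by (force simp: blk_def labels_iff)
    moreover have "(- 2, 2) \<in> I x" using G True by simp
    ultimately show ?thesis using tr by blast
  next
    case False
    have "1 \<in> labels n" using c by (simp add: labels_iff)
    then have "(i, 1) \<in> I x" "(1, j) \<in> I x" using down[of i 1] up[of 1 j] that c False by auto
    then show ?thesis by (rule tr)
  qed
  have "(i, j) \<in> I x" if "(i, j) \<in> lpairs n" "i \<noteq> c" "j \<noteq> - c" for i j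
  proof (cases "blk c i = blk c j")
    case True then show ?thesis using Y that by (auto simp: lpairs_iff)
  next
    case False
    have ij: "i < j" using that by (simp add: lpairs_iff)
    have "\<not> j < - c" "\<not> c < i" "i < - c \<or> c < j"
      using False ij c by (auto simp: blk_def split: if_splits)
    with that(2,3) have "i < - c \<and> c < j \<or> i < - c \<and> - c < j \<and> j \<le> c \<or> - c \<le> i \<and> i < c \<and> c < j"
      by linarith
    then consider "i < - c" "c < j" | "i < - c" "- c < j" "j \<le> c" | "- c \<le> i" "i < c" "c < j"
      by blast
    then show ?thesis using across down up that by cases (auto simp: lpairs_iff)
  qed
  then show ?thesis using that xy y by blast
qed

text \<open>In \<open>z\<close> the order is \<open>c\<close>, \<open>b\<close>, \<open>a\<close>.
  Of the congruent elements \<open>x\<close> and \<open>y\<close> from \<open>merged_blocks\<close>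
  the second does not invert \<open>(a, b)\<close>, so \<open>collapse\<close> applies once the meet
  of \<open>z\<close> and \<open>x\<close> keeps \<open>(a, b)\<close>. Pairs starting at
  \<open>c\<close> may be missing from \<open>x\<close> without harm, as \<open>(c, b)\<close> is
  not inverted in \<open>z\<close>; pairs ending at \<open>-c\<close> cause the case
  distinction.\<close>

lemma right_collapse:
  assumes c: "1 \<le> c" "c < int n" and J: "(J, J') \<in> Th" "I J' \<subseteq> {(i, j) \<in> lpairs n. blk c i = blk c j}"
    and gen: "if c = 1 then {(-1, 2), (-2, 2)} \<subseteq> I J else (c - 1, c + 1) \<in> I J"
    and cov: "cov z z' a b" and acb: "a < c" "c < b" and ac: "(a, c) \<in> I z"
  shows "(z, z') \<in> Th"
proof -
  obtain x y where xy: "(x, y) \<in> Th" and Iy: "I y = {(i, j) \<in> lpairs n. blk c i = blk c j}"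
    and Ix: "\<And>i j. (i, j) \<in> lpairs n \<Longrightarrow> i \<noteq> c \<Longrightarrow> j \<noteq> - c \<Longrightarrow> (i, j) \<in> I x"
    by (rule merged_blocks[OF c J gen]) (rule that)
  have B: "x \<in> B" "y \<in> B" "z \<in> B" "z' \<in> B" and zab: "(a, b) \<in> I z" and ab': "(a, b) \<notin> I z'"
    using Th_mem[OF xy] cov by (auto simp: cov_def)
  note bz = I_biclosed[OF B(3)]
  have lab: "a \<in> labels n" "b \<in> labels n" "c \<in> labels n" and ablp: "(a, b) \<in> lpairs n"
    using biclosed_sub[OF bz zab] biclosed_sub[OF bz ac] by (auto simp: lpairs_iff)
  have cb: "(c, b) \<notin> I z" using cov_split(3)[OF cov lab(3)] acb ac by blast
  show ?thesis
  proof (cases "(a, - c) \<in> I z")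
    case False
    \<comment> \<open>Besides \<open>a\<close>, the labels above \<open>a\<close> that follow
      \<open>b\<close> in \<open>z\<close>. Chains of non-inversions of \<open>z\<close> cannot
      leave them before \<open>b\<close>; those of \<open>x\<close> add only steps from
      \<open>c\<close>, which precedes \<open>b\<close>, and steps to \<open>-c\<close>, which
      follows \<open>b\<close> in this case.\<close>
    define S where "S = {v. v = a \<or> a < v \<and> (v, b) \<in> I z}"
    have "(a, b) \<in> I (mt z x)"
    proof (rule mt_memI[OF B(3,1) ablp, of S])
      show "a \<in> S" by (simp add: S_def)
      show "b \<notin> S" using acb biclosed_sub[OF bz, of b b] by (auto simp: S_def)
      fix v w assume v: "v \<in> S" and vw: "(v, w) \<in> lpairs n" and wb: "w \<le> b"
        and d: "(v, w) \<notin> I z \<or> (v, w) \<notin> I x"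
      have w: "w \<in> labels n" "v < w" "a \<le> v" using vw v by (auto simp: lpairs_iff S_def)
      have vb: "(v, b) \<in> I z" using v zab by (auto simp: S_def)
      show "w \<in> S"
      proof (cases "(v, w) \<in> I z")
        case True
        then have "v = c \<or> w = - c" using Ix[OF vw] d by blast
        moreover have "v \<noteq> c" using vb cb by auto
        ultimately have wc: "w = - c" by blast
        then have "(w, b) \<in> I z"
          using cov_split(3)[OF cov, of w] False w c acb by auto
        then show ?thesis using w by (auto simp: S_def)
      next
        case notz: False
        then have "w \<noteq> b" using vb by auto
        then have "(w, b) \<in> I z" using biclosed_cotrans[OF bz vb w(1,2)] wb notz by auto
        then show ?thesis using w by (auto simp: S_def)
      qed
    qed
    moreover have "(a, b) \<notin> I y" using acb c by (auto simp: Iy blk_def)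
    ultimately show ?thesis using collapse[OF cov xy] by blast
  next
    case True
    \<comment> \<open>Now \<open>-c\<close> precedes \<open>a\<close>, hence also \<open>b\<close>,
      and the chain \<open>a\<close>, \<open>-c\<close>, \<open>b\<close> defeats the direct
      argument. Instead \<open>x\<close> and \<open>y\<close> are met with an element
      \<open>t\<close> that keeps \<open>(-c, b)\<close> in \<open>T\<close>; joining with
      \<open>z'\<close>, which inverts \<open>(a, -c)\<close>, then restores \<open>(a, b)\<close>
      from \<open>T\<close> but not from \<open>T'\<close>.\<close>
    have nac: "a < - c" "- c \<in> labels n" using biclosed_sub[OF bz True] by auto
    have ncb: "(- c, b) \<notin> I z" using cov_split(3)[OF cov nac(2)] nac True acb c by auto
    define R' where "R' = {v. \<bar>v\<bar> < c \<and> (v, b) \<in> I z}"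
    \<comment> \<open>This makes \<open>key\<close> odd. If \<open>v\<close> and \<open>-v\<close>
      both followed \<open>b\<close>, then \<open>(-b, b)\<close> would be inverted, and splitting
      it at \<open>-c\<close> contradicts that both \<open>c\<close> and \<open>-c\<close> precede
      \<open>b\<close>.\<close>
    have R'_anti: "- v \<notin> R'" if "v \<in> R'" for v
    proof
      assume "- v \<in> R'"
      then have "(- b, v) \<in> I z" "(v, b) \<in> I z"
        using that biclosed_sym[OF bz, of "- v" b] by (auto simp: R'_def)
      then have "(- b, b) \<in> I z" using biclosed_trans[OF bz] by blast
      then have "(- b, - c) \<in> I z"
        using biclosed_cotrans[OF bz _ nac(2), of "- b" b] ncb acb c by auto
      then show False using biclosed_sym[OF bz, of "- b" "- c"] cb by simp
    qed
    \<comment> \<open>By increasing key: labels above \<open>c\<close>, negatives of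
      \<open>R'\<close>, \<open>c\<close>, the other inner labels, \<open>-c\<close>,
      \<open>R'\<close>, labels below \<open>-c\<close>. Chains of non-inversions of
      \<open>t\<close> starting at \<open>-c\<close> can only go to \<open>R'\<close>, so
      \<open>(-c, b)\<close> survives in \<open>T\<close>; and \<open>R'\<close> has the largest key
      in the middle block, so no inversion of \<open>T'\<close> ends in it.\<close>
    define key :: "int \<Rightarrow> int" where
      "key v = (if c < v then - 3 else if v < - c then 3 else if v = c then - 1 else if v = - c then 1
        else if v \<in> R' then 2 else if - v \<in> R' then - 2 else 0)" for v
    have key_odd: "key (- v) = - key v" for v
      using c R'_anti[of v] by (auto simp: key_def)
    obtain t where t: "t \<in> B" "I t = {(i, j) \<in> lpairs n. key j < key i}"
      using I_realize[OF biclosed_key[of n key, OF key_odd]] by blast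
    define T T' where "T = mt t x" and "T' = mt t y"
    have TT': "(T, T') \<in> Th" "T \<in> B" "T' \<in> B" using Th_mt[OF xy t(1)] Th_mem by (auto simp: T_def T'_def)
    have ncbT: "(- c, b) \<in> I T"
      unfolding T_def
    proof (rule mt_memI[OF t(1) B(1), of _ _ "{v. v = - c \<or> v \<in> R'}"])
      show "(- c, b) \<in> lpairs n" using nac lab acb c by (auto simp: lpairs_iff)
      show "b \<notin> {v. v = - c \<or> v \<in> R'}" using acb c by (auto simp: R'_def)
      fix v w assume v: "v \<in> {v. v = - c \<or> v \<in> R'}" and vw: "(v, w) \<in> lpairs n"
        and d: "(v, w) \<notin> I t \<or> (v, w) \<notin> I x"
      have lt: "v < w" "- c \<le> v" "v < c" using v vw c by (auto simp: R'_def lpairs_iff)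
      then have "(v, w) \<notin> I t" using Ix[OF vw] d by auto
      then have "key v \<le> key w" using vw t by auto
      moreover have "key v \<ge> 1" using v c by (auto simp: key_def R'_def)
      ultimately have "w = - c \<or> w \<in> R'" using lt by (auto simp: key_def split: if_splits)
      then show "w \<in> {v. v = - c \<or> v \<in> R'}" by simp
    qed simp
    have anc': "(a, - c) \<in> I z'" using cov_split(1)[OF cov nac(2)] nac True acb c by auto
    have jB: "jn z' T \<in> B" "jn z' T' \<in> B" using jn_mem B TT' by auto
    have "(a, b) \<in> I (jn z' T)"
      using biclosed_trans[OF I_biclosed[OF jB(1)], of a "- c" b] anc' ncbT I_jn_upper[OF B(4) TT'(2)]
      by blast
    then have "I z \<subseteq> I (jn z' T)"
      using cov I_jn_upper(1)[OF B(4) TT'(2)] biclosed_sym[OF I_biclosed[OF jB(1)]] unfolding cov_def by auto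
    then have "(a, b) \<in> I (mt z (jn z' T))"
      using I_mt_greatest[OF B(3) jB(1) B(3)] zab by auto
    \<comment> \<open>The separating set consists of \<open>a\<close> and the larger labels that
      precede it in \<open>z'\<close>. A step of \<open>T'\<close> leaving this set below
      \<open>b\<close> would have to end in \<open>R'\<close>.\<close>
    moreover have "(a, b) \<notin> I (jn z' T')"
    proof (rule jn_notmemI[OF B(4) TT'(3), of _ "{v. v = a \<or> (a, v) \<in> I z'}"])
      show "b \<notin> {v. v = a \<or> (a, v) \<in> I z'}" using ab' acb by auto
      fix v w assume v: "v \<in> {v. v = a \<or> (a, v) \<in> I z'}" and wb: "w \<le> b"
        and d: "(v, w) \<in> I z' \<or> (v, w) \<in> I T'"
      show "w \<in> {v. v = a \<or> (a, v) \<in> I z'}"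
      proof (cases "(v, w) \<in> I z'")
        case True
        then show ?thesis using v biclosed_trans[OF I_biclosed[OF B(4)]] by blast
      next
        case False
        then have "(v, w) \<in> I t" "(v, w) \<in> I y" using d I_mt_lower[OF t(1) B(2)] by (auto simp: T'_def)
        then have vw: "(v, w) \<in> lpairs n" "blk c v = blk c w" "key w < key v" using t Iy by auto
        have av: "a \<le> v" using v biclosed_sub[OF I_biclosed[OF B(4)], of a v] by auto
        have w0: "- c \<le> w" "w \<le> c" "- c \<le> v" "v \<le> c"
          using vw(2,3) c by (auto simp: blk_def key_def split: if_splits)
        have lt: "a < w" "w < b" "w \<in> labels n" using av vw w0 acb by (auto simp: lpairs_iff)
        show ?thesis
        proof (rule ccontr)
          assume "\<not> ?thesis"
          then have wbz: "(a, w) \<notin> I z" "(w, b) \<in> I z" using cov_split[OF cov lt(3,1,2)] by auto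
          then have "w \<noteq> c" "w \<noteq> - c" using ac True by auto
          then have "w \<in> R'" using w0 wbz by (auto simp: R'_def)
          then have "key w = 2" using w0 \<open>w \<noteq> c\<close> \<open>w \<noteq> - c\<close> by (auto simp: key_def)
          then show False using vw(3) w0 by (auto simp: key_def split: if_splits)
        qed
      qed
    qed simp
    ultimately show ?thesis using collapse[OF cov Th_jn[OF TT'(1) B(4)]] by blast
  qed
qed

end

section \<open>The Cambrian projection\<close>

text \<open>The inversion set of the largest uncontracted element below an element with inversion set
  \<open>K\<close>; the predicate \<open>R\<close> singles out the right points.\<close>

definition camb :: "nat \<Rightarrow> (int \<Rightarrow> bool) \<Rightarrow> (int \<times> int) set \<Rightarrow> (int \<times> int) set" where
  "camb n R K = {(a, b) \<in> lpairs n. \<forall>r l. (r, l) \<in> lpairs n \<longrightarrow> a \<le> r \<longrightarrow> l \<le> b \<longrightarrow>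
     r = a \<or> R r \<longrightarrow> l = b \<or> \<not> R l \<longrightarrow> (r, l) \<in> K}"

lemma camb_memD:
  "(a, b) \<in> camb n R K \<Longrightarrow> (r, l) \<in> lpairs n \<Longrightarrow> a \<le> r \<Longrightarrow> l \<le> b \<Longrightarrow> r = a \<or> R r \<Longrightarrow>
    l = b \<or> \<not> R l \<Longrightarrow> (r, l) \<in> K"
  unfolding camb_def by blast

lemma camb_sub: "camb n R K \<subseteq> K"
  by (auto simp: camb_def)

lemma camb_mono: "K \<subseteq> K' \<Longrightarrow> camb n R K \<subseteq> camb n R K'"
  by (auto simp: camb_def)

lemma camb_idem: "camb n R (camb n R K) = camb n R K"
proof
  show "camb n R K \<subseteq> camb n R (camb n R K)"
  proof (rule subrelI)
    fix a b assume ab: "(a, b) \<in> camb n R K"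
    have "(r, l) \<in> camb n R K"
      if "(r, l) \<in> lpairs n" "a \<le> r" "l \<le> b" "r = a \<or> R r" "l = b \<or> \<not> R l" for r l
      unfolding camb_def using that ab by (fastforce simp: camb_def)
    moreover have "(a, b) \<in> lpairs n" using ab by (simp add: camb_def)
    ultimately show "(a, b) \<in> camb n R (camb n R K)"
      unfolding camb_def[of n R "camb n R K"] by blast
  qed
qed (rule camb_sub)

text \<open>A right point may begin a tested pair and a left point may end one, so the tests for
  \<open>(b, d)\<close>, respectively \<open>(a, b)\<close>, are among those for
  \<open>(a, d)\<close>: this is cotransitivity. For transitivity, a tested pair straddling
  \<open>b\<close> is composed of a pair tested for \<open>(a, b)\<close> and one tested for
  \<open>(b, d)\<close>.\<close>

lemma camb_biclosed:
  assumes K: "biclosed n K" and R: "\<And>v. v \<in> labels n \<Longrightarrow> R (- v) \<longleftrightarrow> \<not> R v"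
  shows "biclosed n (camb n R K)"
proof (rule biclosedI)
  show "camb n R K \<subseteq> lpairs n" by (auto simp: camb_def)
  show "(a, d) \<in> camb n R K" if "(a, b) \<in> camb n R K" "(b, d) \<in> camb n R K" for a b d
  proof -
    have lt: "(a, d) \<in> lpairs n" "a < b" "b < d" "b \<in> labels n" using that by (auto simp: camb_def lpairs_iff)
    have "(r, l) \<in> K" if h: "(r, l) \<in> lpairs n" "a \<le> r" "l \<le> d" "r = a \<or> R r" "l = d \<or> \<not> R l" for r l
    proof -
      consider "l \<le> b" | "b \<le> r" | "r < b" "b < l" by linarith
      then show ?thesis
      proof cases
        case 1
        then have "l = b \<or> \<not> R l" using h lt by auto
        then show ?thesis using h 1 \<open>(a, b) \<in> camb n R K\<close> by (auto simp: camb_def)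
      next
        case 2
        then have "r = b \<or> R r" using h lt by auto
        then show ?thesis using h 2 \<open>(b, d) \<in> camb n R K\<close> by (auto simp: camb_def)
      next
        case 3
        then have "(r, b) \<in> K" using h lt \<open>(a, b) \<in> camb n R K\<close> by (auto simp: camb_def lpairs_iff)
        moreover have "(b, l) \<in> K" using h lt 3 \<open>(b, d) \<in> camb n R K\<close> by (auto simp: camb_def lpairs_iff)
        ultimately show ?thesis using biclosed_trans[OF K] by blast
      qed
    qed
    then show ?thesis using lt by (auto simp: camb_def)
  qed
  show "(a, b) \<in> camb n R K \<or> (b, d) \<in> camb n R K"
    if "(a, d) \<in> camb n R K" "b \<in> labels n" "a < b" "b < d" for a b d
  proof (cases "R b")
    case True
    then have "(b, d) \<in> camb n R K" using that by (auto simp: camb_def lpairs_iff)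
    then show ?thesis ..
  next
    case False
    then have "(a, b) \<in> camb n R K" using that by (auto simp: camb_def lpairs_iff)
    then show ?thesis ..
  qed
  show "(- b, - a) \<in> camb n R K" if "(a, b) \<in> camb n R K" for a b
  proof -
    have "(r, l) \<in> K" if h: "(r, l) \<in> lpairs n" "- b \<le> r" "l \<le> - a" "r = - b \<or> R r" "l = - a \<or> \<not> R l" for r l
    proof -
      have "(- l, - r) \<in> lpairs n" "a \<le> - l" "- r \<le> b" "- l = a \<or> R (- l)" "- r = b \<or> \<not> R (- r)"
        using h R[of r] R[of l] by (auto simp: lpairs_iff)
      then have "(- l, - r) \<in> K" using camb_memD[OF \<open>(a, b) \<in> camb n R K\<close>] by blast
      then show ?thesis using biclosed_sym_iff[OF K] by blast
    qed
    then show ?thesis using that by (auto simp: camb_def)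
  qed
qed

section \<open>Compatibility of the projection with meets and joins\<close>

text \<open>The fibers of the projection are also fibers of the opposite one, which yields joins.
  Induction on the length of a tested pair \<open>(l, r)\<close>: if it were in \<open>K'\<close>,
  some \<open>(r', l')\<close> inside would be missing from \<open>K'\<close>, because
  \<open>(l, r)\<close> is outside \<open>camb n R K'\<close>. The shorter pairs
  \<open>(l, r')\<close> and \<open>(l', r)\<close> are not in \<open>K'\<close> by induction, so
  cotransitivity puts \<open>(r', l')\<close> into \<open>K'\<close> after all.\<close>

lemma camb_dual:
  assumes K: "biclosed n K" "biclosed n K'" and eq: "camb n R K = camb n R K'"
  shows "camb n (\<lambda>v. \<not> R v) (lpairs n - K) \<subseteq> camb n (\<lambda>v. \<not> R v) (lpairs n - K')"
proof (rule subrelI)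
  fix a b assume ab: "(a, b) \<in> camb n (\<lambda>v. \<not> R v) (lpairs n - K)"
  have "(l, r) \<notin> K'" if "(l, r) \<in> lpairs n" "a \<le> l" "r \<le> b" "l = a \<or> \<not> R l" "r = b \<or> R r" for l r
    using that
  proof (induction "nat (r - l)" arbitrary: l r rule: less_induct)
    case less
    show ?case
    proof
      assume lr: "(l, r) \<in> K'"
      have "(l, r) \<notin> K" using less.prems ab by (auto simp: camb_def)
      then have "(l, r) \<notin> camb n R K'" using eq camb_sub by blast
      then obtain r' l' where rl: "(r', l') \<in> lpairs n" "l \<le> r'" "l' \<le> r" "r' = l \<or> R r'"
          "l' = r \<or> \<not> R l'" "(r', l') \<notin> K'"
        using less.prems by (auto simp: camb_def)
      have lt: "r' < l'" "r' \<in> labels n" "l' \<in> labels n" "l < r" "l \<in> labels n" "r \<in> labels n"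
        using rl less.prems by (auto simp: lpairs_iff)
      have r'r: "(r', r) \<in> K'"
      proof (cases "r' = l")
        case False
        then have "(l, r') \<notin> K'" using rl lt less.prems by (intro less.hyps) (auto simp: lpairs_iff)
        then show ?thesis using biclosed_cotrans[OF K(2) lr lt(2)] False rl lt by auto
      qed (use lr in simp)
      then have "l' \<noteq> r" using rl by auto
      then have "(l', r) \<notin> K'" using rl lt less.prems by (intro less.hyps) (auto simp: lpairs_iff)
      then show False using biclosed_cotrans[OF K(2) r'r lt(3,1)] \<open>l' \<noteq> r\<close> rl by auto
    qed
  qed
  then show "(a, b) \<in> camb n (\<lambda>v. \<not> R v) (lpairs n - K')" using ab by (auto simp: camb_def)
qed

lemma camb_dual_iff:
  assumes K: "biclosed n K" "biclosed n K'"
  shows "camb n (\<lambda>v. \<not> R v) (lpairs n - K) = camb n (\<lambda>v. \<not> R v) (lpairs n - K') \<longleftrightarrow> camb n R K = camb n R K'"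
proof
  assume h: "camb n (\<lambda>v. \<not> R v) (lpairs n - K) = camb n (\<lambda>v. \<not> R v) (lpairs n - K')"
  have "camb n R K \<subseteq> camb n R K'" "camb n R K' \<subseteq> camb n R K"
    using camb_dual[OF biclosed_compl biclosed_compl, OF K h] camb_dual[OF biclosed_compl biclosed_compl, OF K(2,1) h[symmetric]]
      K by (simp_all add: biclosed_compl_compl)
  then show "camb n R K = camb n R K'" by blast
next
  assume "camb n R K = camb n R K'"
  then show "camb n (\<lambda>v. \<not> R v) (lpairs n - K) = camb n (\<lambda>v. \<not> R v) (lpairs n - K')"
    using camb_dual K by blast
qed

text \<open>The projection of \<open>mt x y\<close> lies below those of \<open>x\<close> and
  \<open>y\<close>, hence below \<open>x'\<close>, \<open>y'\<close> and their meet. Being its own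
  projection, it lies below the projection of that meet.\<close>

lemma (in inv_lattice) camb_mt:
  assumes R: "\<And>v. v \<in> labels n \<Longrightarrow> R (- v) \<longleftrightarrow> \<not> R v"
    and B: "x \<in> B" "x' \<in> B" "y \<in> B" "y' \<in> B"
    and "camb n R (I x) = camb n R (I x')" "camb n R (I y) = camb n R (I y')"
  shows "camb n R (I (mt x y)) \<subseteq> camb n R (I (mt x' y'))"
proof -
  obtain m where m: "m \<in> B" "I m = camb n R (I (mt x y))"
    using I_realize camb_biclosed[OF I_biclosed[OF mt_mem[OF B(1,3)]]] R by blast
  have "I m \<subseteq> I x'" "I m \<subseteq> I y'"
    unfolding m using camb_mono[OF I_mt_lower(1)[OF B(1,3)]] camb_mono[OF I_mt_lower(2)[OF B(1,3)]]
      assms camb_sub by blast+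
  then have "I m \<subseteq> I (mt x' y')" using I_mt_greatest B m by blast
  then have "camb n R (I m) \<subseteq> camb n R (I (mt x' y'))" by (rule camb_mono)
  then show ?thesis unfolding m camb_idem .
qed

lemma (in inv_lattice) camb_mt_eq:
  assumes R: "\<And>v. v \<in> labels n \<Longrightarrow> R (- v) \<longleftrightarrow> \<not> R v"
    and B: "x \<in> B" "x' \<in> B" "y \<in> B" "y' \<in> B"
    and "camb n R (I x) = camb n R (I x')" "camb n R (I y) = camb n R (I y')"
  shows "camb n R (I (mt x y)) = camb n R (I (mt x' y'))"
  using camb_mt[where R = R, OF R] B assms(6,7) by (metis subset_antisym)

lemma (in inv_lattice) camb_jn_eq:
  assumes R: "\<And>v. v \<in> labels n \<Longrightarrow> R (- v) \<longleftrightarrow> \<not> R v"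
    and B: "x \<in> B" "x' \<in> B" "y \<in> B" "y' \<in> B"
    and eq: "camb n R (I x) = camb n R (I x')" "camb n R (I y) = camb n R (I y')"
  shows "camb n R (I (jn x y)) = camb n R (I (jn x' y'))"
proof -
  have "camb n (\<lambda>v. \<not> R v) (lpairs n - I (jn x y)) = camb n (\<lambda>v. \<not> R v) (lpairs n - I (jn x' y'))"
    by (rule inv_lattice.camb_mt_eq[OF dual])
       (use R B eq in \<open>simp_all add: camb_dual_iff I_biclosed\<close>)
  then show ?thesis using B by (simp add: camb_dual_iff I_biclosed jn_mem)
qed

section \<open>The Cambrian congruence\<close>

text \<open>The right points among all labels: a negative label lies on the side opposite to its negative.\<close>

definition rt :: "int set \<Rightarrow> int \<Rightarrow> bool" where
  "rt Rpts v \<longleftrightarrow> (if 0 < v then v \<in> Rpts else - v \<notin> Rpts)"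

lemma rt_uminus: "v \<noteq> 0 \<Longrightarrow> rt Rpts (- v) \<longleftrightarrow> \<not> rt Rpts v"
  by (auto simp: rt_def)

text \<open>In a fixed set a tested pair is reached by moving one end at a time, first the left and
  then the right, so single inner labels suffice as tests.\<close>

lemma camb_eq_iff:
  assumes K: "K \<subseteq> lpairs n"
  shows "camb n R K = K \<longleftrightarrow> (\<forall>a b c. (a, b) \<in> K \<longrightarrow> c \<in> labels n \<longrightarrow> a < c \<longrightarrow> c < b \<longrightarrow>
    (if R c then (c, b) \<in> K else (a, c) \<in> K))" (is "_ \<longleftrightarrow> ?A")
proof
  assume "camb n R K = K"
  then have "(r, l) \<in> K" if "(a, b) \<in> K" "(r, l) \<in> lpairs n" "a \<le> r" "l \<le> b" "r = a \<or> R r" "l = b \<or> \<not> R l"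
    for a b r l
    using that camb_memD[of a b n R K r l] by simp
  note h = this
  show ?A
  proof (intro allI impI)
    fix a b c assume abc: "(a, b) \<in> K" "c \<in> labels n" "a < c" "c < b"
    then have "(a, c) \<in> lpairs n" "(c, b) \<in> lpairs n" using K by (auto simp: lpairs_iff)
    then show "if R c then (c, b) \<in> K else (a, c) \<in> K"
      using h[OF abc(1), of c b] h[OF abc(1), of a c] abc by auto
  qed
next
  assume A: ?A
  have "(r, l) \<in> K" if "(a, b) \<in> K" "(r, l) \<in> lpairs n" "a \<le> r" "l \<le> b" "r = a \<or> R r" "l = b \<or> \<not> R l"
    for a b r l
  proof -
    have "r \<in> labels n" "l \<in> labels n" "r < l" using that by (auto simp: lpairs_iff)
    then have "(r, b) \<in> K"
      using A[rule_format, of a b r] that by (cases "r = a") auto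
    then show ?thesis
      using A[rule_format, of r b l] that \<open>l \<in> labels n\<close> \<open>r < l\<close> by (cases "l = b") auto
  qed
  then show "camb n R K = K" using K camb_sub[of n R K] by (auto simp: camb_def)
qed

text \<open>Discrete intermediate values, used along the positions of a permutation to find a
  descent across a given value.\<close>

lemma adj_crossing:
  assumes "u \<in> labels n" "v \<in> labels n" "u < v" "P u" "\<not> P v"
  obtains p q where "adj n p q" "u \<le> p" "q \<le> v" "P p" "\<not> P q"
proof -
  have "\<exists>p q. adj n p q \<and> u \<le> p \<and> q \<le> v \<and> P p \<and> \<not> P q"
    using assms
  proof (induction "nat (v - u)" arbitrary: u rule: less_induct)
    case less
    define u' where "u' = (if u = -1 then 1 else u + 1)"
    have u': "adj n u u'" "u' \<in> labels n" "u' \<le> v" "u < u'"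
      using less.prems by (auto simp: adj_iff labels_iff u'_def)
    show ?case
    proof (cases "P u'")
      case True
      then have "u' < v" using u' less.prems by (cases "u' = v") auto
      then obtain p q where "adj n p q" "u' \<le> p" "q \<le> v" "P p" "\<not> P q"
        using less.hyps[of u'] True u' less.prems by auto
      then show ?thesis using u' by force
    qed (use u' less.prems in blast)
  qed
  then show ?thesis using that by blast
qed

text \<open>Let \<open>(a, b)\<close> and \<open>c\<close> violate \<open>camb_eq_iff\<close>. From
  the position of \<open>b\<close> to that of \<open>a\<close> the entries fall from above
  \<open>c\<close> to below it, so two consecutive ones jump over \<open>c\<close>. The label
  \<open>c\<close> stands outside this range of positions, on the forbidden side, and so it is on
  that side of the descent as well.\<close>

lemma bad_descent:
  assumes x: "x \<in> signed_perms n" and ne: "camb n R (invs n x) \<noteq> invs n x"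
  obtains p q c where "adj n p q" "x q < c" "c < x p" "c \<in> labels n"
    "if R c then (x q, c) \<in> invs n x else (c, x p) \<in> invs n x"
proof -
  note sp = signed_permsD[OF x]
  obtain a b c where ab: "(a, b) \<in> invs n x" and c: "c \<in> labels n" "a < c" "c < b"
    and bad: "\<not> (if R c then (c, b) \<in> invs n x else (a, c) \<in> invs n x)"
    using ne camb_eq_iff[OF invs_sub] by blast
  define u v w where "u = inv x b" and "v = inv x a" and "w = inv x c"
  have lab: "u \<in> labels n" "v \<in> labels n" "w \<in> labels n" "u < v"
    using ab c sp(8) by (auto simp: invs_iff u_def v_def w_def)
  have xs: "x u = b" "x v = a" "x w = c" by (auto simp: u_def v_def w_def sp)
  have w: "if R c then w < u else v < w"
    using bad c ab lab xs sp(10)[of c b] sp(10)[of c a]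
    by (auto simp: invs_iff u_def[symmetric] v_def[symmetric] w_def[symmetric] split: if_splits)
  obtain p q where pq: "adj n p q" "u \<le> p" "q \<le> v" "c < x p" "\<not> c < x q"
    using adj_crossing[OF lab(1,2,4), of "\<lambda>p. c < x p"] xs c by auto
  have "p < q" using pq by (auto simp: adj_def)
  then have "x q \<noteq> c" using w pq sp(6)[of q] by (auto simp: w_def split: if_splits)
  then have "x q < c" using pq by auto
  moreover have "if R c then (x q, c) \<in> invs n x else (c, x p) \<in> invs n x"
    using w pq \<open>p < q\<close> \<open>x q < c\<close> c sp(6,7)
    by (auto simp: invs_iff adj_def w_def[symmetric])
  ultimately show ?thesis using that pq c by blast
qed

section \<open>The projection congruence and join-irreducible elements\<close>

lemma weak_order_inv_lattice:
  assumes "1 \<le> n"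
  shows "inv_lattice n (signed_perms n) (invs n) (join (weak_order_B n)) (meet (weak_order_B n))"
  by unfold_locales
     (use assms in \<open>auto simp: invs_biclosed weak_order_join weak_order_meet
       intro: invs_inject dest: biclosed_realize\<close>)

lemma weak_order_inv_congruence:
  assumes n: "1 \<le> n" and T: "lattice_congruence (weak_order_B n) \<Theta>"
  shows "inv_congruence n (signed_perms n) (invs n) (join (weak_order_B n)) (meet (weak_order_B n)) \<Theta>"
proof -
  have eq: "equiv (signed_perms n) \<Theta>" using T by (simp add: lattice_congruence_def)
  then have refl: "(z, z) \<in> \<Theta>" if "z \<in> signed_perms n" for z
    using that by (simp add: equiv_def refl_on_def)
  show ?thesis
    using T refl eq
    by (intro inv_congruence.intro weak_order_inv_lattice[OF n] inv_congruence_axioms.intro)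
       (auto simp: lattice_congruence_def)
qed

definition camb_cong :: "nat \<Rightarrow> (int \<Rightarrow> bool) \<Rightarrow> ((int \<Rightarrow> int) \<times> (int \<Rightarrow> int)) set" where
  "camb_cong n R = {(x, y). x \<in> signed_perms n \<and> y \<in> signed_perms n \<and>
     camb n R (invs n x) = camb n R (invs n y)}"

lemma camb_cong_lattice_congruence:
  assumes n: "1 \<le> n" and R: "\<And>v. v \<in> labels n \<Longrightarrow> R (- v) \<longleftrightarrow> \<not> R v"
  shows "lattice_congruence (weak_order_B n) (camb_cong n R)"
proof -
  interpret inv_lattice n "signed_perms n" "invs n" "join (weak_order_B n)" "meet (weak_order_B n)"
    by (rule weak_order_inv_lattice[OF n])
  have "equiv (signed_perms n) (camb_cong n R)"
    by (rule equivI) (auto simp: camb_cong_def refl_on_def sym_def trans_def)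
  then show ?thesis
    using camb_mt_eq[where R = R, OF R] camb_jn_eq[where R = R, OF R] mt_mem jn_mem
    by (auto simp: lattice_congruence_def camb_cong_def)
qed

text \<open>For a pair \<open>(x, y)\<close> related in this way, \<open>x\<close> is join-irreducible and \<open>y\<close> is its only lower cover.\<close>

definition irr :: "nat \<Rightarrow> (int \<Rightarrow> int) \<Rightarrow> (int \<Rightarrow> int) \<Rightarrow> int \<Rightarrow> int \<Rightarrow> bool" where
  "irr n x y a b \<longleftrightarrow> x \<in> signed_perms n \<and> y \<in> signed_perms n \<and>
     invs n x = invs n y \<union> {(a, b), (- b, - a)} \<and> (a, b) \<notin> invs n y \<and>
     (\<forall>K. biclosed n K \<longrightarrow> K \<subseteq> invs n x \<longrightarrow> (a, b) \<in> K \<longrightarrow> invs n x \<subseteq> K)"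

lemma irr_below:
  assumes "irr n x y a b" "biclosed n K" "K \<subset> invs n x"
  shows "K \<subseteq> invs n y"
proof -
  have "(a, b) \<notin> K" using assms by (auto simp: irr_def)
  moreover then have "(- b, - a) \<notin> K" using biclosed_sym_iff[OF assms(2)] by blast
  ultimately show ?thesis using assms by (auto simp: irr_def)
qed

text \<open>If \<open>x\<close> is congruent to a smaller \<open>z\<close>, then \<open>z\<close>
  lies below the only lower cover \<open>y\<close>, and joining both sides with \<open>y\<close>
  makes \<open>x\<close> congruent to \<open>y\<close>.\<close>

lemma irr_contracts:
  assumes n: "1 \<le> n" and xy: "irr n x y a b" and T: "lattice_congruence (weak_order_B n) \<Theta>"
  shows "contracts (weak_order_B n) \<Theta> x \<longleftrightarrow> (x, y) \<in> \<Theta>"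
proof
  interpret inv_congruence n "signed_perms n" "invs n" "join (weak_order_B n)" "meet (weak_order_B n)" \<Theta>
    by (rule weak_order_inv_congruence[OF n T])
  have B: "x \<in> signed_perms n" "y \<in> signed_perms n" using xy by (auto simp: irr_def)
  { assume "contracts (weak_order_B n) \<Theta> x"
    then obtain z where z: "z \<in> signed_perms n" "(x, z) \<in> \<Theta>" "invs n z \<subseteq> invs n x" "z \<noteq> x"
      using n by (auto simp: contracts_def lless_def weak_order_le)
    then have "invs n z \<subset> invs n x" using invs_inject B by blast
    then have "invs n z \<subseteq> invs n y" using irr_below[OF xy invs_biclosed] z by blast
    then have "y \<squnion>\<^bsub>weak_order_B n\<^esub> z = y" using jn_absorb z B by blast
    moreover have "y \<squnion>\<^bsub>weak_order_B n\<^esub> x = x \<squnion>\<^bsub>weak_order_B n\<^esub> y" by (rule join_comm)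
    moreover have "\<dots> = x" using jn_absorb B xy by (auto simp: irr_def)
    ultimately show "(x, y) \<in> \<Theta>" using Th_jn[OF z(2) B(2)] by simp }
  show "contracts (weak_order_B n) \<Theta> x" if "(x, y) \<in> \<Theta>"
    using that xy n unfolding contracts_def irr_def
    by (intro bexI[of _ y]) (auto simp: lless_def weak_order_le)
qed

text \<open>Once the projection of \<open>x\<close> loses a pair, it lies below \<open>y\<close>, so
  \<open>x\<close> and \<open>y\<close> have the same projection.\<close>

lemma irr_camb_cong:
  assumes R: "\<And>v. v \<in> labels n \<Longrightarrow> R (- v) \<longleftrightarrow> \<not> R v"
    and xy: "irr n x y a b" and ne: "(a, b) \<notin> camb n R (invs n x)"
  shows "(x, y) \<in> camb_cong n R"
proof -
  have B: "x \<in> signed_perms n" "y \<in> signed_perms n" using xy by (auto simp: irr_def)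
  have "camb n R (invs n x) \<subset> invs n x" using ne xy camb_sub by (fastforce simp: irr_def)
  then have "camb n R (invs n x) \<subseteq> invs n y"
    using irr_below[OF xy camb_biclosed[OF invs_biclosed[OF B(1)]]] R by blast
  then have "camb n R (invs n x) \<subseteq> camb n R (invs n y)"
    using camb_mono camb_idem by metis
  moreover have "camb n R (invs n y) \<subseteq> camb n R (invs n x)"
    by (rule camb_mono) (use xy in \<open>auto simp: irr_def\<close>)
  ultimately show ?thesis using B by (auto simp: camb_cong_def)
qed

lemma notin_camb:
  assumes "c \<in> labels n" "a < c" "c < b" "if R c then (c, b) \<notin> K else (a, c) \<notin> K"
  shows "(a, b) \<notin> camb n R K"
proof
  assume h: "(a, b) \<in> camb n R K"
  then have "a \<in> labels n" "b \<in> labels n" by (auto simp: camb_def lpairs_iff)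
  then show False
    using camb_memD[OF h, of c b] camb_memD[OF h, of a c] assms by (auto simp: lpairs_iff split: if_splits)
qed

subsection \<open>The generators\<close>

text \<open>Each generator is paired with its only lower cover, obtained by dropping the last letter
  of its word. For the label \<open>1\<close> the two pairs form a chain, by which the longer
  generator becomes congruent to a simple reflection.\<close>

definition gen_pairs :: "nat \<Rightarrow> int set \<Rightarrow> int set \<Rightarrow> ((int \<Rightarrow> int) \<times> (int \<Rightarrow> int)) set" where
  "gen_pairs n Lpts Rpts =
     (if 1 \<in> Rpts then {(sw (-1) 1 \<circ> sw 1 2, sw (-1) 1),
        (sw (-1) 1 \<circ> sw 1 2 \<circ> sw (-1) 1, sw (-1) 1 \<circ> sw 1 2)} else {}) \<union>
     (if 1 \<in> Lpts then {(sw 1 2 \<circ> sw (-1) 1, sw 1 2),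
        (sw 1 2 \<circ> sw (-1) 1 \<circ> sw 1 2, sw 1 2 \<circ> sw (-1) 1)} else {}) \<union>
     {(sw (i - 1) i \<circ> sw i (i + 1), sw (i - 1) i) | i. 2 \<le> i \<and> i \<le> int n - 1 \<and> i \<in> Rpts} \<union>
     {(sw i (i + 1) \<circ> sw (i - 1) i, sw i (i + 1)) | i. 2 \<le> i \<and> i \<le> int n - 1 \<and> i \<in> Lpts}"

lemma one_line_eqI:
  assumes len: "length xs = n" and odd: "\<And>i. f (- i) = - f i"
    and fixd: "\<And>i. int n < i \<Longrightarrow> f i = i"
    and nth: "\<And>i. 1 \<le> i \<Longrightarrow> i \<le> int n \<Longrightarrow> xs ! (nat i - 1) = f i"
  shows "one_line xs = f"
proof
  fix i
  have f0: "f 0 = 0" using odd[of 0] by simp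
  have "f i = i" if "i < - int n" using fixd[of "- i"] odd[of i] that by simp
  then show "one_line xs i = f i"
    using nth[of i] nth[of "- i"] odd[of i] fixd[of i] f0 len
    by (cases "i = 0") (auto simp: one_line_def)
qed

lemma cambrian_generators_eq:
  assumes n: "2 \<le> n"
  shows "cambrian_generators n Lpts Rpts = fst ` gen_pairs n Lpts Rpts"
proof -
  have a: "one_line ([u, v] @ [3..int n]) = f"
    if "\<And>i. f (- i) = - f i" "\<And>i. 2 < i \<Longrightarrow> f i = i" "f 1 = u" "f 2 = v" for u v f
  proof (rule one_line_eqI[where n = n])
    show "([u, v] @ [3..int n]) ! (nat i - 1) = f i" if "1 \<le> i" "i \<le> int n" for i
    proof -
      consider "i = 1" | "i = 2" | "2 < i" using \<open>1 \<le> i\<close> by linarith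
      then show ?thesis
      proof cases
        case 3
        then have "nat i - 1 = Suc (Suc (nat (i - 3)))" by linarith
        then show ?thesis using 3 that \<open>\<And>i. 2 < i \<Longrightarrow> f i = i\<close> by simp
      qed (use \<open>f 1 = u\<close> \<open>f 2 = v\<close> in auto)
    qed
  qed (use that n in auto)
  have b: "one_line ([1..i - 2] @ [u, v, w] @ [i + 2..int n]) = f"
    if i: "2 \<le> i" "i \<le> int n - 1" and odd: "\<And>j. f (- j) = - f j" and fixd: "\<And>j. i + 1 < j \<Longrightarrow> f j = j"
      "\<And>j. 1 \<le> j \<Longrightarrow> j < i - 1 \<Longrightarrow> f j = j" and uvw: "f (i - 1) = u" "f i = v" "f (i + 1) = w" for u v w f i
  proof (rule one_line_eqI[where n = n])
    show "([1..i - 2] @ [u, v, w] @ [i + 2..int n]) ! (nat j - 1) = f j" if j: "1 \<le> j" "j \<le> int n" for j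
    proof -
      consider "j < i - 1" | "j = i - 1" | "j = i" | "j = i + 1" | "i + 1 < j" using j by linarith
      then show ?thesis
      proof cases
        case 1
        then have "nat j - 1 < nat (i - 2)" "1 + int (nat j - 1) = j" using j by linarith+
        then show ?thesis using 1 fixd(2)[of j] j by (simp add: nth_append)
      next
        case 2
        then have "nat j - 1 = nat (i - 2)" using j by linarith
        then show ?thesis using 2 uvw by (simp add: nth_append)
      next
        case 3
        then have "nat j - 1 = nat (i - 2) + 1" using j i by linarith
        then show ?thesis using 3 uvw by (simp add: nth_append)
      next
        case 4
        then have "nat j - 1 = nat (i - 2) + 2" using j i by linarith
        then show ?thesis using 4 uvw by (simp add: nth_append)
      next
        case 5
        then have "nat j - 1 = nat (i - 2) + 3 + nat (j - i - 2)" using j i by linarith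
        then show ?thesis using 5 fixd(1)[of j] j by (simp add: nth_append)
      qed
    qed
    show "length ([1..i - 2] @ [u, v, w] @ [i + 2..int n]) = n" using i by simp
  qed (use odd fixd(1) i in auto)
  have "one_line ([2, -1] @ [3..int n]) = sw (-1) 1 \<circ> sw 1 2"
    "one_line ([-2, -1] @ [3..int n]) = sw (-1) 1 \<circ> sw 1 2 \<circ> sw (-1) 1"
    "one_line ([-2, 1] @ [3..int n]) = sw 1 2 \<circ> sw (-1) 1"
    "one_line ([1, -2] @ [3..int n]) = sw 1 2 \<circ> sw (-1) 1 \<circ> sw 1 2"
    by (rule a; auto simp: sw_def)+
  moreover have "one_line ([1..i - 2] @ [i, i + 1, i - 1] @ [i + 2..int n]) = sw (i - 1) i \<circ> sw i (i + 1)"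
    "one_line ([1..i - 2] @ [i + 1, i - 1, i] @ [i + 2..int n]) = sw i (i + 1) \<circ> sw (i - 1) i"
    if "2 \<le> i" "i \<le> int n - 1" for i
    by (rule b[OF that]; use that in \<open>auto simp: sw_def\<close>)+
  ultimately show ?thesis
    by (auto simp: cambrian_generators_def gen_pairs_def image_Un image_iff)
qed

lemma id_signed_perms: "id \<in> signed_perms n"
  by (simp add: signed_perms_def permutes_id)

lemma invs_sw:
  assumes "adj n a b"
  shows "sw a b \<in> signed_perms n" "invs n (sw a b) = {(a, b), (- b, - a)}"
  using comp_sw_signed_perms(1)[OF id_signed_perms assms] invs_comp_sw(1)[OF id_signed_perms assms] assms
  by (auto simp: adj_def invs_iff)

lemma irr_comp_sw:
  assumes y: "y \<in> signed_perms n" and pq: "adj n p q" and ab: "y p = a" "y q = b" "a < b"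
    and "\<And>K. biclosed n K \<Longrightarrow> (a, b) \<in> K \<Longrightarrow> K \<subseteq> insert (a, b) (insert (- b, - a) (invs n y)) \<Longrightarrow> invs n y \<subseteq> K"
  shows "irr n (y \<circ> sw p q) y a b" "invs n (y \<circ> sw p q) = insert (a, b) (insert (- b, - a) (invs n y))"
proof -
  show eq: "invs n (y \<circ> sw p q) = insert (a, b) (insert (- b, - a) (invs n y))"
    using invs_comp_sw[OF y pq] ab by auto
  show "irr n (y \<circ> sw p q) y a b"
    unfolding irr_def eq using invs_comp_sw(2)[OF y pq] comp_sw_signed_perms(1)[OF y pq] y ab assms(6)
    by (auto dest: biclosed_sym)
qed

text \<open>Irreducibility is the content of \<open>K1\<close> to \<open>K4\<close>: a biclosed
  subset with the last inversion must split it at inner labels, and so few pairs are available that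
  the splits, with mirror images and compositions, force all the others.\<close>

lemma generator_invs:
  assumes n: "2 \<le> n"
  shows "irr n (sw (-1) 1 \<circ> sw 1 2) (sw (-1) 1) (-1) 2"
    and "irr n (sw (-1) 1 \<circ> sw 1 2 \<circ> sw (-1) 1) (sw (-1) 1 \<circ> sw 1 2) (-2) 2"
    and "invs n (sw (-1) 1 \<circ> sw 1 2) = {(-1, 1), (-1, 2), (-2, 1)}"
    and "invs n (sw (-1) 1 \<circ> sw 1 2 \<circ> sw (-1) 1) = {(-1, 1), (-1, 2), (-2, 1), (-2, 2)}"
    and "irr n (sw 1 2 \<circ> sw (-1) 1) (sw 1 2) (-2) 2"
    and "irr n (sw 1 2 \<circ> sw (-1) 1 \<circ> sw 1 2) (sw 1 2 \<circ> sw (-1) 1) (-2) 1"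
    and "invs n (sw 1 2 \<circ> sw (-1) 1) = {(1, 2), (-2, -1), (-2, 2)}"
    and "invs n (sw 1 2 \<circ> sw (-1) 1 \<circ> sw 1 2) = {(1, 2), (-2, -1), (-2, 2), (-1, 2), (-2, 1)}"
proof -
  have adj: "adj n (-1) 1" "adj n 1 2" using n by (auto simp: adj_iff labels_iff)
  have lab: "1 \<in> labels n" "- 1 \<in> labels n" using n by (auto simp: labels_iff)
  note s0 = invs_sw[OF adj(1)] and s1 = invs_sw[OF adj(2)]
  note 1 = irr_comp_sw[OF s0(1) adj(2), of "-1" 2]
  have K1: "invs n (sw (-1) 1) \<subseteq> K"
    if "biclosed n K" "(-1, 2) \<in> K" "K \<subseteq> insert (- 1, 2) (insert (- 2, - (- 1)) (invs n (sw (-1) 1)))" for K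
    using biclosed_cotrans[OF that(1,2) lab(1)] that(3) by (auto simp: s0(2))
  show i1: "irr n (sw (-1) 1 \<circ> sw 1 2) (sw (-1) 1) (-1) 2"
    by (rule 1(1)) (use K1 in \<open>auto simp: sw_def\<close>)
  show e1: "invs n (sw (-1) 1 \<circ> sw 1 2) = {(-1, 1), (-1, 2), (-2, 1)}"
    by (subst 1(2)) (use K1 in \<open>auto simp: sw_def s0(2)\<close>)
  have B1: "sw (-1) 1 \<circ> sw 1 2 \<in> signed_perms n" using i1 by (simp add: irr_def)
  note 2 = irr_comp_sw[OF B1 adj(1), of "-2" 2]
  have K2: "invs n (sw (-1) 1 \<circ> sw 1 2) \<subseteq> K"
    if "biclosed n K" "(-2, 2) \<in> K" "K \<subseteq> insert (- 2, 2) (insert (- 2, - (- 2)) (invs n (sw (-1) 1 \<circ> sw 1 2)))" for K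
  proof -
    have "(- 2, 1) \<in> K" using biclosed_cotrans[OF that(1,2) lab(1)] that(3) by (auto simp: e1)
    moreover then have "(- 1, 2) \<in> K" using biclosed_sym[OF that(1), of "-2" 1] by simp
    moreover then have "(- 1, 1) \<in> K" using biclosed_cotrans[OF that(1) _ lab(1), of "-1" 2] that(3) by (auto simp: e1)
    ultimately show ?thesis by (auto simp: e1)
  qed
  show "irr n (sw (-1) 1 \<circ> sw 1 2 \<circ> sw (-1) 1) (sw (-1) 1 \<circ> sw 1 2) (-2) 2"
    by (rule 2(1)) (use K2 in \<open>auto simp: sw_def\<close>)
  show "invs n (sw (-1) 1 \<circ> sw 1 2 \<circ> sw (-1) 1) = {(-1, 1), (-1, 2), (-2, 1), (-2, 2)}"
    by (subst 2(2)) (use K2 in \<open>auto simp: sw_def e1\<close>)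
  note 3 = irr_comp_sw[OF s1(1) adj(1), of "-2" 2]
  have K3: "invs n (sw 1 2) \<subseteq> K"
    if "biclosed n K" "(-2, 2) \<in> K" "K \<subseteq> insert (- 2, 2) (insert (- 2, - (- 2)) (invs n (sw 1 2)))" for K
  proof -
    have "(1, 2) \<in> K" using biclosed_cotrans[OF that(1,2) lab(1)] that(3) by (auto simp: s1(2))
    then show ?thesis using biclosed_sym[OF that(1), of 1 2] by (auto simp: s1(2))
  qed
  show i3: "irr n (sw 1 2 \<circ> sw (-1) 1) (sw 1 2) (-2) 2"
    by (rule 3(1)) (use K3 in \<open>auto simp: sw_def\<close>)
  show e3: "invs n (sw 1 2 \<circ> sw (-1) 1) = {(1, 2), (-2, -1), (-2, 2)}"
    by (subst 3(2)) (use K3 in \<open>auto simp: sw_def s1(2)\<close>)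
  have B3: "sw 1 2 \<circ> sw (-1) 1 \<in> signed_perms n" using i3 by (simp add: irr_def)
  note 4 = irr_comp_sw[OF B3 adj(2), of "-2" 1]
  have K4: "invs n (sw 1 2 \<circ> sw (-1) 1) \<subseteq> K"
    if "biclosed n K" "(-2, 1) \<in> K" "K \<subseteq> insert (- 2, 1) (insert (- 1, - (- 2)) (invs n (sw 1 2 \<circ> sw (-1) 1)))" for K
  proof -
    have "(- 1, 1) \<notin> K" using subsetD[OF that(3), of "(- 1, 1)"] by (auto simp: e3)
    then have "(- 2, - 1) \<in> K" using biclosed_cotrans[OF that(1,2) lab(2)] by simp
    moreover then have "(1, 2) \<in> K" using biclosed_sym[OF that(1), of "-2" "-1"] by simp
    moreover then have "(- 2, 2) \<in> K" using biclosed_trans[OF that(1,2)] by blast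
    ultimately show ?thesis by (auto simp: e3)
  qed
  show "irr n (sw 1 2 \<circ> sw (-1) 1 \<circ> sw 1 2) (sw 1 2 \<circ> sw (-1) 1) (-2) 1"
    by (rule 4(1)) (use K4 in \<open>auto simp: sw_def\<close>)
  show "invs n (sw 1 2 \<circ> sw (-1) 1 \<circ> sw 1 2) = {(1, 2), (-2, -1), (-2, 2), (-1, 2), (-2, 1)}"
    by (subst 4(2)) (use K4 in \<open>auto simp: sw_def e3\<close>)
qed

lemma generator_invs_ge2:
  assumes i: "2 \<le> i" "i \<le> int n - 1"
  shows "irr n (sw (i - 1) i \<circ> sw i (i + 1)) (sw (i - 1) i) (i - 1) (i + 1)"
    and "invs n (sw (i - 1) i \<circ> sw i (i + 1)) = {(i - 1, i), (- i, 1 - i), (i - 1, i + 1), (- i - 1, 1 - i)}"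
    and "irr n (sw i (i + 1) \<circ> sw (i - 1) i) (sw i (i + 1)) (i - 1) (i + 1)"
    and "invs n (sw i (i + 1) \<circ> sw (i - 1) i) = {(i, i + 1), (- i - 1, - i), (i - 1, i + 1), (- i - 1, 1 - i)}"
proof -
  have adj: "adj n (i - 1) i" "adj n i (i + 1)" using i by (auto simp: adj_iff labels_iff)
  have lab: "i \<in> labels n" using i by (auto simp: labels_iff)
  note s0 = invs_sw[OF adj(1)] and s1 = invs_sw[OF adj(2)]
  note 1 = irr_comp_sw[OF s0(1) adj(2), of "i - 1" "i + 1"]
  have K1: "invs n (sw (i - 1) i) \<subseteq> K"
    if "biclosed n K" "(i - 1, i + 1) \<in> K"
      "K \<subseteq> insert (i - 1, i + 1) (insert (- (i + 1), - (i - 1)) (invs n (sw (i - 1) i)))" for K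
  proof -
    have "(i - 1, i) \<in> K" using biclosed_cotrans[OF that(1,2) lab] that(3) i by (auto simp: s0(2))
    then show ?thesis using biclosed_sym[OF that(1), of "i - 1" i] by (auto simp: s0(2))
  qed
  show "irr n (sw (i - 1) i \<circ> sw i (i + 1)) (sw (i - 1) i) (i - 1) (i + 1)"
    by (rule 1(1)) (use K1 i in \<open>auto simp: sw_def\<close>)
  show "invs n (sw (i - 1) i \<circ> sw i (i + 1)) = {(i - 1, i), (- i, 1 - i), (i - 1, i + 1), (- i - 1, 1 - i)}"
    by (subst 1(2)) (use K1 i in \<open>auto simp: sw_def s0(2)\<close>)
  note 3 = irr_comp_sw[OF s1(1) adj(1), of "i - 1" "i + 1"]
  have K3: "invs n (sw i (i + 1)) \<subseteq> K"
    if "biclosed n K" "(i - 1, i + 1) \<in> K"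
      "K \<subseteq> insert (i - 1, i + 1) (insert (- (i + 1), - (i - 1)) (invs n (sw i (i + 1))))" for K
  proof -
    have "(i - 1, i) \<notin> K" using subsetD[OF that(3), of "(i - 1, i)"] i by (auto simp: s1(2))
    then have "(i, i + 1) \<in> K" using biclosed_cotrans[OF that(1,2) lab] by auto
    then show ?thesis using biclosed_sym[OF that(1), of i "i + 1"] by (auto simp: s1(2))
  qed
  show "irr n (sw i (i + 1) \<circ> sw (i - 1) i) (sw i (i + 1)) (i - 1) (i + 1)"
    by (rule 3(1)) (use K3 i in \<open>auto simp: sw_def\<close>)
  show "invs n (sw i (i + 1) \<circ> sw (i - 1) i) = {(i, i + 1), (- i - 1, - i), (i - 1, i + 1), (- i - 1, 1 - i)}"
    by (subst 3(2)) (use K3 i in \<open>auto simp: sw_def s1(2)\<close>)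
qed

locale designation =
  fixes n :: nat and Lpts Rpts :: "int set"
  assumes n2: "2 \<le> n" and LR: "Lpts \<union> Rpts = {1..int n - 1}" and disj: "Lpts \<inter> Rpts = {}"
begin

lemma n1: "1 \<le> n"
  using n2 by simp

text \<open>This covers \<open>n\<close> too: being in neither set it counts as left, and
  \<open>-n\<close> as right.\<close>

lemma rt_labels: "v \<in> labels n \<Longrightarrow> rt Rpts (- v) \<longleftrightarrow> \<not> rt Rpts v"
  by (rule rt_uminus) (auto simp: labels_iff)

lemma designated: "1 \<le> i \<Longrightarrow> i < int n \<Longrightarrow> i \<in> Lpts \<longleftrightarrow> i \<notin> Rpts"
  using LR disj by fastforce

lemma rt_pos: "i \<in> Rpts \<Longrightarrow> rt Rpts i" "i \<in> Lpts \<Longrightarrow> \<not> rt Rpts i"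
proof -
  show "rt Rpts i" if "i \<in> Rpts"
  proof -
    have "i \<in> {1..int n - 1}" using that LR by blast
    then show ?thesis using that by (simp add: rt_def)
  qed
  show "\<not> rt Rpts i" if "i \<in> Lpts"
  proof -
    have "i \<in> {1..int n - 1}" "i \<notin> Rpts" using that LR disj by blast+
    then show ?thesis by (simp add: rt_def)
  qed
qed

lemma gen_pairs_irr:
  assumes "(x, y) \<in> gen_pairs n Lpts Rpts"
  obtains a b where "irr n x y a b" "(a, b) \<notin> camb n (rt Rpts) (invs n x)"
proof -
  have l1: "1 \<in> labels n" "- 1 \<in> labels n" using n2 by (auto simp: labels_iff)
  have rm: "rt Rpts (- 1) \<longleftrightarrow> \<not> rt Rpts 1" by (rule rt_uminus) simp
  note g = generator_invs[OF n2]
  have "\<exists>a b. irr n x y a b \<and> (a, b) \<notin> camb n (rt Rpts) (invs n x)"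
    using assms unfolding gen_pairs_def
  proof (elim UnE)
    assume "(x, y) \<in> (if 1 \<in> Rpts then {(sw (-1) 1 \<circ> sw 1 2, sw (-1) 1),
        (sw (-1) 1 \<circ> sw 1 2 \<circ> sw (-1) 1, sw (-1) 1 \<circ> sw 1 2)} else {})"
    then have R: "rt Rpts 1" and xy: "(x, y) = (sw (-1) 1 \<circ> sw 1 2, sw (-1) 1) \<or>
        (x, y) = (sw (-1) 1 \<circ> sw 1 2 \<circ> sw (-1) 1, sw (-1) 1 \<circ> sw 1 2)"
      by (auto simp: rt_pos split: if_splits)
    have "(-1, 2) \<notin> camb n (rt Rpts) (invs n (sw (-1) 1 \<circ> sw 1 2))"
      "(-2, 2) \<notin> camb n (rt Rpts) (invs n (sw (-1) 1 \<circ> sw 1 2 \<circ> sw (-1) 1))"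
      by (rule notin_camb[OF l1(1)]; simp add: R g(3,4))+
    then show ?thesis using g(1,2) xy by blast
  next
    assume "(x, y) \<in> (if 1 \<in> Lpts then {(sw 1 2 \<circ> sw (-1) 1, sw 1 2),
        (sw 1 2 \<circ> sw (-1) 1 \<circ> sw 1 2, sw 1 2 \<circ> sw (-1) 1)} else {})"
    then have R: "\<not> rt Rpts 1" and xy: "(x, y) = (sw 1 2 \<circ> sw (-1) 1, sw 1 2) \<or>
        (x, y) = (sw 1 2 \<circ> sw (-1) 1 \<circ> sw 1 2, sw 1 2 \<circ> sw (-1) 1)"
      by (auto simp: rt_pos split: if_splits)
    have "(-2, 2) \<notin> camb n (rt Rpts) (invs n (sw 1 2 \<circ> sw (-1) 1))"
      by (rule notin_camb[OF l1(1)]; simp add: R g(7))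
    moreover have "(-2, 1) \<notin> camb n (rt Rpts) (invs n (sw 1 2 \<circ> sw (-1) 1 \<circ> sw 1 2))"
      by (rule notin_camb[OF l1(2)]; simp add: R rm g(8))
    ultimately show ?thesis using g(5,6) xy by blast
  next
    assume "(x, y) \<in> {(sw (i - 1) i \<circ> sw i (i + 1), sw (i - 1) i) | i. 2 \<le> i \<and> i \<le> int n - 1 \<and> i \<in> Rpts}"
    then obtain i where i: "2 \<le> i" "i \<le> int n - 1" "rt Rpts i"
      and xy: "x = sw (i - 1) i \<circ> sw i (i + 1)" "y = sw (i - 1) i"
      using rt_pos by auto
    have "(i - 1, i + 1) \<notin> camb n (rt Rpts) (invs n x)"
      by (rule notin_camb[of i]) (use i in \<open>auto simp: generator_invs_ge2(2)[OF i(1,2)] xy labels_iff\<close>)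
    then show ?thesis using generator_invs_ge2(1)[OF i(1,2)] xy by blast
  next
    assume "(x, y) \<in> {(sw i (i + 1) \<circ> sw (i - 1) i, sw i (i + 1)) | i. 2 \<le> i \<and> i \<le> int n - 1 \<and> i \<in> Lpts}"
    then obtain i where i: "2 \<le> i" "i \<le> int n - 1" "\<not> rt Rpts i"
      and xy: "x = sw i (i + 1) \<circ> sw (i - 1) i" "y = sw i (i + 1)"
      using rt_pos by auto
    have "(i - 1, i + 1) \<notin> camb n (rt Rpts) (invs n x)"
      by (rule notin_camb[of i]) (use i in \<open>auto simp: generator_invs_ge2(4)[OF i(1,2)] xy labels_iff\<close>)
    then show ?thesis using generator_invs_ge2(3)[OF i(1,2)] xy by blast
  qed
  then show ?thesis using that by blast
qed

lemma contracts_generators_iff: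
  assumes T: "lattice_congruence (weak_order_B n) \<Theta>"
  shows "(\<forall>x \<in> cambrian_generators n Lpts Rpts. contracts (weak_order_B n) \<Theta> x) \<longleftrightarrow>
    gen_pairs n Lpts Rpts \<subseteq> \<Theta>"
proof -
  have "contracts (weak_order_B n) \<Theta> x \<longleftrightarrow> (x, y) \<in> \<Theta>" if "(x, y) \<in> gen_pairs n Lpts Rpts" for x y
    using gen_pairs_irr[OF that] irr_contracts[OF n1 _ T] by metis
  then show ?thesis unfolding cambrian_generators_eq[OF n2] by force
qed

text \<open>The least congruence is the intersection of all congruences containing
  \<open>gen_pairs\<close>. The projection congruence is one of these, so the family is nonempty and
  the upper bound follows.\<close>

lemma cambrian_congruence_properties:
  shows "lattice_congruence (weak_order_B n) (cambrian_congruence n Lpts Rpts)"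
    and "gen_pairs n Lpts Rpts \<subseteq> cambrian_congruence n Lpts Rpts"
    and "cambrian_congruence n Lpts Rpts \<subseteq> camb_cong n (rt Rpts)"
proof -
  define F where "F = {\<Theta>. lattice_congruence (weak_order_B n) \<Theta> \<and> gen_pairs n Lpts Rpts \<subseteq> \<Theta>}"
  have "gen_pairs n Lpts Rpts \<subseteq> camb_cong n (rt Rpts)"
  proof (rule subrelI)
    fix x y assume "(x, y) \<in> gen_pairs n Lpts Rpts"
    then show "(x, y) \<in> camb_cong n (rt Rpts)"
      using gen_pairs_irr irr_camb_cong[where R = "rt Rpts", OF rt_labels] by metis
  qed
  then have C: "camb_cong n (rt Rpts) \<in> F"
    using camb_cong_lattice_congruence[OF n1, of "rt Rpts"] rt_labels by (simp add: F_def)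
  have eq: "equiv (signed_perms n) \<Theta>" if "\<Theta> \<in> F" for \<Theta>
    using that by (simp add: F_def lattice_congruence_def)
  have "equiv (signed_perms n) (\<Inter>F)"
  proof (rule equivI)
    show "\<Inter>F \<subseteq> signed_perms n \<times> signed_perms n" using C by (auto simp: camb_cong_def)
    show "refl_on (signed_perms n) (\<Inter>F)" using eq C by (auto simp: refl_on_def equiv_def)
    show "sym (\<Inter>F)" using eq by (auto simp: sym_def equiv_def)
    show "trans (\<Inter>F)" using eq by (auto simp: trans_def equiv_def)
  qed
  then have I: "\<Inter>F \<in> F"
    by (auto simp: F_def lattice_congruence_def)
  have "cambrian_congruence n Lpts Rpts = \<Inter>F"
    unfolding cambrian_congruence_def generated_congruence_def
  proof (rule Least_equality)
    show "lattice_congruence (weak_order_B n) (\<Inter>F) \<and>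
        (\<forall>x\<in>cambrian_generators n Lpts Rpts. contracts (weak_order_B n) (\<Inter>F) x)"
      using I contracts_generators_iff by (auto simp: F_def)
    fix \<Theta> assume "lattice_congruence (weak_order_B n) \<Theta> \<and>
        (\<forall>x\<in>cambrian_generators n Lpts Rpts. contracts (weak_order_B n) \<Theta> x)"
    then have "\<Theta> \<in> F" using contracts_generators_iff by (auto simp: F_def)
    then show "\<Inter>F \<subseteq> \<Theta>" by blast
  qed
  then show "lattice_congruence (weak_order_B n) (cambrian_congruence n Lpts Rpts)"
    "gen_pairs n Lpts Rpts \<subseteq> cambrian_congruence n Lpts Rpts"
    "cambrian_congruence n Lpts Rpts \<subseteq> camb_cong n (rt Rpts)"
    using I C by (auto simp: F_def)
qed

section \<open>Elements contracted by the Cambrian congruence\<close>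

text \<open>At a right point, \<open>right_collapse\<close> applies to the generators at
  \<open>c\<close>. At a left point it is applied in the dual lattice, where \<open>z'\<close> and
  \<open>z\<close> exchange their roles and the congruent pair must be found among elements with
  small complements.\<close>

lemma descent_collapse:
  assumes T: "lattice_congruence (weak_order_B n) \<Theta>" and gen: "gen_pairs n Lpts Rpts \<subseteq> \<Theta>"
    and z: "z \<in> signed_perms n" "z' \<in> signed_perms n" "invs n z = invs n z' \<union> {(a, b), (- b, - a)}"
      "(a, b) \<notin> invs n z'"
    and c: "1 \<le> c" "c \<in> labels n" "a < c" "c < b" "if rt Rpts c then (a, c) \<in> invs n z else (c, b) \<in> invs n z"
  shows "(z, z') \<in> \<Theta>"
proof -
  interpret inv_congruence n "signed_perms n" "invs n" "join (weak_order_B n)" "meet (weak_order_B n)" \<Theta>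
    by (rule weak_order_inv_congruence[OF n1 T])
  interpret dual: inv_congruence n "signed_perms n" "\<lambda>x. lpairs n - invs n x"
    "meet (weak_order_B n)" "join (weak_order_B n)" \<Theta>
    by (rule dual_congruence)
  have cv: "cov z z' a b" using z by (simp add: cov_def)
  have "(a, b) \<in> invs n z" using z by simp
  then have cn: "c < int n" using c by (auto simp: invs_iff labels_iff)
  have lab: "1 \<in> labels n" "2 \<in> labels n" using n2 by (auto simp: labels_iff)
  show ?thesis
  proof (cases "rt Rpts c")
    case True
    then have cR: "c \<in> Rpts" using c by (simp add: rt_def)
    define J J' where "J = (if c = 1 then sw (-1) 1 \<circ> sw 1 2 \<circ> sw (-1) 1 else sw (c - 1) c \<circ> sw c (c + 1))"
      and "J' = (if c = 1 then sw (-1) 1 else sw (c - 1) c)"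
    have "(J, J') \<in> \<Theta>"
    proof (cases "c = 1")
      case True
      then have "(sw (-1) 1 \<circ> sw 1 2 \<circ> sw (-1) 1, sw (-1) 1 \<circ> sw 1 2) \<in> \<Theta>" "(sw (-1) 1 \<circ> sw 1 2, sw (-1) 1) \<in> \<Theta>"
        using gen cR by (auto simp: gen_pairs_def)
      then show ?thesis using Th_trans True by (auto simp: J_def J'_def)
    next
      case False
      have "(sw (c - 1) c \<circ> sw c (c + 1), sw (c - 1) c) \<in> gen_pairs n Lpts Rpts"
        unfolding gen_pairs_def using False cR cn c by auto
      then show ?thesis using gen False by (auto simp: J_def J'_def)
    qed
    moreover have "invs n J' \<subseteq> {(i, j) \<in> lpairs n. blk c i = blk c j}"
    proof (cases "c = 1")
      case True
      have "adj n (-1) 1" using n2 by (auto simp: adj_iff labels_iff)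
      then show ?thesis using invs_sw(2)[of n "-1" 1] invs_sub[of n J'] True
        by (auto simp: J'_def blk_def)
    next
      case False
      have "adj n (c - 1) c" using False c cn by (auto simp: adj_iff labels_iff)
      then show ?thesis using invs_sw(2)[of n "c - 1" c] invs_sub[of n J'] False c
        by (auto simp: J'_def blk_def)
    qed
    moreover have "if c = 1 then {(-1, 2), (-2, 2)} \<subseteq> invs n J else (c - 1, c + 1) \<in> invs n J"
      using generator_invs(4)[OF n2] generator_invs_ge2(2)[of c n] c cn by (auto simp: J_def)
    ultimately show ?thesis
      using right_collapse[OF c(1) cn _ _ _ cv c(3,4)] c(5) True by auto
  next
    case False
    have cL: "c \<in> Lpts" using False designated c cn by (auto simp: rt_def)
    \<comment> \<open>\<open>m0\<close> is the generator that a right point would have at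
      \<open>c\<close>, for \<open>c = 1\<close> the longer one. The element \<open>m\<close> with
      the complementary inversions serves as \<open>J\<close> of the dual statement. Joining the
      congruent pair \<open>y\<close>, \<open>x\<close> with \<open>m\<close> yields the partner:
      \<open>y\<close> lies below \<open>m\<close>, while \<open>x\<close> adds every pair of
      \<open>m0\<close> that connects different blocks.\<close>
    define x y m0 where
      "x = (if c = 1 then sw 1 2 \<circ> sw (-1) 1 \<circ> sw 1 2 else sw c (c + 1) \<circ> sw (c - 1) c)"
      and "y = (if c = 1 then sw 1 2 else sw c (c + 1))"
      and "m0 = (if c = 1 then sw (-1) 1 \<circ> sw 1 2 \<circ> sw (-1) 1 else sw (c - 1) c \<circ> sw c (c + 1))"
    have m0: "m0 \<in> signed_perms n"
      using generator_invs(2)[OF n2] generator_invs_ge2(1)[of c n] c cn by (auto simp: irr_def m0_def)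
    have Im0: "invs n m0 = (if c = 1 then {(-1, 1), (-1, 2), (-2, 1), (-2, 2)}
        else {(c - 1, c), (- c, 1 - c), (c - 1, c + 1), (- c - 1, 1 - c)})"
      using generator_invs(4)[OF n2] generator_invs_ge2(2)[of c n] c cn by (auto simp: m0_def)
    obtain m where m: "m \<in> signed_perms n" "invs n m = lpairs n - invs n m0"
      using biclosed_realize[OF biclosed_compl[OF invs_biclosed[OF m0]]] by blast
    have xy: "(x, y) \<in> \<Theta>"
    proof (cases "c = 1")
      case True
      then have "(sw 1 2 \<circ> sw (-1) 1 \<circ> sw 1 2, sw 1 2 \<circ> sw (-1) 1) \<in> \<Theta>" "(sw 1 2 \<circ> sw (-1) 1, sw 1 2) \<in> \<Theta>"
        using gen cL by (auto simp: gen_pairs_def)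
      then show ?thesis using Th_trans True by (auto simp: x_def y_def)
    next
      case False
      have "(sw c (c + 1) \<circ> sw (c - 1) c, sw c (c + 1)) \<in> gen_pairs n Lpts Rpts"
        unfolding gen_pairs_def using False cL cn c by auto
      then show ?thesis using gen False by (auto simp: x_def y_def)
    qed
    have B: "x \<in> signed_perms n" "y \<in> signed_perms n" using Th_mem[OF xy] by auto
    have "invs n y \<subseteq> invs n m"
    proof -
      have "adj n c (c + 1)" using c cn by (auto simp: adj_iff labels_iff)
      then have "invs n y = {(c, c + 1), (- (c + 1), - c)}" using invs_sw(2)[of n c "c + 1"] by (auto simp: y_def)
      then show ?thesis using invs_sub[of n y] c by (auto simp: m Im0)
    qed
    then have "m \<squnion>\<^bsub>weak_order_B n\<^esub> y = m" using jn_absorb m(1) B by blast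
    then have J: "(m, m \<squnion>\<^bsub>weak_order_B n\<^esub> x) \<in> \<Theta>" using Th_sym[OF Th_jn[OF xy m(1)]] by simp
    let ?J = "m \<squnion>\<^bsub>weak_order_B n\<^esub> x"
    have "lpairs n - invs n ?J \<subseteq> {(i, j) \<in> lpairs n. blk c i = blk c j}"
    proof -
      have "lpairs n - invs n ?J \<subseteq> lpairs n - invs n m" "invs n x \<subseteq> invs n ?J"
        using I_jn_upper[OF m(1) B(1)] by auto
      moreover have "lpairs n - invs n m = invs n m0" unfolding m using invs_sub[of n m0] by blast
      ultimately have "lpairs n - invs n ?J \<subseteq> invs n m0 - invs n x" by blast
      also have "\<dots> \<subseteq> (if c = 1 then {(-1, 1)} else {(c - 1, c), (- c, 1 - c)})"
      proof (cases "c = 1")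
        case True
        then show ?thesis using generator_invs(8)[OF n2] by (simp add: Im0 x_def) blast
      next
        case False
        then show ?thesis using generator_invs_ge2(4)[of c n] c cn by (simp add: Im0 x_def) blast
      qed
      finally have "lpairs n - invs n ?J \<subseteq> (if c = 1 then {(-1, 1)} else {(c - 1, c), (- c, 1 - c)})" .
      moreover have "blk c i = blk c j" if "(i, j) \<in> (if c = 1 then {(-1, 1)} else {(c - 1, c), (- c, 1 - c)})" for i j
        using that c by (cases "c = 1") (auto simp: blk_def)
      ultimately show ?thesis by blast
    qed
    moreover have "if c = 1 then {(-1, 2), (-2, 2)} \<subseteq> lpairs n - invs n m else (c - 1, c + 1) \<in> lpairs n - invs n m"
    proof -
      have "lpairs n - invs n m = invs n m0" unfolding m using invs_sub[of n m0] by blast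
      then show ?thesis by (auto simp: Im0)
    qed
    moreover have "(a, c) \<in> lpairs n - invs n z'"
      using cov_split[OF cv c(2-4)] c(5) False \<open>(a, b) \<in> invs n z\<close> c by (auto simp: lpairs_iff invs_iff)
    ultimately have "(z', z) \<in> \<Theta>"
      using dual.right_collapse[OF c(1) cn J _ _ cov_dual[OF cv] c(3,4)] by auto
    then show ?thesis by (rule Th_sym)
  qed
qed

lemma uncontracted_iff:
  assumes x: "x \<in> signed_perms n"
  shows "\<not> contracts (weak_order_B n) (cambrian_congruence n Lpts Rpts) x \<longleftrightarrow>
    camb n (rt Rpts) (invs n x) = invs n x"
proof
  note P = cambrian_congruence_properties
  { assume "\<not> contracts (weak_order_B n) (cambrian_congruence n Lpts Rpts) x"
    then have nc: "(x, z') \<notin> cambrian_congruence n Lpts Rpts"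
      if "z' \<in> signed_perms n" "invs n z' \<subset> invs n x" for z'
      using that x n1 by (auto simp: contracts_def lless_def weak_order_le)
    show "camb n (rt Rpts) (invs n x) = invs n x"
    proof (rule ccontr)
      assume "camb n (rt Rpts) (invs n x) \<noteq> invs n x"
      then obtain p q c where pq: "adj n p q" "x q < c" "c < x p" "c \<in> labels n"
          "if rt Rpts c then (x q, c) \<in> invs n x else (c, x p) \<in> invs n x"
        using bad_descent[OF x] by metis
      then obtain z' where z': "z' \<in> signed_perms n"
          "invs n x = invs n z' \<union> {(x q, x p), (- x p, - x q)}" "(x q, x p) \<notin> invs n z'"
        using lower_cover[OF x pq(1)] by fastforce
      have "(x, z') \<in> cambrian_congruence n Lpts Rpts"
      proof (cases "1 \<le> c")
        case True
        then show ?thesis using descent_collapse[OF P(1,2) x z' _ pq(4,2,3,5)] by blast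
      next
        case False
        \<comment> \<open>The same covering belongs to the mirror-image descent, for which
          \<open>-c\<close> is a positive label on the wrong side.\<close>
        then have "c < 0" using pq by (auto simp: labels_iff)
        have "(- x p, - x q) \<notin> invs n z'"
          using z' biclosed_sym_iff[OF invs_biclosed[OF z'(1)]] by blast
        moreover have "if rt Rpts (- c) then (- x p, - c) \<in> invs n x else (- c, - x q) \<in> invs n x"
          using pq(5) rt_labels[OF pq(4)] biclosed_sym[OF invs_biclosed[OF x]] by (auto split: if_splits)
        ultimately show ?thesis
          using descent_collapse[OF P(1,2) x z'(1), of "- x p" "- x q" "- c"] z' pq \<open>c < 0\<close> by (auto simp: insert_commute)
      qed
      then show False using nc z' by blast
    qed }
  assume eq: "camb n (rt Rpts) (invs n x) = invs n x"
  show "\<not> contracts (weak_order_B n) (cambrian_congruence n Lpts Rpts) x"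
  proof
    assume "contracts (weak_order_B n) (cambrian_congruence n Lpts Rpts) x"
    then obtain y where y: "y \<in> signed_perms n" "(x, y) \<in> camb_cong n (rt Rpts)" "invs n y \<subseteq> invs n x" "y \<noteq> x"
      using n1 P(3) by (auto simp: contracts_def lless_def weak_order_le)
    then have "invs n x \<subseteq> invs n y" using eq camb_sub[of n "rt Rpts" "invs n y"] by (simp add: camb_cong_def)
    then show False using y invs_inject[OF y(1) x] by blast
  qed
qed

end

section \<open>Noncrossing arcs and uncontracted permutations\<close>

definition desc_pairs :: "nat \<Rightarrow> (int \<Rightarrow> int) \<Rightarrow> (int \<times> int) set" where
  "desc_pairs n \<pi> = (\<lambda>(a, b). (\<pi> b, \<pi> a)) ` descents n \<pi>"

text \<open>The inversions forced by an inversion \<open>(p, q)\<close> in an uncontracted permutation.\<close>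

definition arc_invs :: "nat \<Rightarrow> (int \<Rightarrow> bool) \<Rightarrow> int \<times> int \<Rightarrow> (int \<times> int) set" where
  "arc_invs n R = (\<lambda>(p, q). {(r, l) \<in> lpairs n. p \<le> r \<and> l \<le> q \<and> (r = p \<or> R r) \<and> (l = q \<or> \<not> R l)})"

text \<open>An arc whose sides are prescribed by \<open>R\<close> is determined by its endpoints. The last two
  conditions say that two such arcs do not cross: at both ends of the common range of heights the
  same one of them must be on the left.\<close>

definition compatible :: "nat \<Rightarrow> (int \<Rightarrow> bool) \<Rightarrow> (int \<times> int) set \<Rightarrow> bool" where
  "compatible n R D \<longleftrightarrow> D \<subseteq> lpairs n \<and> (\<forall>p q. (p, q) \<in> D \<longrightarrow> (- q, - p) \<in> D) \<and>
     (\<forall>p q p' q'. (p, q) \<in> D \<longrightarrow> (p', q') \<in> D \<longrightarrow>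
        (p = p' \<longleftrightarrow> q = q') \<and>
        (p < p' \<longrightarrow> p' < q' \<longrightarrow> q' < q \<longrightarrow> R p' = R q') \<and>
        (p < p' \<longrightarrow> p' < q \<longrightarrow> q < q' \<longrightarrow> R p' \<noteq> R q))"

lemma descents_iff: "(a, b) \<in> descents n \<pi> \<longleftrightarrow> adj n a b \<and> \<pi> b < \<pi> a"
  by (auto simp: descents_def adj_def)

lemma desc_pairs_iff: "(p, q) \<in> desc_pairs n \<pi> \<longleftrightarrow> (\<exists>a b. adj n a b \<and> \<pi> b < \<pi> a \<and> p = \<pi> b \<and> q = \<pi> a)"
  unfolding desc_pairs_def image_iff Bex_def split_paired_Ex descents_iff by auto

lemma desc_pairs_invs:
  assumes "\<pi> \<in> signed_perms n" "(p, q) \<in> desc_pairs n \<pi>"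
  shows "(p, q) \<in> invs n \<pi>"
  using assms(2) signed_permsD[OF assms(1)] by (auto simp: desc_pairs_iff invs_iff adj_def)

lemma arc_invs_iff:
  "(r, l) \<in> arc_invs n R (p, q) \<longleftrightarrow> (r, l) \<in> lpairs n \<and> p \<le> r \<and> l \<le> q \<and> (r = p \<or> R r) \<and> (l = q \<or> \<not> R l)"
  by (auto simp: arc_invs_def)

lemma UN_pairE:
  assumes "e \<in> (\<Union>d \<in> D. f d)"
  obtains p q where "(p, q) \<in> D" "e \<in> f (p, q)"
proof -
  obtain d where "d \<in> D" "e \<in> f d" using assms by blast
  then show ?thesis using that by (cases d) auto
qed

text \<open>An inner label splits a forced pair within the same arc: a right point can begin the
  upper half, a left point can end the lower half.\<close>

lemma compatible_trancl:
  assumes D: "compatible n R D" and R: "\<And>v. v \<in> labels n \<Longrightarrow> R (- v) \<longleftrightarrow> \<not> R v"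
  shows "biclosed n ((\<Union>d \<in> D. arc_invs n R d)\<^sup>+)"
proof (rule trancl_union_biclosed)
  let ?U = "\<Union>d \<in> D. arc_invs n R d"
  show "?U \<subseteq> lpairs n" by (auto simp: arc_invs_def)
  show "(a, b) \<in> ?U \<or> (b, c) \<in> ?U" if ac: "(a, c) \<in> ?U" and b: "b \<in> labels n" "a < b" "b < c" for a b c
  proof -
    obtain p q where "(p, q) \<in> D" "(a, c) \<in> arc_invs n R (p, q)" using ac by (rule UN_pairE)
    then have "(a, b) \<in> arc_invs n R (p, q) \<or> (b, c) \<in> arc_invs n R (p, q)"
      using b by (auto simp: arc_invs_iff lpairs_iff)
    then show ?thesis using \<open>(p, q) \<in> D\<close> by blast
  qed
  show "(- b, - a) \<in> ?U" if ab: "(a, b) \<in> ?U" for a b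
  proof -
    obtain p q where pq: "(p, q) \<in> D" "(a, b) \<in> arc_invs n R (p, q)" using ab by (rule UN_pairE)
    then have "(- b, - a) \<in> arc_invs n R (- q, - p)"
      using R[of a] R[of b] by (auto simp: arc_invs_iff lpairs_iff)
    moreover have "(- q, - p) \<in> D" using D pq by (auto simp: compatible_def)
    ultimately show ?thesis by blast
  qed
qed

section \<open>Chains of inversions forced by compatible arcs\<close>

context
  fixes n R D U
  assumes D: "compatible n R D" and R: "\<And>v. v \<in> labels n \<Longrightarrow> R (- v) \<longleftrightarrow> \<not> R v"
    and U: "U = (\<Union>d \<in> D. arc_invs n R d)"
begin

text \<open>Started at \<open>p\<close>, chains visit only left points below \<open>q\<close>: a
  right point \<open>w\<close> could only be reached as the upper end of another arc, which
  compatibility at the ends of the common range excludes. In the same way a step over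
  \<open>q\<close> forces \<open>q\<close> to be a right point inside the other arc, so that the
  step can be restarted at \<open>q\<close>.\<close>

lemma U_step:
  assumes pq: "(p, q) \<in> D" and v: "v = p \<or> p < v \<and> \<not> R v" and vw: "(v, w) \<in> U" and lt: "v < q" "w \<noteq> q"
  shows "w < q \<and> \<not> R w \<or> q < w \<and> (q, w) \<in> U"
proof -
  obtain p' q' where pq': "(p', q') \<in> D" and J: "(v, w) \<in> arc_invs n R (p', q')"
    using vw unfolding U by (rule UN_pairE)
  have C: "p = p' \<longleftrightarrow> q = q'" "p < p' \<Longrightarrow> p' < q' \<Longrightarrow> q' < q \<Longrightarrow> R p' = R q'"
    "p < p' \<Longrightarrow> p' < q \<Longrightarrow> q < q' \<Longrightarrow> R p' \<noteq> R q"
    "p' < p \<Longrightarrow> p < q \<Longrightarrow> q < q' \<Longrightarrow> R p = R q"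
    "p' < p \<Longrightarrow> p < q' \<Longrightarrow> q' < q \<Longrightarrow> R p \<noteq> R q'"
    using D pq pq' unfolding compatible_def by metis+
  have J': "v < w" "p' \<le> v" "w \<le> q'" "v = p' \<or> R v" "w = q' \<or> \<not> R w" "v \<in> labels n" "w \<in> labels n"
    using J by (auto simp: arc_invs_iff lpairs_iff)
  have q: "q \<in> labels n" using D pq by (auto simp: compatible_def lpairs_iff)
  consider "w < q" | "q < w" using lt by linarith
  then show ?thesis
  proof cases
    case 1
    have "\<not> R w"
    proof
      assume "R w"
      then have w: "w = q'" using J' by blast
      show False
      proof (cases "v = p")
        case True
        then have "p \<noteq> p'" using C(1) w 1 by auto
        then show False using C(5) True J' w 1 \<open>R w\<close> by auto
      next
        case False
        then show False using C(2) J' w 1 \<open>R w\<close> v by auto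
      qed
    qed
    then show ?thesis using 1 by blast
  next
    case 2
    have "R q"
    proof (rule ccontr)
      assume nq: "\<not> R q"
      show False
      proof (cases "v = p")
        case True
        then have "p \<noteq> p'" using C(1) J' 2 by auto
        then show False using C(4) True J' 2 lt nq by auto
      next
        case False
        then show False using C(3) J' 2 lt nq v by auto
      qed
    qed
    then have "(q, w) \<in> arc_invs n R (p', q')"
      using J' 2 q lt by (auto simp: arc_invs_iff lpairs_iff)
    then show ?thesis using 2 pq' U by blast
  qed
qed

lemma U_sub: "U \<subseteq> lpairs n"
  using U by (auto simp: arc_invs_def)

lemma D_lt: "(p, q) \<in> D \<Longrightarrow> p < q \<and> p \<in> labels n \<and> q \<in> labels n"
  using D by (auto simp: compatible_def lpairs_iff)

lemma D_uminus: "(p, q) \<in> D \<Longrightarrow> (- q, - p) \<in> D"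
  using D by (auto simp: compatible_def)

lemma U_biclosed: "biclosed n (U\<^sup>+)"
  unfolding U by (rule compatible_trancl[OF D R])

lemma right_not_below:
  assumes pq: "(p, q) \<in> D" and c: "p < c" "c < q" "R c"
  shows "(p, c) \<notin> U\<^sup>+"
proof
  assume "(p, c) \<in> U\<^sup>+"
  then have "c \<in> {v. v = p \<or> p < v \<and> \<not> R v}"
  proof (rule trancl_invariant[OF _ U_sub])
    fix v w assume h: "v \<in> {v. v = p \<or> p < v \<and> \<not> R v}" "(v, w) \<in> U" "w \<le> c"
    have "v < w" using h U_sub by (auto simp: lpairs_iff)
    then show "w \<in> {v. v = p \<or> p < v \<and> \<not> R v}"
      using U_step[OF pq, of v w] h c by auto
  qed simp
  then show False using c by auto
qed

lemma left_not_above: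
  assumes pq: "(p, q) \<in> D" and c: "c \<in> labels n" "p < c" "c < q" "\<not> R c"
  shows "(c, q) \<notin> U\<^sup>+"
  using right_not_below[OF D_uminus[OF pq], of "- c"] c R[OF c(1)] biclosed_sym[OF U_biclosed, of c q]
  by auto

text \<open>A chain getting beyond \<open>q\<close> either visits \<open>q\<close> or jumps over it,
  and \<open>U_step\<close> lets the jump start at \<open>q\<close>.\<close>

lemma beyond_above:
  assumes pq: "(p, q) \<in> D" and x: "(p, x) \<in> U\<^sup>+" "q < x"
  shows "(q, x) \<in> U\<^sup>+"
proof -
  let ?S = "{v. (v = p \<or> p < v \<and> v < q \<and> \<not> R v) \<or> v = q \<or> (q, v) \<in> U\<^sup>+}"
  have "x \<in> ?S"
  proof (rule trancl_invariant[OF x(1) U_sub])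
    fix v w assume h: "v \<in> ?S" "(v, w) \<in> U"
    have vw: "v < w" using h U_sub by (auto simp: lpairs_iff)
    show "w \<in> ?S"
    proof (cases "v = q \<or> (q, v) \<in> U\<^sup>+")
      case True
      then show ?thesis using h(2) by (auto intro: trancl_into_trancl)
    next
      case False
      then have "v = p \<or> p < v \<and> \<not> R v" "v < q" using h D_lt[OF pq] by auto
      then show ?thesis using U_step[OF pq _ h(2)] vw by auto
    qed
  qed simp
  then show ?thesis using x(2) D_lt[OF pq] by auto
qed

lemma beyond_below:
  assumes pq: "(p, q) \<in> D" and x: "(x, q) \<in> U\<^sup>+" "x < p"
  shows "(x, p) \<in> U\<^sup>+"
  using beyond_above[OF D_uminus[OF pq], of "- x"] x biclosed_sym[OF U_biclosed, of x q]
    biclosed_sym[OF U_biclosed, of "- p" "- x"] by auto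

text \<open>An entry standing between \<open>q\<close> and \<open>p\<close> would have its value
  inside the arc, where it could be neither a right nor a left point, or beyond one of the ends,
  where it would have to stand outside the two entries.\<close>

lemma compatible_adjacent:
  assumes \<pi>: "\<pi> \<in> signed_perms n" "invs n \<pi> = U\<^sup>+" and pq: "(p, q) \<in> D"
  shows "adj n (inv \<pi> q) (inv \<pi> p)"
proof -
  note sp = signed_permsD[OF \<pi>(1)]
  note lt = D_lt[OF pq]
  have "(p, q) \<in> arc_invs n R (p, q)" using lt by (auto simp: arc_invs_iff lpairs_iff)
  then have "(p, q) \<in> U" using pq U by blast
  then have "(p, q) \<in> invs n \<pi>" using \<pi> by auto
  moreover have False if c: "c \<in> labels n" "inv \<pi> q < c" "c < inv \<pi> p" for c
  proof -
    define x where "x = \<pi> c"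
    have x: "x \<in> labels n" "inv \<pi> q < inv \<pi> x" "inv \<pi> x < inv \<pi> p" using c by (auto simp: x_def sp)
    then have "x \<noteq> p" "x \<noteq> q" by auto
    then consider "p < x" "x < q" | "x < p" | "q < x" by linarith
    then show False
    proof cases
      case 1
      then have "(p, x) \<in> U\<^sup>+" "(x, q) \<in> U\<^sup>+" using x lt unfolding \<pi>(2)[symmetric] by (auto simp: invs_iff)
      then show False using right_not_below[OF pq 1] left_not_above[OF pq x(1) 1] by blast
    next
      case 2
      then have "(x, q) \<in> U\<^sup>+" "(x, p) \<notin> U\<^sup>+" using x lt unfolding \<pi>(2)[symmetric] by (auto simp: invs_iff)
      then show False using beyond_below[OF pq _ 2] by blast
    next
      case 3
      then have "(p, x) \<in> U\<^sup>+" "(q, x) \<notin> U\<^sup>+" using x lt unfolding \<pi>(2)[symmetric] by (auto simp: invs_iff)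
      then show False using beyond_above[OF pq _ 3] by blast
    qed
  qed
  ultimately show ?thesis using lt sp(8) by (auto simp: adj_def invs_iff)
qed

text \<open>A descent is not a chain of several steps, as an intermediate label would stand between
  its two entries. So it is a single pair forced by some arc \<open>(p, q)\<close>, and if it were
  not the arc itself, then \<open>p\<close> or \<open>q\<close> would stand between its
  entries.\<close>

lemma compatible_desc_pairs:
  assumes \<pi>: "\<pi> \<in> signed_perms n" "invs n \<pi> = U\<^sup>+"
  shows "desc_pairs n \<pi> = D"
proof (rule Set.set_eqI, clarify, rule iffI)
  note sp = signed_permsD[OF \<pi>(1)]
  fix p q assume pq: "(p, q) \<in> D"
  then show "(p, q) \<in> desc_pairs n \<pi>"
    using compatible_adjacent[OF \<pi> pq] D_lt[OF pq] sp(5) by (metis desc_pairs_iff)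
next
  note sp = signed_permsD[OF \<pi>(1)]
  fix a b assume ab: "(a, b) \<in> desc_pairs n \<pi>"
  then have adj: "adj n (inv \<pi> b) (inv \<pi> a)" by (auto simp: desc_pairs_iff sp)
  have between: False if "x \<in> labels n" "inv \<pi> b < inv \<pi> x" "inv \<pi> x < inv \<pi> a" for x
    using adj that sp(8) unfolding adj_def by blast
  have abU: "(a, b) \<in> U\<^sup>+" using desc_pairs_invs[OF \<pi>(1) ab] \<pi>(2) by simp
  have "(a, b) \<in> U"
    using abU
  proof (cases rule: tranclE)
    case (step y)
    have "(y, b) \<in> U\<^sup>+" using step by blast
    then have "(a, y) \<in> invs n \<pi>" "(y, b) \<in> invs n \<pi>" using step unfolding \<pi>(2) by blast+
    then show ?thesis using between[of y] by (auto simp: invs_iff)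
  qed
  then obtain p q where pq: "(p, q) \<in> D" and J: "(a, b) \<in> arc_invs n R (p, q)"
    unfolding U by (rule UN_pairE)
  note lt = D_lt[OF pq]
  have J': "a < b" "p \<le> a" "b \<le> q" "a = p \<or> R a" "b = q \<or> \<not> R b" "a \<in> labels n" "b \<in> labels n"
    using J by (auto simp: arc_invs_iff lpairs_iff)
  have qp: "inv \<pi> q < inv \<pi> p" using compatible_adjacent[OF \<pi> pq] by (simp add: adj_def)
  have pa: "inv \<pi> p < inv \<pi> a" if "a \<noteq> p"
    using right_not_below[OF pq, of a] that J' lt sp(10)[of p a]
    unfolding \<pi>(2)[symmetric] by (auto simp: invs_iff)
  have bq: "inv \<pi> b < inv \<pi> q" if "b \<noteq> q"
    using left_not_above[OF pq, of b] that J' lt sp(10)[of b q]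
    unfolding \<pi>(2)[symmetric] by (auto simp: invs_iff)
  have "a = p"
  proof (rule ccontr)
    assume "a \<noteq> p"
    then show False using between[of p] pa bq qp lt by fastforce
  qed
  moreover have "b = q"
  proof (rule ccontr)
    assume "b \<noteq> q"
    then show False using between[of q] bq qp lt \<open>a = p\<close> by fastforce
  qed
  ultimately show "(a, b) \<in> D" using pq by simp
qed

lemma compatible_camb:
  assumes \<pi>: "\<pi> \<in> signed_perms n" "invs n \<pi> = U\<^sup>+"
  shows "camb n R (invs n \<pi>) = invs n \<pi>"
proof (rule ccontr)
  assume "camb n R (invs n \<pi>) \<noteq> invs n \<pi>"
  then obtain p q c where pq: "adj n p q" "\<pi> q < c" "c < \<pi> p" "c \<in> labels n"
      "if R c then (\<pi> q, c) \<in> invs n \<pi> else (c, \<pi> p) \<in> invs n \<pi>"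
    using bad_descent[OF \<pi>(1)] by metis
  then have "(\<pi> q, \<pi> p) \<in> D"
    using compatible_desc_pairs[OF \<pi>] desc_pairs_iff[of "\<pi> q" "\<pi> p" n \<pi>] by force
  then show False
    using right_not_below[of "\<pi> q" "\<pi> p" c] left_not_above[of "\<pi> q" "\<pi> p" c] pq \<pi>(2)
    by (cases "R c") auto
qed

end

theorem compatible_realize:
  assumes D: "compatible n R D" and R: "\<And>v. v \<in> labels n \<Longrightarrow> R (- v) \<longleftrightarrow> \<not> R v"
  shows "\<exists>\<pi> \<in> signed_perms n. camb n R (invs n \<pi>) = invs n \<pi> \<and> desc_pairs n \<pi> = D"
proof -
  obtain \<pi> where "\<pi> \<in> signed_perms n" "invs n \<pi> = (\<Union>d \<in> D. arc_invs n R d)\<^sup>+"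
    using biclosed_realize[OF compatible_trancl[OF D]] R by blast
  then show ?thesis
    using compatible_camb[OF D R refl] compatible_desc_pairs[OF D R refl] by blast
qed

text \<open>Along the entries from \<open>b\<close> to \<open>a\<close>, either some entry lies strictly between them in value, or
  a single descent jumps over the whole range of values.\<close>

lemma camb_invs_generated:
  assumes \<pi>: "\<pi> \<in> signed_perms n" and camb: "camb n R (invs n \<pi>) = invs n \<pi>"
  shows "invs n \<pi> = (\<Union>d \<in> desc_pairs n \<pi>. arc_invs n R d)\<^sup>+"
proof
  let ?U = "\<Union>d \<in> desc_pairs n \<pi>. arc_invs n R d"
  note sp = signed_permsD[OF \<pi>]
  have C: "if R c then (c, b) \<in> invs n \<pi> else (a, c) \<in> invs n \<pi>"
    if "(a, b) \<in> invs n \<pi>" "c \<in> labels n" "a < c" "c < b" for a b c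
    using camb camb_eq_iff[OF invs_sub] that by blast
  have "?U \<subseteq> invs n \<pi>"
  proof
    fix e assume "e \<in> ?U"
    then obtain p q where pq: "(p, q) \<in> desc_pairs n \<pi>" "e \<in> arc_invs n R (p, q)" by (rule UN_pairE)
    obtain r l where e: "e = (r, l)" "(p, q) \<in> desc_pairs n \<pi>" "(r, l) \<in> arc_invs n R (p, q)"
      using pq by (cases e) auto
    then have "(p, q) \<in> camb n R (invs n \<pi>)" using desc_pairs_invs[OF \<pi>] camb by simp
    then show "e \<in> invs n \<pi>" using camb_memD[of p q n R "invs n \<pi>" r l] e by (auto simp: arc_invs_iff)
  qed
  then show "?U\<^sup>+ \<subseteq> invs n \<pi>"
    using trancl_mono_subset[of ?U "invs n \<pi>"] invs_biclosed[OF \<pi>] by (simp add: biclosed_def trancl_id)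
  have "(a, b) \<in> ?U\<^sup>+" if "(a, b) \<in> invs n \<pi>" for a b
    using that
  proof (induction "nat (inv \<pi> a - inv \<pi> b)" arbitrary: a b rule: less_induct)
    case less
    then have ab: "a \<in> labels n" "b \<in> labels n" "a < b" "inv \<pi> b < inv \<pi> a" by (auto simp: invs_iff)
    show ?case
    proof (cases "\<exists>c \<in> labels n. a < c \<and> c < b \<and> inv \<pi> b < inv \<pi> c \<and> inv \<pi> c < inv \<pi> a")
      case True
      then obtain c where c: "c \<in> labels n" "a < c" "c < b" "inv \<pi> b < inv \<pi> c" "inv \<pi> c < inv \<pi> a" by blast
      then have "(a, c) \<in> ?U\<^sup>+" "(c, b) \<in> ?U\<^sup>+"
        using ab by (auto intro!: less.hyps simp: invs_iff)
      then show ?thesis by (rule trancl_trans)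
    next
      case False
      have labp: "inv \<pi> b \<in> labels n" "inv \<pi> a \<in> labels n" using ab sp(8) by auto
      obtain p q where pq: "adj n p q" "inv \<pi> b \<le> p" "q \<le> inv \<pi> a" "b \<le> \<pi> p" "\<not> b \<le> \<pi> q"
        using adj_crossing[OF labp ab(4), of "\<lambda>p. b \<le> \<pi> p"] ab sp(5) by auto
      have pql: "p \<in> labels n" "q \<in> labels n" "p < q" using pq by (auto simp: adj_def)
      have qa: "\<pi> q \<le> a"
      proof (rule ccontr)
        assume "\<not> \<pi> q \<le> a"
        moreover then have "q \<noteq> inv \<pi> a" using sp(5)[of a] by auto
        ultimately show False using False[simplified, rule_format, of "\<pi> q"] pq pql sp(6,7) by auto
      qed
      have D: "(\<pi> q, \<pi> p) \<in> desc_pairs n \<pi>" using pq qa ab by (force simp: desc_pairs_iff)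
      have I: "(\<pi> q, \<pi> p) \<in> invs n \<pi>" by (rule desc_pairs_invs[OF \<pi> D])
      have "a = \<pi> q \<or> R a"
      proof (rule ccontr)
        assume h: "\<not> ?thesis"
        then have "(\<pi> q, a) \<in> invs n \<pi>" using C[OF I ab(1)] qa pq ab by auto
        then show False using pq by (simp add: invs_iff sp(6))
      qed
      moreover have "b = \<pi> p \<or> \<not> R b"
      proof (rule ccontr)
        assume h: "\<not> ?thesis"
        then have "(b, \<pi> p) \<in> invs n \<pi>" using C[OF I ab(2)] qa pq ab by auto
        then show False using pq by (simp add: invs_iff sp(6))
      qed
      ultimately have "(a, b) \<in> arc_invs n R (\<pi> q, \<pi> p)"
        using ab qa pq by (auto simp: arc_invs_iff lpairs_iff)
      then show ?thesis using D by blast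
    qed
  qed
  then show "invs n \<pi> \<subseteq> ?U\<^sup>+" by (rule subrelI)
qed

lemma desc_pairs_inject:
  assumes "\<pi> \<in> signed_perms n" "camb n R (invs n \<pi>) = invs n \<pi>"
    and "\<sigma> \<in> signed_perms n" "camb n R (invs n \<sigma>) = invs n \<sigma>"
    and "desc_pairs n \<pi> = desc_pairs n \<sigma>"
  shows "\<pi> = \<sigma>"
  using assms camb_invs_generated invs_inject by metis

section \<open>Arcs with prescribed sides\<close>

definition std_arc :: "nat \<Rightarrow> (int \<Rightarrow> bool) \<Rightarrow> int \<times> int \<Rightarrow> arc" where
  "std_arc n R = (\<lambda>(p, q). Arc p q {v \<in> labels n. p < v \<and> v < q \<and> \<not> R v} {v \<in> labels n. p < v \<and> v < q \<and> R v})"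

text \<open>The entries of a descent are consecutive, so every label between them in value stands
  before both or after both; being fixed by the projection decides which.\<close>

lemma delta_eq_std_arcs:
  assumes \<pi>: "\<pi> \<in> signed_perms n" and camb: "camb n R (invs n \<pi>) = invs n \<pi>"
  shows "delta n \<pi> = std_arc n R ` desc_pairs n \<pi>"
proof -
  note sp = signed_permsD[OF \<pi>]
  have C: "if R c then (c, b) \<in> invs n \<pi> else (a, c) \<in> invs n \<pi>"
    if "(a, b) \<in> invs n \<pi>" "c \<in> labels n" "a < c" "c < b" for a b c
    using camb camb_eq_iff[OF invs_sub] that by blast
  have sides: "{\<pi> c | c. c \<in> labels n \<and> \<pi> b < \<pi> c \<and> \<pi> c < \<pi> a \<and> c < a} = {v \<in> labels n. \<pi> b < v \<and> v < \<pi> a \<and> \<not> R v}"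
    and sides2: "{\<pi> c | c. c \<in> labels n \<and> \<pi> b < \<pi> c \<and> \<pi> c < \<pi> a \<and> b < c} = {v \<in> labels n. \<pi> b < v \<and> v < \<pi> a \<and> R v}"
    if ab: "(a, b) \<in> descents n \<pi>" for a b
  proof -
    have adj: "adj n a b" and "(\<pi> b, \<pi> a) \<in> desc_pairs n \<pi>" using ab by (auto simp: descents_iff desc_pairs_iff)
    then have I: "(\<pi> b, \<pi> a) \<in> invs n \<pi>" using desc_pairs_invs[OF \<pi>] by blast
    have side: "R v \<longleftrightarrow> b < inv \<pi> v" "\<not> R v \<longleftrightarrow> inv \<pi> v < a"
      if v: "v \<in> labels n" "\<pi> b < v" "v < \<pi> a" for v
    proof -
      have "\<not> (a < inv \<pi> v \<and> inv \<pi> v < b)" using adj v sp(8) by (auto simp: adj_def)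
      moreover have "inv \<pi> v \<noteq> a" "inv \<pi> v \<noteq> b" using v sp(5)[of v] by auto
      ultimately have "inv \<pi> v < a \<or> b < inv \<pi> v" by linarith
      moreover have "a < b" using adj by (simp add: adj_def)
      ultimately show "R v \<longleftrightarrow> b < inv \<pi> v" "\<not> R v \<longleftrightarrow> inv \<pi> v < a"
        using C[OF I v] by (auto simp: invs_iff sp(6) split: if_splits)
    qed
    have img: "v \<in> {\<pi> c | c. P c} \<longleftrightarrow> P (inv \<pi> v)" for v P
    proof
      assume "P (inv \<pi> v)"
      moreover have "v = \<pi> (inv \<pi> v)" by (simp add: sp(5))
      ultimately show "v \<in> {\<pi> c | c. P c}" by blast
    qed (auto simp: sp(6))
    show "{\<pi> c | c. c \<in> labels n \<and> \<pi> b < \<pi> c \<and> \<pi> c < \<pi> a \<and> c < a} = {v \<in> labels n. \<pi> b < v \<and> v < \<pi> a \<and> \<not> R v}"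
      by (rule Set.set_eqI, unfold img) (use side(2) in \<open>auto simp: sp\<close>)
    show "{\<pi> c | c. c \<in> labels n \<and> \<pi> b < \<pi> c \<and> \<pi> c < \<pi> a \<and> b < c} = {v \<in> labels n. \<pi> b < v \<and> v < \<pi> a \<and> R v}"
      by (rule Set.set_eqI, unfold img) (use side(1) in \<open>auto simp: sp\<close>)
  qed
  show ?thesis
    unfolding delta_def desc_pairs_def image_image
  proof (intro image_cong refl, clarify)
    fix a b assume ab: "(a, b) \<in> descents n \<pi>"
    show "Arc (\<pi> b) (\<pi> a) {\<pi> c | c. c \<in> labels n \<and> \<pi> b < \<pi> c \<and> \<pi> c < \<pi> a \<and> c < a}
        {\<pi> c | c. c \<in> labels n \<and> \<pi> b < \<pi> c \<and> \<pi> c < \<pi> a \<and> b < c} = std_arc n R (\<pi> b, \<pi> a)"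
      unfolding std_arc_def prod.case arc.inject using sides[OF ab] sides2[OF ab] by blast
  qed
qed

lemma desc_pairs_uminus:
  assumes \<pi>: "\<pi> \<in> signed_perms n" and "(p, q) \<in> desc_pairs n \<pi>"
  shows "(- q, - p) \<in> desc_pairs n \<pi>"
  using assms(2) signed_permsD(2)[OF \<pi>] adj_uminus unfolding desc_pairs_iff
  by (metis neg_less_iff_less)

section \<open>Monotone curves and their projections\<close>

definition lft :: "nat \<Rightarrow> (int \<Rightarrow> bool) \<Rightarrow> int \<Rightarrow> int \<Rightarrow> int set" where
  "lft n R a b = {v \<in> labels n. a < v \<and> v < b \<and> \<not> R v}"

definition rgt :: "nat \<Rightarrow> (int \<Rightarrow> bool) \<Rightarrow> int \<Rightarrow> int \<Rightarrow> int set" where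
  "rgt n R a b = {v \<in> labels n. a < v \<and> v < b \<and> R v}"

definition std_curve :: "nat \<Rightarrow> (int \<Rightarrow> bool) \<Rightarrow> (real \<Rightarrow> real) \<Rightarrow> int \<Rightarrow> int \<Rightarrow> bool" where
  "std_curve n R F a b \<longleftrightarrow> a \<in> labels n \<and> b \<in> labels n \<and> a < b \<and>
     continuous_on {real_of_int a..real_of_int b} F \<and> F a = 0 \<and> F b = 0 \<and>
     (\<forall>i \<in> inner_points n a b. if R i then F i < 0 else 0 < F i)"

lemma mem_curve: "(x, y) \<in> curve f a b \<longleftrightarrow> real_of_int a \<le> y \<and> y \<le> real_of_int b \<and> x = f y"
  by (auto simp: curve_def)

lemma uminus_curve: "uminus ` curve f a b = curve (\<lambda>y. - f (- y)) (- b) (- a)"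
proof (rule Set.set_eqI, clarify)
  fix x y :: real
  have "(x, y) \<in> uminus ` curve f a b \<longleftrightarrow> - (x, y) \<in> curve f a b"
    by (metis (no_types, lifting) image_iff minus_minus)
  then show "(x, y) \<in> uminus ` curve f a b \<longleftrightarrow> (x, y) \<in> curve (\<lambda>y. - f (- y)) (- b) (- a)"
    by (auto simp: mem_curve)
qed

lemma curve_eqD:
  assumes eq: "curve f a b = curve g a' b'" and "a \<le> b"
  shows "a = a'" "b = b'" "real_of_int a \<le> y \<Longrightarrow> y \<le> real_of_int b \<Longrightarrow> f y = g y"
proof -
  have iff: "real_of_int a \<le> y \<and> y \<le> real_of_int b \<and> x = f y \<longleftrightarrow>
      real_of_int a' \<le> y \<and> y \<le> real_of_int b' \<and> x = g y" for x y
    using eq by (metis mem_curve)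
  have "real_of_int a' \<le> real_of_int a" "real_of_int b \<le> real_of_int b'" "real_of_int a \<le> real_of_int b'"
    using iff[where x = "f a" and y = "real_of_int a"] iff[where x = "f b" and y = "real_of_int b"] assms(2) by auto
  moreover then have "real_of_int a \<le> real_of_int a'" "real_of_int b' \<le> real_of_int b"
    using iff[where x = "g a'" and y = "real_of_int a'"] iff[where x = "g b'" and y = "real_of_int b'"] by auto
  ultimately show "a = a'" "b = b'" by linarith+
  show "real_of_int a \<le> y \<Longrightarrow> y \<le> real_of_int b \<Longrightarrow> f y = g y"
    using iff[where x = "f y" and y = y] by auto
qed

lemma sign_const:
  fixes h :: "real \<Rightarrow> real"
  assumes "continuous_on {m..M} h" "m \<le> M" and nz: "\<And>y. m \<le> y \<Longrightarrow> y \<le> M \<Longrightarrow> h y \<noteq> 0"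
  shows "0 < h m \<longleftrightarrow> 0 < h M"
proof
  assume "0 < h m"
  show "0 < h M"
  proof (rule ccontr)
    assume "\<not> 0 < h M"
    then obtain x where "m \<le> x" "x \<le> M" "h x = 0"
      using IVT2'[of h M 0 m] assms \<open>0 < h m\<close> by auto
    then show False using nz by blast
  qed
next
  assume "0 < h M"
  show "0 < h m"
  proof (rule ccontr)
    assume "\<not> 0 < h m"
    then obtain x where "m \<le> x" "x \<le> M" "h x = 0"
      using IVT'[of h m 0 M] assms \<open>0 < h M\<close> by auto
    then show False using nz by blast
  qed
qed

lemma std_curve_inner:
  "std_curve n R F a b \<Longrightarrow> i \<in> labels n \<Longrightarrow> a < i \<Longrightarrow> i < b \<Longrightarrow> (0 < F i \<longleftrightarrow> \<not> R i) \<and> (F i < 0 \<longleftrightarrow> R i) \<and> F i \<noteq> 0"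
  by (auto simp: std_curve_def inner_points_def split: if_splits dest: bspec[of _ _ i])

lemma std_curve_sides:
  assumes "std_curve n R F a b"
  shows "points_left_of n F a b = lft n R a b" "points_right_of n F a b = rgt n R a b"
  using std_curve_inner[OF assms]
  by (auto simp: points_left_of_def points_right_of_def lft_def rgt_def inner_points_def)

lemma std_curveI:
  assumes "a \<in> labels n" "b \<in> labels n" "a < b" "continuous_on {real_of_int a..real_of_int b} F"
    "F a = 0" "F b = 0" "\<And>i. i \<in> labels n \<Longrightarrow> a < i \<Longrightarrow> i < b \<Longrightarrow> if R i then F i < 0 else 0 < F i"
  shows "std_curve n R F a b"
  using assms by (auto simp: std_curve_def inner_points_def)

lemma std_arc_eq: "std_arc n R (a, b) = Arc a b (lft n R a b) (rgt n R a b)"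
  by (simp add: std_arc_def lft_def rgt_def)

lemma represents_std_arc:
  "represents_arc n C (std_arc n R (a, b)) \<longleftrightarrow> (\<exists>F. std_curve n R F a b \<and> C = curve F a b)"
proof
  assume "represents_arc n C (std_arc n R (a, b))"
  then obtain F where F: "a \<in> labels n" "b \<in> labels n" "a < b" "admissible n F a b" "F a = 0" "F b = 0"
    "lft n R a b = points_left_of n F a b" "rgt n R a b = points_right_of n F a b" "C = curve F a b"
    by (auto simp: std_arc_eq)
  have "if R i then F i < 0 else 0 < F i" if "i \<in> labels n" "a < i" "i < b" for i
  proof -
    have "i \<in> lft n R a b \<longleftrightarrow> \<not> R i" "i \<in> rgt n R a b \<longleftrightarrow> R i" using that by (auto simp: lft_def rgt_def)
    then show ?thesis unfolding F(7,8) by (auto simp: points_left_of_def points_right_of_def)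
  qed
  then have "std_curve n R F a b" using F by (intro std_curveI) (auto simp: admissible_def)
  then show "\<exists>F. std_curve n R F a b \<and> C = curve F a b" using F by blast
next
  assume "\<exists>F. std_curve n R F a b \<and> C = curve F a b"
  then obtain F where F: "std_curve n R F a b" "C = curve F a b" by blast
  then have "admissible n F a b"
    using std_curve_inner[OF F(1)] by (auto simp: std_curve_def admissible_def inner_points_def)
  then show "represents_arc n C (std_arc n R (a, b))"
    using F std_curve_sides[OF F(1)] by (auto simp: std_arc_eq std_curve_def)
qed

lemma std_curve_uminus:
  assumes F: "std_curve n R F a b" and R: "\<And>v. v \<in> labels n \<Longrightarrow> R (- v) \<longleftrightarrow> \<not> R v"
  shows "std_curve n R (\<lambda>y. - F (- y)) (- b) (- a)"
proof (rule std_curveI)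
  have "continuous_on {real_of_int a..real_of_int b} F" using F by (simp add: std_curve_def)
  then show "continuous_on {real_of_int (- b)..real_of_int (- a)} (\<lambda>y. - F (- y))"
    by (intro continuous_on_minus continuous_on_compose2[of _ F _ uminus]) (auto intro: continuous_intros)
  fix i assume i: "i \<in> labels n" "- b < i" "i < - a"
  then show "if R i then - F (- real_of_int i) < 0 else 0 < - F (- real_of_int i)"
    using std_curve_inner[OF F, of "- i"] R[OF i(1)] by auto
qed (use F in \<open>auto simp: std_curve_def\<close>)

definition label_points :: "nat \<Rightarrow> (real \<times> real) set" where
  "label_points n = (\<lambda>i. (0, real_of_int i)) ` labels n"

text \<open>A meeting point would be a labeled point. As the endpoints differ, its height is
  strictly inside the range of one of the curves, and that curve avoids the labeled point.\<close>

lemma std_curves_disjoint: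
  assumes F: "std_curve n R F a b" and G: "std_curve n R G a' b'" and ne: "a \<noteq> a'" "b \<noteq> b'"
    and I: "curve F a b \<inter> curve G a' b' \<subseteq> label_points n"
    and y: "real_of_int (max a a') \<le> y" "y \<le> real_of_int (min b b')" and mM: "max a a' < min b b'"
  shows "F y \<noteq> G y"
proof
  assume eq: "F y = G y"
  then have "(F y, y) \<in> curve F a b \<inter> curve G a' b'" using y by (auto simp: mem_curve)
  then have "(F y, y) \<in> label_points n" using I by blast
  then obtain i where i: "i \<in> labels n" "F y = 0" "y = real_of_int i" by (auto simp: label_points_def)
  have bounds: "max a a' \<le> i" "i \<le> min b b'" using y i by linarith+
  have "F i = 0" "G i = 0" using i eq by auto
  then have "\<not> (a < i \<and> i < b)" "\<not> (a' < i \<and> i < b')"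
    using std_curve_inner[OF F i(1)] std_curve_inner[OF G i(1)] by blast+
  then show False using bounds ne mM by linarith
qed

text \<open>Compare the sign of \<open>F - G\<close> at both ends of the common range. In the nested
  case \<open>G\<close> vanishes at both and \<open>F\<close> shows the sides of \<open>a'\<close>
  and \<open>b'\<close>; in the overlapping case \<open>F\<close> vanishes at the upper end, so the
  side of \<open>b\<close> enters with the opposite sign.\<close>

lemma std_curves_noncrossing:
  assumes F: "std_curve n R F a b" and G: "std_curve n R G a' b'"
    and I: "curve F a b \<inter> curve G a' b' \<subseteq> label_points n"
  shows "a < a' \<Longrightarrow> a' < b' \<Longrightarrow> b' < b \<Longrightarrow> R a' = R b'"
    and "a < a' \<Longrightarrow> a' < b \<Longrightarrow> b < b' \<Longrightarrow> R a' \<noteq> R b"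
proof -
  have cF: "continuous_on {real_of_int a..real_of_int b} F" and cG: "continuous_on {real_of_int a'..real_of_int b'} G"
    and lab: "a' \<in> labels n" "b' \<in> labels n" "b \<in> labels n" and z: "F b = 0" "G a' = 0" "G b' = 0"
    using F G by (auto simp: std_curve_def)
  have cont: "continuous_on {real_of_int m..real_of_int M} (\<lambda>y. F y - G y)"
    if "a \<le> m" "a' \<le> m" "M \<le> b" "M \<le> b'" for m M
    using that by (intro continuous_on_diff continuous_on_subset[OF cF] continuous_on_subset[OF cG]) auto
  { assume lt: "a < a'" "a' < b'" "b' < b"
    have "0 < F a' - G a' \<longleftrightarrow> 0 < F b' - G b'"
      by (rule sign_const[where h = "\<lambda>y. F y - G y", OF cont])
         (use lt std_curves_disjoint[OF F G _ _ I] in auto)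
    then show "R a' = R b'"
      using z std_curve_inner[OF F lab(1)] std_curve_inner[OF F lab(2)] lt by auto }
  { assume lt: "a < a'" "a' < b" "b < b'"
    have "0 < F a' - G a' \<longleftrightarrow> 0 < F b - G b"
      by (rule sign_const[where h = "\<lambda>y. F y - G y", OF cont])
         (use lt std_curves_disjoint[OF F G _ _ I] in auto)
    then show "R a' \<noteq> R b"
      using z std_curve_inner[OF F lab(1)] std_curve_inner[OF G lab(3)] lt by auto }
qed

section \<open>Points of projected curves\<close>

lemma orb_proj_eq_iff: "orb_proj u = orb_proj v \<longleftrightarrow> u = v \<or> u = - v"
  by (cases u; cases v) auto

lemma Upper_in_proj_curve:
  assumes "0 \<le> a"
  shows "Upper (x, y) \<in> orb_proj ` curve f a b \<longleftrightarrow> 0 < y \<and> real_of_int a \<le> y \<and> y \<le> real_of_int b \<and> x = f y"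
proof
  assume "Upper (x, y) \<in> orb_proj ` curve f a b"
  then obtain z where "real_of_int a \<le> z" "z \<le> real_of_int b" "Upper (x, y) = orb_proj (f z, z)"
    by (auto simp: curve_def)
  then show "0 < y \<and> real_of_int a \<le> y \<and> y \<le> real_of_int b \<and> x = f y"
    using assms by (auto split: if_splits)
next
  assume h: "0 < y \<and> real_of_int a \<le> y \<and> y \<le> real_of_int b \<and> x = f y"
  then show "Upper (x, y) \<in> orb_proj ` curve f a b"
    by (intro image_eqI[of _ _ "(f y, y)"]) (auto simp: mem_curve)
qed

lemma Semi_in_proj_curve:
  assumes "0 \<le> a" "a \<le> b"
  shows "Semi r \<in> orb_proj ` curve f a b \<longleftrightarrow> a = 0 \<and> r = \<bar>f 0\<bar>"
proof
  assume "Semi r \<in> orb_proj ` curve f a b"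
  then obtain z where "real_of_int a \<le> z" "z \<le> real_of_int b" "Semi r = orb_proj (f z, z)"
    by (auto simp: curve_def)
  moreover then have "z = 0" using assms by (auto split: if_splits)
  ultimately show "a = 0 \<and> r = \<bar>f 0\<bar>" using assms by auto
next
  assume "a = 0 \<and> r = \<bar>f 0\<bar>"
  then show "Semi r \<in> orb_proj ` curve f a b"
    using assms by (intro image_eqI[of _ _ "(f 0, 0)"]) (auto simp: mem_curve)
qed

text \<open>The pieces of a long arc are ordered on their common range of heights, so the set of points
  determines which point of the fiber at a given height belongs to which piece.\<close>

definition long_pieces :: "orb_point set \<Rightarrow> int \<Rightarrow> int \<Rightarrow> (real \<Rightarrow> real) \<Rightarrow> (real \<Rightarrow> real) \<Rightarrow> bool" where
  "long_pieces C p q f g \<longleftrightarrow> 1 \<le> p \<and> 1 \<le> q \<and> p \<noteq> q \<and> f p = 0 \<and> g q = 0 \<and>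
     (\<forall>y. 0 < y \<longrightarrow> y \<le> real_of_int p \<longrightarrow> y \<le> real_of_int q \<longrightarrow> f y < g y) \<and>
     (\<forall>x y. Upper (x, y) \<in> C \<longleftrightarrow> 0 < y \<and> (y \<le> real_of_int p \<and> x = f y \<or> y \<le> real_of_int q \<and> x = g y))"

lemma long_pieces_less:
  "long_pieces C p q f g \<Longrightarrow> 0 < y \<Longrightarrow> y \<le> real_of_int p \<Longrightarrow> y \<le> real_of_int q \<Longrightarrow> f y < g y"
  by (simp add: long_pieces_def)

lemma long_pieces_Upper:
  "long_pieces C p q f g \<Longrightarrow>
    Upper (x, y) \<in> C \<longleftrightarrow> 0 < y \<and> (y \<le> real_of_int p \<and> x = f y \<or> y \<le> real_of_int q \<and> x = g y)"
  by (simp add: long_pieces_def)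

lemma long_pieces_order:
  assumes "continuous_on {0..real_of_int p} f" "continuous_on {0..real_of_int q} g" "f 0 < g 0"
    and "curve f 0 p \<inter> curve g 0 q = {}" and y: "0 \<le> y" "y \<le> real_of_int p" "y \<le> real_of_int q"
  shows "f y < g y"
proof -
  have "continuous_on {0..y} (\<lambda>z. g z - f z)"
    using y by (intro continuous_on_diff continuous_on_subset[OF assms(1)] continuous_on_subset[OF assms(2)]) auto
  moreover have "g z - f z \<noteq> 0" if "0 \<le> z" "z \<le> y" for z
  proof
    assume "g z - f z = 0"
    then have "(f z, z) \<in> curve f 0 p \<inter> curve g 0 q" using that y by (auto simp: mem_curve)
    then show False using assms(4) by blast
  qed
  ultimately show ?thesis using sign_const[of 0 y "\<lambda>z. g z - f z"] assms(3) y by auto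
qed

lemma represents_long_pieces:
  assumes "represents_arc_B n C (Long p q L R)"
  obtains f g r where "long_pieces C p q f g" "L = points_left_of n f 0 p" "R = points_right_of n g 0 q"
    "0 < r" "\<And>s. Semi s \<in> C \<longleftrightarrow> s = r" "admissible n f 0 p" "admissible n g 0 q"
    "f 0 = - r" "g 0 = r" "curve f 0 p \<inter> curve g 0 q = {}" "C = orb_proj ` (curve f 0 p \<union> curve g 0 q)"
proof -
  obtain f g r where h: "1 \<le> p" "1 \<le> q" "p \<noteq> q" "0 < r" "admissible n f 0 p" "f 0 = - r" "f p = 0"
      "admissible n g 0 q" "g 0 = r" "g q = 0" "curve f 0 p \<inter> curve g 0 q = {}"
      "L = points_left_of n f 0 p" "R = points_right_of n g 0 q" "C = orb_proj ` (curve f 0 p \<union> curve g 0 q)"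
    using assms by auto
  have "f y < g y" if "0 < y" "y \<le> real_of_int p" "y \<le> real_of_int q" for y
    by (rule long_pieces_order[OF _ _ _ h(11)]) (use h that in \<open>auto simp: admissible_def\<close>)
  then have "long_pieces C p q f g"
    using h unfolding long_pieces_def h(14) image_Un by (auto simp: Upper_in_proj_curve)
  moreover have "Semi s \<in> C \<longleftrightarrow> s = r" for s
    using h unfolding h(14) image_Un by (auto simp: Semi_in_proj_curve)
  ultimately show ?thesis using that h by blast
qed

lemma long_pieces_unique:
  assumes P: "long_pieces C p q f g" and P': "long_pieces C p' q' f' g'"
  shows "p = p'" "q = q'"
    "0 < y \<Longrightarrow> y \<le> real_of_int p \<Longrightarrow> f y = f' y" "0 < y \<Longrightarrow> y \<le> real_of_int q \<Longrightarrow> g y = g' y"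
proof -
  have maxle: "max p q \<le> max p' q'"
    if "long_pieces C p q f g" "long_pieces C p' q' f' g'" for p q f g p' q' f' g'
  proof -
    have "Upper (if q < p then f p else g q, real_of_int (max p q)) \<in> C"
      using that(1) by (auto simp: long_pieces_def)
    then show ?thesis using that(2) unfolding long_pieces_def
      by (metis max.coboundedI1 max.coboundedI2 of_int_le_iff)
  qed
  have minle: "min p q \<le> min p' q'"
    if "long_pieces C p q f g" "long_pieces C p' q' f' g'" for p q f g p' q' f' g'
  proof (rule ccontr)
    assume n: "\<not> min p q \<le> min p' q'"
    let ?y = "real_of_int (min p q)"
    have "Upper (f ?y, ?y) \<in> C" "Upper (g ?y, ?y) \<in> C" "f ?y < g ?y"
      using that(1) by (auto simp: long_pieces_def)
    then show False using that(2) n unfolding long_pieces_def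
      by (smt (verit, best) of_int_le_iff)
  qed
  \<comment> \<open>At the lower of the two endpoints the piece ending there is on the axis, and the
    other is on a definite side of it; exchanging left and right would put it on the opposite
    side.\<close>
  have swap: False if "long_pieces C p q f g" "long_pieces C q p f' g'" "p < q" for p q f g f' g'
  proof -
    let ?y = "real_of_int p"
    have y: "0 < ?y" "?y \<le> real_of_int q" "f ?y = 0" "g' ?y = 0"
      using that by (auto simp: long_pieces_def)
    have "f ?y < g ?y" "f' ?y < g' ?y"
      using long_pieces_less[OF that(1), of ?y] long_pieces_less[OF that(2), of ?y] y by blast+
    moreover have "Upper (g ?y, ?y) \<in> C" using long_pieces_Upper[OF that(1), of "g ?y" ?y] y by blast
    then have "g ?y = f' ?y \<or> g ?y = g' ?y" using long_pieces_Upper[OF that(2), of "g ?y" ?y] by blast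
    ultimately show False using y by auto
  qed
  have ne: "p \<noteq> q" using P by (auto simp: long_pieces_def)
  have "max p q = max p' q'" "min p q = min p' q'"
    using antisym[OF maxle[OF P P'] maxle[OF P' P]] antisym[OF minle[OF P P'] minle[OF P' P]] by blast+
  then have "p = p' \<and> q = q' \<or> p = q' \<and> q = p'" by (auto simp: max_def min_def split: if_splits)
  moreover have "\<not> (p = q' \<and> q = p')"
    using swap[of p q f g f' g'] swap[of q p f' g' f g] P P' ne by (cases "p < q") auto
  ultimately show eq: "p = p'" "q = q'" by auto
  have iff: "y \<le> real_of_int p \<and> x = f y \<or> y \<le> real_of_int q \<and> x = g y \<longleftrightarrow>
      y \<le> real_of_int p \<and> x = f' y \<or> y \<le> real_of_int q \<and> x = g' y" if "0 < y" for x y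
    using long_pieces_Upper[OF P, of x y] long_pieces_Upper[OF P', of x y] that eq by simp
  have lt: "f y < g y" "f' y < g' y" if "0 < y" "y \<le> real_of_int p" "y \<le> real_of_int q" for y
    using P P' that eq unfolding long_pieces_def by auto
  show "f y = f' y" if "0 < y" "y \<le> real_of_int p"
  proof (cases "y \<le> real_of_int q")
    case True
    then have "f y = f' y \<or> f y = g' y" "f' y = f y \<or> f' y = g y"
      using iff[OF that(1), of "f y"] iff[OF that(1), of "f' y"] that by blast+
    then show ?thesis using lt[OF that True] by linarith
  qed (use iff[OF that(1), of "f y"] that in blast)
  show "g y = g' y" if "0 < y" "y \<le> real_of_int q"
  proof (cases "y \<le> real_of_int p")
    case True
    then have "g y = f' y \<or> g y = g' y" "g' y = f y \<or> g' y = g y"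
      using iff[OF that(1), of "g y"] iff[OF that(1), of "g' y"] that by blast+
    then show ?thesis using lt[OF that(1) True that(2)] by linarith
  qed (use iff[OF that(1), of "g y"] that in blast)
qed

lemma points_cong:
  assumes "\<And>i. i \<in> labels n \<Longrightarrow> a < i \<Longrightarrow> i < b \<Longrightarrow> f (real_of_int i) = g (real_of_int i)"
  shows "points_left_of n f a b = points_left_of n g a b" "points_right_of n f a b = points_right_of n g a b"
  using assms by (auto simp: points_left_of_def points_right_of_def inner_points_def)

text \<open>The semicircle points on the arc tell the kinds apart: none, only \<open>Semi 0\<close>,
  or one of positive radius. Within a kind, the \<open>Upper\<close> points recover the functions at
  all positive heights.\<close>

lemma represents_arc_B_unique:
  assumes "represents_arc_B n C \<beta>" "represents_arc_B n C \<beta>'"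
  shows "\<beta> = \<beta>'"
proof -
  have Ord: "1 \<le> p \<and> p < q \<and> (\<exists>f. (\<forall>x y. Upper (x, y) \<in> C \<longleftrightarrow> real_of_int p \<le> y \<and> y \<le> real_of_int q \<and> x = f y) \<and>
      (\<forall>r. Semi r \<notin> C) \<and> L = points_left_of n f p q \<and> R = points_right_of n f p q)"
    if h: "represents_arc_B n C (Ordinary p q L R)" for p q L R
  proof -
    obtain f where f: "1 \<le> p" "p < q" "L = points_left_of n f p q" "R = points_right_of n f p q" "C = orb_proj ` curve f p q"
      using h by auto
    then have "Upper (x, y) \<in> C \<longleftrightarrow> real_of_int p \<le> y \<and> y \<le> real_of_int q \<and> x = f y" "Semi r \<notin> C" for x y r
      using Upper_in_proj_curve[of p x y f q] Semi_in_proj_curve[of p q r f] by auto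
    then show ?thesis using f by blast
  qed
  have Orb: "1 \<le> p \<and> (\<exists>f. (\<forall>x y. Upper (x, y) \<in> C \<longleftrightarrow> 0 < y \<and> y \<le> real_of_int p \<and> x = f y) \<and>
      (\<forall>r. Semi r \<in> C \<longleftrightarrow> r = 0) \<and> L = points_left_of n f 0 p \<and> R = points_right_of n f 0 p)"
    if h: "represents_arc_B n C (Orbifold p L R)" for p L R
  proof -
    obtain f where f: "1 \<le> p" "f 0 = 0" "L = points_left_of n f 0 p" "R = points_right_of n f 0 p" "C = orb_proj ` curve f 0 p"
      using h by auto
    then have "Upper (x, y) \<in> C \<longleftrightarrow> 0 < y \<and> y \<le> real_of_int p \<and> x = f y" "Semi r \<in> C \<longleftrightarrow> r = 0" for x y r
      using Upper_in_proj_curve[of 0 x y f p] Semi_in_proj_curve[of 0 p r f] by auto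
    then show ?thesis using f by blast
  qed
  have Lng: "\<exists>f g r. long_pieces C p q f g \<and> L = points_left_of n f 0 p \<and> R = points_right_of n g 0 q \<and>
      0 < r \<and> (\<forall>s. Semi s \<in> C \<longleftrightarrow> s = r)"
    if "represents_arc_B n C (Long p q L R)" for p q L R
  proof (rule represents_long_pieces[OF that])
    fix f g r assume h: "long_pieces C p q f g" "L = points_left_of n f 0 p" "R = points_right_of n g 0 q"
      "0 < r" "\<And>s. Semi s \<in> C \<longleftrightarrow> s = r"
    show ?thesis by (rule exI[of _ f], rule exI[of _ g], rule exI[of _ r]) (use h in simp)
  qed
  have kinds: "represents_arc_B n C (Ordinary p q L R) \<Longrightarrow> Semi r \<notin> C"
    "represents_arc_B n C (Orbifold p L R) \<Longrightarrow> Semi 0 \<in> C"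
    "represents_arc_B n C (Long p q L R) \<Longrightarrow> Semi 0 \<notin> C \<and> (\<exists>r. Semi r \<in> C)" for p q L R r
  proof -
    show "represents_arc_B n C (Ordinary p q L R) \<Longrightarrow> Semi r \<notin> C" using Ord by blast
    show "represents_arc_B n C (Orbifold p L R) \<Longrightarrow> Semi 0 \<in> C" using Orb by blast
    assume "represents_arc_B n C (Long p q L R)"
    then obtain r where "0 < r" "\<forall>s. Semi s \<in> C \<longleftrightarrow> s = r" using Lng by blast
    then show "Semi 0 \<notin> C \<and> (\<exists>r. Semi r \<in> C)" by auto
  qed
  show ?thesis
  proof (cases \<beta>; cases \<beta>')
    fix p q L R p' q' L' R'
    assume b: "\<beta> = Ordinary p q L R" "\<beta>' = Ordinary p' q' L' R'"
    obtain f f' where f: "\<And>x y. Upper (x, y) \<in> C \<longleftrightarrow> real_of_int p \<le> y \<and> y \<le> real_of_int q \<and> x = f y"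
        "L = points_left_of n f p q" "R = points_right_of n f p q"
      and f': "\<And>x y. Upper (x, y) \<in> C \<longleftrightarrow> real_of_int p' \<le> y \<and> y \<le> real_of_int q' \<and> x = f' y"
        "L' = points_left_of n f' p' q'" "R' = points_right_of n f' p' q'"
      and "p < q"
      using Ord[OF assms(1)[unfolded b]] Ord[OF assms(2)[unfolded b]] by blast
    have "curve f p q = curve f' p' q'"
      using f(1) f'(1) by (intro Set.set_eqI, clarify) (metis mem_curve)
    then have "p = p'" "q = q'" "\<And>y. real_of_int p \<le> y \<Longrightarrow> y \<le> real_of_int q \<Longrightarrow> f y = f' y"
      using curve_eqD[of f p q f' p' q'] \<open>p < q\<close> by auto
    then show ?thesis using points_cong[of n p q f f'] b f f' by auto
  next
    fix p L R p' L' R'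
    assume b: "\<beta> = Orbifold p L R" "\<beta>' = Orbifold p' L' R'"
    obtain f f' where f: "\<And>x y. Upper (x, y) \<in> C \<longleftrightarrow> 0 < y \<and> y \<le> real_of_int p \<and> x = f y"
        "L = points_left_of n f 0 p" "R = points_right_of n f 0 p"
      and f': "\<And>x y. Upper (x, y) \<in> C \<longleftrightarrow> 0 < y \<and> y \<le> real_of_int p' \<and> x = f' y"
        "L' = points_left_of n f' 0 p'" "R' = points_right_of n f' 0 p'"
      and pos: "1 \<le> p" "1 \<le> p'"
      using Orb[OF assms(1)[unfolded b]] Orb[OF assms(2)[unfolded b]] by blast
    have "real_of_int p \<le> real_of_int p'" "real_of_int p' \<le> real_of_int p"
      using f(1)[of "f p" p] f'(1)[of "f p" p] f(1)[of "f' p'" p'] f'(1)[of "f' p'" p'] pos by auto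
    then have "p = p'" by simp
    moreover have "f y = f' y" if "0 < y" "y \<le> real_of_int p" for y
      using f(1)[of "f y" y] f'(1)[of "f y" y] that by blast
    ultimately show ?thesis using points_cong[of n 0 p f f'] b f f' by auto
  next
    fix p q L R p' q' L' R'
    assume b: "\<beta> = Long p q L R" "\<beta>' = Long p' q' L' R'"
    obtain f g f' g' where h: "long_pieces C p q f g" "L = points_left_of n f 0 p" "R = points_right_of n g 0 q"
      and h': "long_pieces C p' q' f' g'" "L' = points_left_of n f' 0 p'" "R' = points_right_of n g' 0 q'"
      using Lng[OF assms(1)[unfolded b]] Lng[OF assms(2)[unfolded b]] by blast
    show ?thesis
      using long_pieces_unique[OF h(1) h'(1)] points_cong(1)[of n 0 p f f'] points_cong(2)[of n 0 q g g'] b h h'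
      by auto
  qed (use kinds assms in blast)+
qed

section \<open>From the symmetric model to the orbifold model\<close>

text \<open>The projection of the arc with endpoints \<open>a < b\<close> and sides prescribed by \<open>R\<close>. In the long case
  the piece ending higher passes the endpoint \<open>m\<close> of the other one, on its prescribed side.\<close>

definition type_B :: "nat \<Rightarrow> (int \<Rightarrow> bool) \<Rightarrow> int \<times> int \<Rightarrow> arc_B" where
  "type_B n R = (\<lambda>(a, b).
     if 0 < a then Ordinary a b (lft n R a b) (rgt n R a b)
     else if b < 0 then Ordinary (- b) (- a) (lft n R (- b) (- a)) (rgt n R (- b) (- a))
     else if a = - b then Orbifold b (lft n R 0 b) (rgt n R 0 b)
     else let m = min (- a) b; M = max (- a) b in
       if R m then Long M m (lft n R 0 M) (rgt n R 0 m) else Long m M (lft n R 0 m) (rgt n R 0 M))"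

text \<open>Endpoint pairs of the preimages in the plane. Followed from its right endpoint
  \<open>q\<close> down to the axis, a long arc continues along the half-turn of its left piece to
  \<open>-p\<close>; the other preimage is the half-turn of this one.\<close>

fun lifts :: "arc_B \<Rightarrow> (int \<times> int) set" where
  "lifts (Ordinary p q L R) = {(p, q), (- q, - p)}"
| "lifts (Orbifold p L R) = {(- p, p)}"
| "lifts (Long p q L R) = {(- p, q), (- q, p)}"

lemma type_B_uminus: "(a, b) \<in> lpairs n \<Longrightarrow> type_B n R (- b, - a) = type_B n R (a, b)"
  by (auto simp: type_B_def lpairs_iff labels_iff Let_def min.commute max.commute)

lemma lifts_type_B: "(a, b) \<in> lpairs n \<Longrightarrow> lifts (type_B n R (a, b)) = {(a, b), (- b, - a)}"
  by (auto simp: type_B_def lpairs_iff labels_iff Let_def min_def max_def)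

lemma down_endpoints_type_B:
  "(a, b) \<in> lpairs n \<Longrightarrow> e \<in> down_endpoints (type_B n R (a, b)) \<longleftrightarrow> 0 < e \<and> (e = b \<or> e = - a)"
  by (auto simp: type_B_def lpairs_iff labels_iff Let_def min_def max_def)

lemma up_endpoints_type_B:
  "(a, b) \<in> lpairs n \<Longrightarrow> e \<in> up_endpoints (type_B n R (a, b)) \<longleftrightarrow> 0 < e \<and> (e = a \<or> e = - b)"
  by (auto simp: type_B_def lpairs_iff labels_iff Let_def min_def max_def)

lemma orb_proj_uminus: "orb_proj (- u) = orb_proj u"
  by (simp add: orb_proj_eq_iff)

lemma orb_proj_image_uminus: "orb_proj ` uminus ` S = orb_proj ` S"
  by (simp add: image_image orb_proj_uminus)

lemma upper_part_sides:
  assumes F: "std_curve n R F a b" and "a < 0"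
  shows "admissible n F 0 b" "points_left_of n F 0 b = lft n R 0 b" "points_right_of n F 0 b = rgt n R 0 b"
proof -
  have inner: "(0 < F i \<longleftrightarrow> \<not> R i) \<and> (F i < 0 \<longleftrightarrow> R i) \<and> F i \<noteq> 0" if "i \<in> labels n" "0 < i" "i < b" for i
    using std_curve_inner[OF F, of i] that assms by auto
  have "continuous_on {real_of_int a..real_of_int b} F" using F by (simp add: std_curve_def)
  then have "continuous_on {real_of_int 0..real_of_int b} F"
    by (rule continuous_on_subset) (use assms in auto)
  then show "admissible n F 0 b" using inner by (auto simp: admissible_def inner_points_def)
  show "points_left_of n F 0 b = lft n R 0 b" "points_right_of n F 0 b = rgt n R 0 b"
    using inner by (auto simp: points_left_of_def points_right_of_def lft_def rgt_def inner_points_def)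
qed

lemma curve_split: "a \<le> 0 \<Longrightarrow> 0 \<le> b \<Longrightarrow> curve f a b = curve f 0 b \<union> curve f a 0"
  by (rule Set.set_eqI, clarify) (auto simp: mem_curve)

lemma proj_curve_split:
  assumes "a \<le> 0" "0 \<le> b"
  shows "orb_proj ` curve F a b = orb_proj ` (curve F 0 b \<union> curve (\<lambda>y. - F (- y)) 0 (- a))"
proof -
  have "curve (\<lambda>y. - F (- y)) 0 (- a) = uminus ` curve F a 0" by (simp add: uminus_curve)
  then show ?thesis unfolding curve_split[OF assms] image_Un by (simp add: orb_proj_image_uminus)
qed

section \<open>Projecting a symmetric drawing\<close>

context
  fixes n R D c
  assumes R: "\<And>v. v \<in> labels n \<Longrightarrow> R (- v) \<longleftrightarrow> \<not> R v"
    and D: "D \<subseteq> lpairs n" and draw: "symmetric_drawing n (std_arc n R ` D) c"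
begin

text \<open>Symmetry says only that the rotated curve is drawn for some arc; its extreme heights
  show that this arc has the endpoints \<open>-b\<close> and \<open>-a\<close>.\<close>

lemma drawn_curve:
  assumes "(a, b) \<in> D"
  obtains F where "std_curve n R F a b" "c (std_arc n R (a, b)) = curve F a b"
    "(- b, - a) \<in> D" "c (std_arc n R (- b, - a)) = curve (\<lambda>y. - F (- y)) (- b) (- a)"
proof -
  have rep: "\<exists>F. std_curve n R F p q \<and> c (std_arc n R (p, q)) = curve F p q" if "(p, q) \<in> D" for p q
    using draw that represents_std_arc[of n "c (std_arc n R (p, q))"] by (auto simp: symmetric_drawing_def)
  obtain F where F: "std_curve n R F a b" "c (std_arc n R (a, b)) = curve F a b" using rep[OF assms] by blast
  have "uminus ` c (std_arc n R (a, b)) \<in> c ` std_arc n R ` D"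
    using draw assms by (auto simp: symmetric_drawing_def)
  then obtain d where d: "d \<in> D" "uminus ` c (std_arc n R (a, b)) = c (std_arc n R d)" by blast
  obtain p q where pq: "d = (p, q)" by (cases d)
  obtain G where G: "std_curve n R G p q" "c (std_arc n R (p, q)) = curve G p q" using rep[of p q] d(1)[unfolded pq] by blast
  have eq: "curve (\<lambda>y. - F (- y)) (- b) (- a) = curve G p q"
    using d F G pq by (simp add: uminus_curve)
  have "- b \<le> - a" using F by (simp add: std_curve_def)
  then have "p = - b" "q = - a" using curve_eqD(1,2)[OF eq] by auto
  then have "(- b, - a) \<in> D" "c (std_arc n R (- b, - a)) = curve (\<lambda>y. - F (- y)) (- b) (- a)"
    using d(1) pq G(2) eq by auto
  then show ?thesis by (rule that[OF F])
qed

lemma drawn_disjoint: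
  assumes "d \<in> D" "d' \<in> D" "d \<noteq> d'"
  shows "c (std_arc n R d) \<inter> c (std_arc n R d') \<subseteq> label_points n"
proof -
  have "std_arc n R d \<noteq> std_arc n R d'" using assms(3) by (auto simp: std_arc_def split: prod.splits)
  then show ?thesis using draw assms unfolding symmetric_drawing_def label_points_def by blast
qed

text \<open>A curve crossing the axis is folded onto its own upper part and that of its half-turn
  \<open>F'\<close>. If the two curves coincide, they pass through the origin; otherwise they stay
  apart, and \<open>F' 0 = - F 0\<close> makes the crossing point nonzero.\<close>

lemma drawing_projects:
  assumes ab: "(a, b) \<in> D"
  shows "represents_arc_B n (orb_proj ` c (std_arc n R (a, b))) (type_B n R (a, b))"
proof -
  obtain F where F: "std_curve n R F a b" and cF: "c (std_arc n R (a, b)) = curve F a b"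
    and ba: "(- b, - a) \<in> D" and cF': "c (std_arc n R (- b, - a)) = curve (\<lambda>y. - F (- y)) (- b) (- a)"
    using drawn_curve[OF ab] .
  define F' where "F' y = - F (- y)" for y
  have F': "std_curve n R F' (- b) (- a)" unfolding F'_def by (rule std_curve_uminus[OF F R])
  have cF': "c (std_arc n R (- b, - a)) = curve F' (- b) (- a)" using cF' by (simp add: F'_def[abs_def])
  have lab: "a \<in> labels n" "b \<in> labels n" "a < b" and z: "F a = 0" "F b = 0" "F' (- b) = 0" "F' (- a) = 0"
    using F F' by (auto simp: std_curve_def)
  have adm: "admissible n G p q" if "std_curve n R G p q" for G p q
    using that std_curve_inner[OF that] by (auto simp: admissible_def std_curve_def inner_points_def)
  consider "0 < a" | "b < 0" | "a < 0" "0 < b" using lab by (fastforce simp: labels_iff)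
  then show ?thesis
  proof cases
    case 1
    then show ?thesis using lab z std_curve_sides[OF F] adm[OF F]
      by (auto simp: type_B_def cF labels_iff simp del: orb_proj.simps intro!: exI[of _ F])
  next
    case 2
    have "curve F' (- b) (- a) = uminus ` curve F a b" by (simp add: uminus_curve F'_def[abs_def])
    then have "orb_proj ` curve F a b = orb_proj ` curve F' (- b) (- a)" by (simp add: orb_proj_image_uminus)
    then show ?thesis using 2 lab z std_curve_sides[OF F'] adm[OF F']
      by (auto simp: type_B_def cF labels_iff simp del: orb_proj.simps intro!: exI[of _ F'])
  next
    case 3
    have proj: "orb_proj ` curve F a b = orb_proj ` (curve F 0 b \<union> curve F' 0 (- a))"
      using proj_curve_split[of a b F] 3 by (simp add: F'_def[abs_def])
    note up = upper_part_sides[OF F 3(1)]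
    have nb: "- b < 0" using 3 by simp
    note up' = upper_part_sides[OF F' nb]
    show ?thesis
    proof (cases "a = - b")
      case True
      then have eq: "curve F a b = curve F' a b" using cF cF' by simp
      have FF': "F y = F' y" if "real_of_int a \<le> y" "y \<le> real_of_int b" for y
        using curve_eqD(3)[OF eq _ that] lab by simp
      have "F 0 = 0" using FF'[of 0] 3 by (simp add: F'_def)
      moreover have "curve F' 0 (- a) = curve F 0 b"
        by (rule Set.set_eqI, clarify) (use True FF' 3 in \<open>auto simp: mem_curve\<close>)
      moreover then have "orb_proj ` c (std_arc n R (a, b)) = orb_proj ` curve F 0 b"
        unfolding cF proj by simp
      moreover have "type_B n R (a, b) = Orbifold b (lft n R 0 b) (rgt n R 0 b)"
        using 3 True by (simp add: type_B_def)
      ultimately show ?thesis using 3 lab z up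
        by (auto simp: labels_iff simp del: orb_proj.simps intro!: exI[of _ F])
    next
      case False
      define m where "m = min (- a) b"
      have "(a, b) \<noteq> (- b, - a)" using False by auto
      then have I: "curve F a b \<inter> curve F' (- b) (- a) \<subseteq> label_points n"
        using drawn_disjoint[OF ab ba] cF cF' by simp
      have ne: "F y \<noteq> F' y" if "- real_of_int m \<le> y" "y \<le> real_of_int m" for y
        using std_curves_disjoint[OF F F' _ _ I, of y] False 3 that
        by (auto simp: m_def min_def max_def split: if_splits)
      have m: "0 < m" "m \<in> labels n" using lab 3 by (auto simp: m_def min_def)
      have F0: "F' 0 = - F 0" by (simp add: F'_def)
      have sgn: "0 < F 0 - F' 0 \<longleftrightarrow> 0 < F m - F' m"
      proof (rule sign_const[where h = "\<lambda>y. F y - F' y"])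
        have "continuous_on {real_of_int 0..real_of_int b} F" "continuous_on {real_of_int 0..real_of_int (- a)} F'"
          using up up' by (auto simp: admissible_def)
        then show "continuous_on {0..real_of_int m} (\<lambda>y. F y - F' y)"
          by (intro continuous_on_diff) (auto elim!: continuous_on_subset simp: m_def)
      qed (use ne m in force)+
      \<comment> \<open>The left-right order of the two parts at the axis is that at height
        \<open>m\<close>, where one of them ends and the other passes \<open>m\<close> on the side
        prescribed by \<open>R\<close>. This tells which endpoint of the long arc is the left
        one.\<close>
      have R0: "0 < F 0 \<longleftrightarrow> R m = (b < - a)"
      proof (cases "b < - a")
        case True
        then have "m = b" by (simp add: m_def)
        then have "0 < F 0 \<longleftrightarrow> 0 < F (- b)" using sgn z F0 by (simp add: F'_def)
        moreover have "\<dots> \<longleftrightarrow> R b" using std_curve_inner[OF F, of "- b"] True 3 lab R by auto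
        ultimately show ?thesis using True \<open>m = b\<close> by simp
      next
        case nlt: False
        then have "m = - a" "- a < b" using False by (auto simp: m_def)
        then have "0 < F 0 \<longleftrightarrow> 0 < F (- a)" using sgn z F0 by simp
        moreover have "\<dots> \<longleftrightarrow> \<not> R (- a)" using std_curve_inner[OF F, of "- a"] \<open>- a < b\<close> 3 lab by auto
        ultimately show ?thesis using nlt \<open>m = - a\<close> by simp
      qed
      have "F y \<noteq> F' y" if "0 \<le> y" "y \<le> - real_of_int a" "y \<le> real_of_int b" for y
        using ne[of y] m that by (cases "- a \<le> b") (auto simp: m_def)
      then have disj: "curve F 0 b \<inter> curve F' 0 (- a) = {}" "curve F' 0 (- a) \<inter> curve F 0 b = {}"
        by (auto simp: mem_curve) metis+
      have bd: "1 \<le> b" "b \<le> int n" "1 \<le> - a" "- a \<le> int n" using lab 3 by (auto simp: labels_iff)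
      show ?thesis
      proof (cases "0 < F 0")
        case True
        have "type_B n R (a, b) = Long (- a) b (lft n R 0 (- a)) (rgt n R 0 b)"
          using False 3 R0 True by (auto simp: type_B_def Let_def m_def[symmetric]) (auto simp: m_def)
        moreover have "represents_arc_B n (orb_proj ` c (std_arc n R (a, b))) (Long (- a) b (lft n R 0 (- a)) (rgt n R 0 b))"
          unfolding represents_arc_B.simps
          using bd False up up' disj z F0 True
          by (intro conjI exI[of _ F'] exI[of _ F] exI[of _ "F 0"]) (auto simp: cF proj Un_commute)
        ultimately show ?thesis by simp
      next
        case nonpos: False
        then have neg: "F 0 < 0" using ne[of 0] m F0 by simp
        have "type_B n R (a, b) = Long b (- a) (lft n R 0 b) (rgt n R 0 (- a))"
          using False 3 R0 nonpos by (auto simp: type_B_def Let_def m_def[symmetric]) (auto simp: m_def)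
        moreover have "represents_arc_B n (orb_proj ` c (std_arc n R (a, b))) (Long b (- a) (lft n R 0 b) (rgt n R 0 (- a)))"
          unfolding represents_arc_B.simps
          using bd False up up' disj z F0 neg
          by (intro conjI exI[of _ F] exI[of _ F'] exI[of _ "- F 0"]) (auto simp: cF proj)
        ultimately show ?thesis by simp
      qed
    qed
  qed
qed

text \<open>Each type-B arc is drawn by projecting one chosen preimage. A common point of two
  projections comes from points equal up to sign, so after replacing one preimage by its half-turn
  it is a common point of two drawn curves.\<close>

lemma noncrossing_type_B:
  assumes uni: "\<And>p q p' q'. (p, q) \<in> D \<Longrightarrow> (p', q') \<in> D \<Longrightarrow> p = p' \<longleftrightarrow> q = q'"
  shows "noncrossing_diagram_B n (type_B n R ` D)"
proof -
  define dd where "dd \<beta> = (SOME d. d \<in> D \<and> type_B n R d = \<beta>)" for \<beta>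
  have dd: "dd \<beta> \<in> D \<and> type_B n R (dd \<beta>) = \<beta>" if "\<beta> \<in> type_B n R ` D" for \<beta>
    unfolding dd_def by (rule someI_ex) (use that in blast)
  define cB where "cB \<beta> = orb_proj ` c (std_arc n R (dd \<beta>))" for \<beta>
  have rep: "represents_arc_B n (cB \<beta>) \<beta>" if "\<beta> \<in> type_B n R ` D" for \<beta>
    using drawing_projects[of "fst (dd \<beta>)" "snd (dd \<beta>)"] dd[OF that] by (simp add: cB_def)
  have Dm: "(- b, - a) \<in> D" if "(a, b) \<in> D" for a b using drawn_curve[OF that] by blast
  have disj: "cB \<beta> \<inter> cB \<beta>' \<subseteq> (\<lambda>i. Upper (0, real_of_int i)) ` {1..int n}"
    if b: "\<beta> \<in> type_B n R ` D" "\<beta>' \<in> type_B n R ` D" and ne: "\<beta> \<noteq> \<beta>'" for \<beta> \<beta>'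
  proof
    fix P assume "P \<in> cB \<beta> \<inter> cB \<beta>'"
    then obtain u v where uv: "u \<in> c (std_arc n R (dd \<beta>))" "v \<in> c (std_arc n R (dd \<beta>'))"
        "P = orb_proj u" "P = orb_proj v" by (auto simp: cB_def)
    obtain p q where pq: "dd \<beta> = (p, q)" by (cases "dd \<beta>")
    have pqD: "(p, q) \<in> D" "type_B n R (p, q) = \<beta>" using dd[OF b(1)] pq by auto
    have mD: "(- q, - p) \<in> D" "type_B n R (- q, - p) = \<beta>"
      using Dm[OF pqD(1)] type_B_uminus[of p q n R] pqD D by auto
    have ne': "(p, q) \<noteq> dd \<beta>'" "(- q, - p) \<noteq> dd \<beta>'" using dd[OF b(2)] pqD mD ne by auto
    have dd': "dd \<beta>' \<in> D" using dd[OF b(2)] by blast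
    have "v = u \<or> v = - u" using uv orb_proj_eq_iff[of v u] by auto
    then have "v \<in> label_points n"
    proof
      assume "v = u"
      then show ?thesis using drawn_disjoint[OF pqD(1) dd' ne'(1)] uv pq by auto
    next
      assume v: "v = - u"
      obtain F where "c (std_arc n R (p, q)) = curve F p q"
        "c (std_arc n R (- q, - p)) = curve (\<lambda>y. - F (- y)) (- q) (- p)" using drawn_curve[OF pqD(1)] .
      then have "- u \<in> c (std_arc n R (- q, - p))" using uv(1) pq uminus_curve[of F p q] by (metis image_eqI)
      then show ?thesis using drawn_disjoint[OF mD(1) dd' ne'(2)] uv v by auto
    qed
    then obtain i where "i \<in> labels n" "v = (0, real_of_int i)" by (auto simp: label_points_def)
    then have "P = Upper (0, real_of_int \<bar>i\<bar>)" "\<bar>i\<bar> \<in> {1..int n}"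
      using uv by (auto simp: labels_iff abs_if)
    then show "P \<in> (\<lambda>i. Upper (0, real_of_int i)) ` {1..int n}" by blast
  qed
  have ends: "down_endpoints \<beta> \<inter> down_endpoints \<beta>' = {} \<and> up_endpoints \<beta> \<inter> up_endpoints \<beta>' = {}"
    if b: "\<beta> \<in> type_B n R ` D" "\<beta>' \<in> type_B n R ` D" and ne: "\<beta> \<noteq> \<beta>'" for \<beta> \<beta>'
  proof -
    obtain p q p' q' where d: "(p, q) \<in> D" "\<beta> = type_B n R (p, q)" "(p', q') \<in> D" "\<beta>' = type_B n R (p', q')"
      using b by auto
    have lp: "(p, q) \<in> lpairs n" "(p', q') \<in> lpairs n" using d D by auto
    have m: "(- q, - p) \<in> D" "\<beta> = type_B n R (- q, - p)" "(- q', - p') \<in> D" "\<beta>' = type_B n R (- q', - p')"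
      using Dm d type_B_uminus lp by auto
    have ne4: "(p, q) \<noteq> (p', q')" "(p, q) \<noteq> (- q', - p')" using d m ne by auto
    then have "p \<noteq> p'" "q \<noteq> q'" "p \<noteq> - q'" "q \<noteq> - p'"
      using uni[OF d(1,3)] uni[OF d(1) m(3)] by auto
    then show ?thesis
      using down_endpoints_type_B[OF lp(1), of _ R] down_endpoints_type_B[OF lp(2), of _ R]
        up_endpoints_type_B[OF lp(1), of _ R] up_endpoints_type_B[OF lp(2), of _ R]
      unfolding d(2,4) by auto
  qed
  show ?thesis
    unfolding noncrossing_diagram_B_def
  proof (rule conjI)
    show "\<exists>c. (\<forall>\<alpha>\<in>type_B n R ` D. represents_arc_B n (c \<alpha>) \<alpha>) \<and>
        (\<forall>\<alpha>\<in>type_B n R ` D. \<forall>\<beta>\<in>type_B n R ` D. \<alpha> \<noteq> \<beta> \<longrightarrow>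
          c \<alpha> \<inter> c \<beta> \<subseteq> (\<lambda>i. Upper (0, real_of_int i)) ` {1..int n})"
      by (rule exI[of _ cB]) (intro conjI ballI impI rep disj)
  qed (intro ballI impI ends)
qed

end

section \<open>Drawing a signed permutation\<close>

text \<open>Place the label \<open>i\<close> at its position in \<open>\<pi>\<close>, draw every descent as a straight segment, and then
  shift each horizontal line so that all labels return to the vertical axis.\<close>

definition position :: "nat \<Rightarrow> (int \<Rightarrow> int) \<Rightarrow> real \<Rightarrow> real" where
  "position n \<pi> y = (\<Sum>k \<in> labels n. real_of_int (inv \<pi> k) * max 0 (1 - \<bar>y - real_of_int k\<bar>))"

definition segment :: "(int \<Rightarrow> int) \<Rightarrow> int \<Rightarrow> int \<Rightarrow> real \<Rightarrow> real" where
  "segment \<pi> p q y = inv \<pi> q + (q - y) / (q - p) * (inv \<pi> p - inv \<pi> q)"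

text \<open>\<open>position\<close> interpolates by tent functions of radius one around the labels,
  so at a label only its own term remains.\<close>

lemma position_label:
  assumes "j \<in> labels n"
  shows "position n \<pi> (real_of_int j) = inv \<pi> j"
proof -
  have "max 0 (1 - \<bar>real_of_int j - real_of_int k\<bar>) = (if j = k then 1 else 0)" for k
  proof (cases "j = k")
    case False
    then have "1 \<le> \<bar>j - k\<bar>" by linarith
    then have "1 \<le> \<bar>real_of_int j - real_of_int k\<bar>" by linarith
    then show ?thesis using False by simp
  qed simp
  then have "position n \<pi> (real_of_int j) = (\<Sum>k \<in> labels n. if j = k then real_of_int (inv \<pi> k) else 0)"
    unfolding position_def by (intro sum.cong) auto
  then show ?thesis using assms by (simp add: sum.delta)
qed

lemma position_uminus:
  assumes "\<pi> \<in> signed_perms n"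
  shows "position n \<pi> (- y) = - position n \<pi> y"
proof -
  have "position n \<pi> (- y) = (\<Sum>k \<in> labels n. real_of_int (inv \<pi> (- k)) * max 0 (1 - \<bar>- y - real_of_int (- k)\<bar>))"
    unfolding position_def
    by (rule sum.reindex_bij_witness[of _ uminus uminus]) auto
  also have "\<dots> = (\<Sum>k \<in> labels n. - (real_of_int (inv \<pi> k) * max 0 (1 - \<bar>y - real_of_int k\<bar>)))"
    by (intro sum.cong refl) (simp add: signed_permsD(4)[OF assms] abs_minus_commute)
  finally show ?thesis by (simp add: position_def sum_negf)
qed

lemma continuous_position: "continuous_on S (position n \<pi>)"
  unfolding position_def by (intro continuous_intros)

lemma segment_bounds:
  assumes "p < q" "inv \<pi> q < inv \<pi> p" "real_of_int p \<le> y" "y \<le> real_of_int q"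
  shows "inv \<pi> q \<le> segment \<pi> p q y" "segment \<pi> p q y \<le> inv \<pi> p"
    "y < q \<Longrightarrow> inv \<pi> q < segment \<pi> p q y" "p < y \<Longrightarrow> segment \<pi> p q y < inv \<pi> p"
proof -
  define t where "t = (q - y) / (q - p)"
  define d where "d = real_of_int (inv \<pi> p) - real_of_int (inv \<pi> q)"
  have d: "0 < d" and t: "0 \<le> t" "t \<le> 1" "y < q \<Longrightarrow> 0 < t" "p < y \<Longrightarrow> t < 1"
    using assms by (auto simp: divide_simps t_def d_def)
  have s: "segment \<pi> p q y = inv \<pi> q + t * d" by (simp add: segment_def t_def d_def)
  have "0 \<le> t * d" "y < q \<Longrightarrow> 0 < t * d" using d t by simp_all
  then show "inv \<pi> q \<le> segment \<pi> p q y" "y < q \<Longrightarrow> inv \<pi> q < segment \<pi> p q y"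
    unfolding s by auto
  have "t * d \<le> d" "p < y \<Longrightarrow> t * d < d"
    using d t by (simp_all add: mult_left_le_one_le mult_less_cancel_right1)
  then show "segment \<pi> p q y \<le> inv \<pi> p" "p < y \<Longrightarrow> segment \<pi> p q y < inv \<pi> p"
    unfolding s by (auto simp: d_def)
qed

lemma segment_ends: "p \<noteq> q \<Longrightarrow> segment \<pi> p q p = inv \<pi> p" "segment \<pi> p q q = inv \<pi> q"
  by (simp_all add: segment_def)

lemma segment_uminus:
  assumes "\<pi> \<in> signed_perms n" "p \<noteq> q"
  shows "segment \<pi> (- q) (- p) (- y) = - segment \<pi> p q y"
  using assms(2) by (simp add: segment_def signed_permsD(4)[OF assms(1)] field_simps)

lemma desc_pairs_adj:
  assumes "\<pi> \<in> signed_perms n" "(p, q) \<in> desc_pairs n \<pi>"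
  shows "adj n (inv \<pi> q) (inv \<pi> p)" "p < q" "p \<in> labels n" "q \<in> labels n"
  using assms(2) signed_permsD[OF assms(1)] by (auto simp: desc_pairs_iff adj_def)

lemma desc_pairs_unique:
  assumes "\<pi> \<in> signed_perms n" "(p, q) \<in> desc_pairs n \<pi>" "(p', q') \<in> desc_pairs n \<pi>"
  shows "p = p' \<longleftrightarrow> q = q'"
proof -
  have "adj n (inv \<pi> q) (inv \<pi> p)" "adj n (inv \<pi> q') (inv \<pi> p')" using desc_pairs_adj assms by auto
  then have "inv \<pi> p = inv \<pi> p' \<longleftrightarrow> inv \<pi> q = inv \<pi> q'" by (auto simp: adj_iff labels_iff)
  then show ?thesis using signed_permsD(10)[OF assms(1)] by simp
qed

text \<open>At the height of an inner label the segment runs strictly between the positions of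
  \<open>q\<close> and \<open>p\<close>, while the label is positioned outside, on the side
  prescribed by \<open>R\<close> because the projection fixes the inversion set.\<close>

lemma segment_std_curve:
  assumes \<pi>: "\<pi> \<in> signed_perms n" and camb: "camb n R (invs n \<pi>) = invs n \<pi>"
    and pq: "(p, q) \<in> desc_pairs n \<pi>"
  shows "std_curve n R (\<lambda>y. segment \<pi> p q y - position n \<pi> y) p q"
proof (rule std_curveI)
  note adj = desc_pairs_adj[OF \<pi> pq] and sp = signed_permsD[OF \<pi>]
  have uv: "inv \<pi> q < inv \<pi> p" using adj(1) by (simp add: adj_def)
  show "p \<in> labels n" "q \<in> labels n" "p < q" using adj by auto
  show "continuous_on {real_of_int p..real_of_int q} (\<lambda>y. segment \<pi> p q y - position n \<pi> y)"
    unfolding segment_def by (intro continuous_on_diff continuous_position continuous_intros) (use adj in auto)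
  show "segment \<pi> p q (real_of_int p) - position n \<pi> (real_of_int p) = 0"
    "segment \<pi> p q (real_of_int q) - position n \<pi> (real_of_int q) = 0"
    using adj by (simp_all add: position_label segment_ends)
  fix i assume i: "i \<in> labels n" "p < i" "i < q"
  have nb: "\<not> (inv \<pi> q < inv \<pi> i \<and> inv \<pi> i < inv \<pi> p)" using adj(1) i(1) sp(8) by (auto simp: adj_def)
  have "if R i then (i, q) \<in> invs n \<pi> else (p, i) \<in> invs n \<pi>"
    using camb camb_eq_iff[OF invs_sub, of n R \<pi>] desc_pairs_invs[OF \<pi> pq] i by blast
  then have side: "if R i then inv \<pi> p \<le> inv \<pi> i else inv \<pi> i \<le> inv \<pi> q"
    using nb by (auto simp: invs_iff split: if_splits)
  have "inv \<pi> q < segment \<pi> p q i" "segment \<pi> p q i < inv \<pi> p"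
    using segment_bounds(3,4)[OF adj(2) uv, of i] i by auto
  then show "if R i then segment \<pi> p q (real_of_int i) - position n \<pi> (real_of_int i) < 0
      else 0 < segment \<pi> p q (real_of_int i) - position n \<pi> (real_of_int i)"
    using side by (simp add: position_label[OF i(1)] split: if_splits)
qed

lemma drawing_exists:
  assumes \<pi>: "\<pi> \<in> signed_perms n" and camb: "camb n R (invs n \<pi>) = invs n \<pi>"
  shows "\<exists>c. symmetric_drawing n (std_arc n R ` desc_pairs n \<pi>) c"
proof -
  define F where "F p q y = segment \<pi> p q y - position n \<pi> y" for p q y
  define c where "c \<alpha> = (case \<alpha> of Arc p q L R' \<Rightarrow> curve (F p q) p q)" for \<alpha>
  have c: "c (std_arc n R (p, q)) = curve (F p q) p q" for p q by (simp add: c_def std_arc_eq)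
  have rep: "represents_arc n (c (std_arc n R (p, q))) (std_arc n R (p, q))" if "(p, q) \<in> desc_pairs n \<pi>" for p q
    unfolding represents_std_arc c using segment_std_curve[OF \<pi> camb that] unfolding F_def[abs_def] by blast
  \<comment> \<open>Each segment fills a strip between two consecutive positions. Distinct strips
    share at most a boundary line, which a segment reaches only at an endpoint.\<close>
  have half: "u \<in> label_points n"
    if d: "(p, q) \<in> desc_pairs n \<pi>" "(p', q') \<in> desc_pairs n \<pi>" and le: "inv \<pi> p \<le> inv \<pi> q'"
      and u: "u \<in> curve (F p q) p q" "u \<in> curve (F p' q') p' q'" for p q p' q' u
  proof -
    obtain x y where xy: "u = (x, y)" by (cases u)
    note a = desc_pairs_adj[OF \<pi> d(1)] and a' = desc_pairs_adj[OF \<pi> d(2)]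
    have lt: "inv \<pi> q < inv \<pi> p" "inv \<pi> q' < inv \<pi> p'" using a a' by (auto simp: adj_def)
    have y: "real_of_int p \<le> y" "y \<le> real_of_int q" "real_of_int p' \<le> y" "y \<le> real_of_int q'"
      and x: "x = F p q y" "x = F p' q' y" using u by (auto simp: xy mem_curve)
    have "segment \<pi> p q y = segment \<pi> p' q' y" using x by (simp add: F_def)
    moreover have "real_of_int (inv \<pi> p) \<le> real_of_int (inv \<pi> q')" using le by simp
    ultimately have "\<not> segment \<pi> p q y < inv \<pi> p"
      using segment_bounds(1)[OF a'(2) lt(2) y(3,4)] by linarith
    then have "y = p" using segment_bounds(4)[OF a(2) lt(1) y(1,2)] y by linarith
    then have "x = 0" using x(1) a by (simp add: F_def segment_ends position_label)
    then show ?thesis using \<open>y = p\<close> a by (auto simp: xy label_points_def)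
  qed
  have disj: "c (std_arc n R (p, q)) \<inter> c (std_arc n R (p', q')) \<subseteq> label_points n"
    if d: "(p, q) \<in> desc_pairs n \<pi>" "(p', q') \<in> desc_pairs n \<pi>" and ne: "(p, q) \<noteq> (p', q')" for p q p' q'
  proof -
    have a: "adj n (inv \<pi> q) (inv \<pi> p)" "adj n (inv \<pi> q') (inv \<pi> p')" using desc_pairs_adj[OF \<pi>] d by auto
    have "q \<noteq> q'" using desc_pairs_unique[OF \<pi> d] ne by auto
    then have "inv \<pi> q \<noteq> inv \<pi> q'" using signed_permsD(10)[OF \<pi>] by simp
    then have "inv \<pi> p \<le> inv \<pi> q' \<or> inv \<pi> p' \<le> inv \<pi> q" using a unfolding adj_def by (meson linorder_neqE not_less)
    then show ?thesis unfolding c using half d by blast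
  qed
  have sym: "uminus ` c (std_arc n R (p, q)) \<in> c ` std_arc n R ` desc_pairs n \<pi>" if d: "(p, q) \<in> desc_pairs n \<pi>" for p q
  proof -
    have "p \<noteq> q" using desc_pairs_adj(2)[OF \<pi> d] by simp
    then have "- F p q (- y) = F (- q) (- p) y" for y
      using segment_uminus[OF \<pi>, of p q "- y"] position_uminus[OF \<pi>, of y] by (simp add: F_def)
    then have "uminus ` c (std_arc n R (p, q)) = c (std_arc n R (- q, - p))"
      unfolding c uminus_curve by simp
    then show ?thesis using desc_pairs_uminus[OF \<pi> d] by blast
  qed
  have "symmetric_drawing n (std_arc n R ` desc_pairs n \<pi>) c"
    unfolding symmetric_drawing_def label_points_def[symmetric]
  proof (intro conjI ballI impI)
    fix \<alpha> assume "\<alpha> \<in> std_arc n R ` desc_pairs n \<pi>"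
    then show "represents_arc n (c \<alpha>) \<alpha>" "uminus ` c \<alpha> \<in> c ` std_arc n R ` desc_pairs n \<pi>"
      using rep sym by auto
    fix \<beta> assume "\<beta> \<in> std_arc n R ` desc_pairs n \<pi>" "\<alpha> \<noteq> \<beta>"
    then show "c \<alpha> \<inter> c \<beta> \<subseteq> label_points n"
      using \<open>\<alpha> \<in> std_arc n R ` desc_pairs n \<pi>\<close> disj by (elim imageE) (metis surj_pair)
  qed
  then show ?thesis by blast
qed

text \<open>All drawings give the same types by \<open>drawing_projects\<close> and
  \<open>represents_arc_B_unique\<close>; \<open>drawing_exists\<close> is needed because
  \<open>delta_orb\<close> would be empty without a drawing.\<close>

lemma delta_orb_eq:
  assumes \<pi>: "\<pi> \<in> signed_perms n" and camb: "camb n R (invs n \<pi>) = invs n \<pi>"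
    and R: "\<And>v. v \<in> labels n \<Longrightarrow> R (- v) \<longleftrightarrow> \<not> R v"
  shows "delta_orb n \<pi> = type_B n R ` desc_pairs n \<pi>"
proof -
  have D: "desc_pairs n \<pi> \<subseteq> lpairs n" using desc_pairs_invs[OF \<pi>] invs_sub by fast
  have rep: "represents_arc_B n (orb_proj ` c (std_arc n R d)) (type_B n R d)"
    if "symmetric_drawing n (std_arc n R ` desc_pairs n \<pi>) c" "d \<in> desc_pairs n \<pi>" for c d
    using drawing_projects[OF R D that(1), of "fst d" "snd d"] that(2) by simp
  obtain c where "symmetric_drawing n (std_arc n R ` desc_pairs n \<pi>) c" using drawing_exists[OF \<pi> camb] by blast
  then show ?thesis
    unfolding delta_orb_def delta_eq_std_arcs[OF \<pi> camb]
    using rep represents_arc_B_unique by (auto simp del: orb_proj.simps) blast+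
qed

section \<open>Lifting diagrams to the symmetric model\<close>

text \<open>A preimage of an arc through the axis: \<open>g\<close> from height zero on, the
  half-turn of \<open>f\<close> below. A long arc has the preimages \<open>glue g f\<close> and
  \<open>glue f g\<close>, an orbifold arc has \<open>glue f f\<close>.\<close>

definition glue :: "(real \<Rightarrow> real) \<Rightarrow> (real \<Rightarrow> real) \<Rightarrow> real \<Rightarrow> real" where
  "glue g f y = (if 0 \<le> y then g y else - f (- y))"

lemma continuous_glue:
  assumes g: "continuous_on {0..q} g" and f: "continuous_on {0..p} f" and "g 0 = - f 0" "0 \<le> p" "0 \<le> q"
  shows "continuous_on {- p..q} (glue g f)"
proof -
  have "continuous_on {- p..0} (\<lambda>y. - f (- y))"
    by (intro continuous_on_minus continuous_on_compose2[OF f, of _ uminus]) (auto intro: continuous_intros)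
  then have "continuous_on ({0..q} \<union> {- p..0}) (\<lambda>y. if 0 \<le> y then g y else - f (- y))"
    using assms by (intro continuous_on_cases) auto
  moreover have "{- p..q} = {0..q} \<union> {- p..0}" using assms by auto
  ultimately show ?thesis by (simp add: glue_def[abs_def])
qed

lemma glue_std_curve:
  assumes R: "\<And>v. v \<in> labels n \<Longrightarrow> R (- v) \<longleftrightarrow> \<not> R v"
    and pq: "1 \<le> p" "p \<le> int n" "1 \<le> q" "q \<le> int n"
    and f: "continuous_on {0..real_of_int p} f" "f p = 0"
      "\<And>i. i \<in> labels n \<Longrightarrow> 0 < i \<Longrightarrow> i < p \<Longrightarrow> if R i then f i < 0 else 0 < f i"
    and g: "continuous_on {0..real_of_int q} g" "g q = 0"
      "\<And>i. i \<in> labels n \<Longrightarrow> 0 < i \<Longrightarrow> i < q \<Longrightarrow> if R i then g i < 0 else 0 < g i"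
    and "g 0 = - f 0"
  shows "std_curve n R (glue g f) (- p) q"
proof (rule std_curveI)
  show "continuous_on {real_of_int (- p)..real_of_int q} (glue g f)"
    using continuous_glue[OF g(1) f(1)] assms by simp
  fix i assume i: "i \<in> labels n" "- p < i" "i < q"
  show "if R i then glue g f (real_of_int i) < 0 else 0 < glue g f (real_of_int i)"
  proof (cases "0 < i")
    case True
    then show ?thesis using g(3) i by (simp add: glue_def)
  next
    case False
    then have "i < 0" using i by (auto simp: labels_iff)
    then show ?thesis using f(3)[of "- i"] R[OF i(1)] i by (auto simp: glue_def)
  qed
qed (use assms in \<open>auto simp: labels_iff glue_def\<close>)

lemma proj_glue: "orb_proj ` curve (glue g f) (- p) q \<subseteq> orb_proj ` (curve f 0 p \<union> curve g 0 q)"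
proof
  fix P assume "P \<in> orb_proj ` curve (glue g f) (- p) q"
  then obtain x y where xy: "(x, y) \<in> curve (glue g f) (- p) q" "P = orb_proj (x, y)" by (metis imageE surj_pair)
  show "P \<in> orb_proj ` (curve f 0 p \<union> curve g 0 q)"
  proof (cases "0 \<le> y")
    case True
    then have "(x, y) \<in> curve g 0 q" using xy by (auto simp: mem_curve glue_def)
    then show ?thesis using xy by blast
  next
    case False
    then have "- (x, y) \<in> curve f 0 p" using xy by (auto simp: mem_curve glue_def)
    moreover have "P = orb_proj (- (x, y))" using xy orb_proj_uminus by metis
    ultimately show ?thesis by blast
  qed
qed

lemma glue_disjoint:
  assumes "curve f 0 p \<inter> curve g 0 q = {}"
  shows "curve (glue g f) (- p) q \<inter> curve (glue f g) (- q) p = {}"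
proof -
  have ne: "f y \<noteq> g y" if "0 \<le> y" "y \<le> real_of_int p" "y \<le> real_of_int q" for y
  proof
    assume "f y = g y"
    then have "(f y, y) \<in> curve f 0 p \<inter> curve g 0 q" using that by (auto simp: mem_curve)
    then show False using assms by blast
  qed
  show ?thesis
  proof (rule ccontr)
    assume "\<not> ?thesis"
    then obtain x y where "(x, y) \<in> curve (glue g f) (- p) q" "(x, y) \<in> curve (glue f g) (- q) p" by auto
    then show False using ne[of y] ne[of "- y"] by (auto simp: mem_curve glue_def split: if_splits)
  qed
qed

section \<open>Lifting allowed arcs and diagrams\<close>

definition allowed :: "int set \<Rightarrow> int set \<Rightarrow> arc_B \<Rightarrow> bool" where
  "allowed Lpts Rpts \<alpha> \<longleftrightarrow> (\<forall>i \<in> Lpts. \<not> passes_left_of \<alpha> i) \<and> (\<forall>i \<in> Rpts. \<not> passes_right_of \<alpha> i)"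

text \<open>The inclusion into \<open>C\<close> transfers noncrossing of different arcs to their
  preimages. The disjointness clause concerns two preimages of one arc, on which the noncrossing
  condition of a diagram is silent.\<close>

definition lifting :: "nat \<Rightarrow> (int \<Rightarrow> bool) \<Rightarrow> orb_point set \<Rightarrow> arc_B \<Rightarrow> (int \<times> int \<Rightarrow> real \<Rightarrow> real) \<Rightarrow> bool" where
  "lifting n R C \<beta> F \<longleftrightarrow> (\<forall>a b. (a, b) \<in> lifts \<beta> \<longrightarrow>
     std_curve n R (F (a, b)) a b \<and> orb_proj ` curve (F (a, b)) a b \<subseteq> C \<and> type_B n R (a, b) = \<beta>) \<and>
     (\<forall>a b a' b'. (a, b) \<in> lifts \<beta> \<longrightarrow> (a', b') \<in> lifts \<beta> \<longrightarrow> (a, b) \<noteq> (a', b') \<longrightarrow>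
        curve (F (a, b)) a b \<inter> curve (F (a', b')) a' b' = {})"

context designation
begin

lemma designated_pos: "i \<in> labels n \<Longrightarrow> 0 < i \<Longrightarrow> i < int n \<Longrightarrow> i \<in> Rpts \<longleftrightarrow> rt Rpts i"
  "i \<in> labels n \<Longrightarrow> 0 < i \<Longrightarrow> i < int n \<Longrightarrow> i \<in> Lpts \<longleftrightarrow> \<not> rt Rpts i"
  using designated[of i] by (auto simp: rt_def)

text \<open>The designation leaves each inner label one admissible side, so the preimages have the
  sides given by \<open>rt Rpts\<close>, and their endpoints determine the type.\<close>

lemma allowed_lifting:
  assumes rep: "represents_arc_B n C \<beta>" and al: "allowed Lpts Rpts \<beta>"
  shows "\<exists>F. lifting n (rt Rpts) C \<beta> F"
proof (cases \<beta>)
  case (Ordinary p q L R)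
  obtain f where f: "1 \<le> p" "p < q" "q \<le> int n" "admissible n f p q" "f p = 0" "f q = 0"
    "L = points_left_of n f p q" "R = points_right_of n f p q" "C = orb_proj ` curve f p q"
    using rep unfolding Ordinary by auto
  have std: "std_curve n (rt Rpts) f p q"
  proof (rule std_curveI)
    fix i assume i: "i \<in> labels n" "p < i" "i < q"
    then have "f i \<noteq> 0" "i \<in> L \<longleftrightarrow> 0 < f i" "i \<in> R \<longleftrightarrow> f i < 0"
      using f by (auto simp: admissible_def inner_points_def points_left_of_def points_right_of_def)
    moreover have "i \<in> Rpts \<Longrightarrow> i \<notin> L" "i \<in> Lpts \<Longrightarrow> i \<notin> R"
      using al by (auto simp: allowed_def Ordinary)
    ultimately show "if rt Rpts i then f (real_of_int i) < 0 else 0 < f (real_of_int i)"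
      using designated_pos[of i] i f by auto
  qed (use f in \<open>auto simp: labels_iff admissible_def\<close>)
  define F where "F d = (if 0 < fst d then f else (\<lambda>y. - f (- y)))" for d :: "int \<times> int"
  have F: "F (p, q) = f" "F (- q, - p) = (\<lambda>y. - f (- y))" using f by (simp_all add: F_def)
  have lp: "(p, q) \<in> lpairs n" using std by (simp add: std_curve_def lpairs_iff)
  have ty: "type_B n (rt Rpts) (p, q) = \<beta>" "type_B n (rt Rpts) (- q, - p) = \<beta>"
    unfolding type_B_uminus[OF lp]
    using f std_curve_sides[OF std] by (simp_all add: type_B_def Ordinary)
  have std': "std_curve n (rt Rpts) (\<lambda>y. - f (- y)) (- q) (- p)"
    by (rule std_curve_uminus[where R = "rt Rpts", OF std rt_labels])
  have pr: "orb_proj ` curve (\<lambda>y. - f (- y)) (- q) (- p) \<subseteq> C"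
    unfolding uminus_curve[symmetric] orb_proj_image_uminus f(9) by simp
  have dj: "curve f p q \<inter> curve (\<lambda>y. - f (- y)) (- q) (- p) = {}"
    using f by (auto simp: mem_curve)
  have "lifting n (rt Rpts) C \<beta> F"
    unfolding lifting_def using std std' ty pr dj f(9) F by (auto simp: Ordinary)
  then show ?thesis by blast
next
  case (Orbifold p L R)
  obtain f where f: "1 \<le> p" "p \<le> int n" "admissible n f 0 p" "f 0 = 0" "f p = 0"
    "L = points_left_of n f 0 p" "R = points_right_of n f 0 p" "C = orb_proj ` curve f 0 p"
    using rep unfolding Orbifold by auto
  have side: "if rt Rpts i then f i < 0 else 0 < f i" if i: "i \<in> labels n" "0 < i" "i < p" for i
  proof -
    have "f i \<noteq> 0" "i \<in> L \<longleftrightarrow> 0 < f i" "i \<in> R \<longleftrightarrow> f i < 0"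
      using f i by (auto simp: admissible_def inner_points_def points_left_of_def points_right_of_def)
    moreover have "i \<in> Rpts \<Longrightarrow> i \<notin> L" "i \<in> Lpts \<Longrightarrow> i \<notin> R"
      using al by (auto simp: allowed_def Orbifold)
    ultimately show ?thesis using designated_pos[of i] i f by auto
  qed
  have std: "std_curve n (rt Rpts) (glue f f) (- p) p"
    by (rule glue_std_curve[where R = "rt Rpts", OF rt_labels]) (use f side in \<open>auto simp: admissible_def\<close>)
  have "points_left_of n f 0 p = points_left_of n (glue f f) 0 p"
    "points_right_of n f 0 p = points_right_of n (glue f f) 0 p"
    by (rule points_cong; simp add: glue_def)+
  then have ty: "type_B n (rt Rpts) (- p, p) = \<beta>"
    using f upper_part_sides[OF std] by (simp add: type_B_def Orbifold)
  have "lifting n (rt Rpts) C \<beta> (\<lambda>_. glue f f)"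
    unfolding lifting_def using std ty proj_glue[of f f p p] f(8) by (auto simp: Orbifold)
  then show ?thesis by blast
next
  case (Long p q L R)
  obtain f g r where pieces: "long_pieces C p q f g"
    and L: "L = points_left_of n f 0 p" and R: "R = points_right_of n g 0 q"
    and fg: "admissible n f 0 p" "admissible n g 0 q" "f 0 = - r" "g 0 = r"
    and dj: "curve f 0 p \<inter> curve g 0 q = {}" and C: "C = orb_proj ` (curve f 0 p \<union> curve g 0 q)"
    by (rule represents_long_pieces[OF rep[unfolded Long]])
  have pq: "1 \<le> p" "p \<le> int n" "1 \<le> q" "q \<le> int n" "p \<noteq> q" using rep unfolding Long by auto
  have z: "f p = 0" "g q = 0" using pieces by (auto simp: long_pieces_def)
  have al': "i \<in> Lpts \<Longrightarrow> i \<notin> R \<and> (i < p \<longrightarrow> i \<in> L)" "i \<in> Rpts \<Longrightarrow> i \<notin> L \<and> (i < q \<longrightarrow> i \<in> R)" for i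
    using al by (auto simp: allowed_def Long)
  have sf: "if rt Rpts i then f i < 0 else 0 < f i" if i: "i \<in> labels n" "0 < i" "i < p" for i
  proof -
    have "f i \<noteq> 0" "i \<in> L \<longleftrightarrow> 0 < f i"
      using fg i unfolding L by (auto simp: admissible_def inner_points_def points_left_of_def)
    then show ?thesis using designated_pos[of i] al'[of i] i pq by auto
  qed
  have sg: "if rt Rpts i then g i < 0 else 0 < g i" if i: "i \<in> labels n" "0 < i" "i < q" for i
  proof -
    have "g i \<noteq> 0" "i \<in> R \<longleftrightarrow> g i < 0"
      using fg i unfolding R by (auto simp: admissible_def inner_points_def points_right_of_def)
    then show ?thesis using designated_pos[of i] al'[of i] i pq by auto
  qed
  have cont: "continuous_on {0..real_of_int p} f" "continuous_on {0..real_of_int q} g"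
    using fg by (auto simp: admissible_def)
  have std1: "std_curve n (rt Rpts) (glue g f) (- p) q"
    by (rule glue_std_curve[where R = "rt Rpts", OF rt_labels]) (use fg z sf sg pq cont in auto)
  have std2: "std_curve n (rt Rpts) (glue f g) (- q) p"
    by (rule glue_std_curve[where R = "rt Rpts", OF rt_labels]) (use fg z sf sg pq cont in auto)
  have Ls: "L = lft n (rt Rpts) 0 p"
  proof -
    have "points_left_of n f 0 p = points_left_of n (glue f g) 0 p" by (rule points_cong) (simp add: glue_def)
    then show ?thesis unfolding L using upper_part_sides(2)[OF std2] pq by simp
  qed
  have Rs: "R = rgt n (rt Rpts) 0 q"
  proof -
    have "points_right_of n g 0 q = points_right_of n (glue g f) 0 q" by (rule points_cong) (simp add: glue_def)
    then show ?thesis unfolding R using upper_part_sides(3)[OF std1] pq by simp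
  qed
  \<comment> \<open>At height \<open>min p q\<close> the shorter piece is on the axis, and the
    longer one passes that label on its prescribed side. As \<open>f\<close> runs to the left of
    \<open>g\<close>, this side tells which piece is shorter, in agreement with the case distinction
    in \<open>type_B\<close>.\<close>
  have order: "if rt Rpts (min p q) then q < p else p < q"
  proof (cases "p < q")
    case True
    then have "f p < g p" using long_pieces_less[OF pieces, of p] pq by simp
    then show ?thesis using True z sg[of p] pq by (auto simp: labels_iff split: if_splits)
  next
    case False
    then have "f q < g q" using long_pieces_less[OF pieces, of q] pq by simp
    then show ?thesis using False z sf[of q] pq by (auto simp: labels_iff min_def split: if_splits)
  qed
  have lp: "(- p, q) \<in> lpairs n" using std1 by (simp add: std_curve_def lpairs_iff)
  have ty: "type_B n (rt Rpts) (- p, q) = \<beta>"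
    using order pq by (auto simp: type_B_def Long Ls Rs Let_def min_def max_def split: if_splits)
  then have ty': "type_B n (rt Rpts) (- q, p) = \<beta>" using type_B_uminus[OF lp] by simp
  define F where "F d = (if d = (- p, q) then glue g f else glue f g)" for d :: "int \<times> int"
  have F: "F (- p, q) = glue g f" "F (- q, p) = glue f g" using pq by (auto simp: F_def)
  have pr: "orb_proj ` curve (glue g f) (- p) q \<subseteq> C" "orb_proj ` curve (glue f g) (- q) p \<subseteq> C"
    using proj_glue[of g f p q] proj_glue[of f g q p] unfolding C by (auto simp: Un_commute simp del: orb_proj.simps)
  have "lifting n (rt Rpts) C \<beta> F"
    unfolding lifting_def
  proof (intro conjI allI impI)
    fix a b assume "(a, b) \<in> lifts \<beta>"
    then have ab: "(a, b) = (- p, q) \<or> (a, b) = (- q, p)" by (simp add: Long)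
    then show "std_curve n (rt Rpts) (F (a, b)) a b" "orb_proj ` curve (F (a, b)) a b \<subseteq> C"
      "type_B n (rt Rpts) (a, b) = \<beta>"
      using std1 std2 ty ty' pr F by (metis prod.inject)+
    fix a' b' assume "(a', b') \<in> lifts \<beta>" "(a, b) \<noteq> (a', b')"
    then have "(a, b) = (- p, q) \<and> (a', b') = (- q, p) \<or> (a, b) = (- q, p) \<and> (a', b') = (- p, q)"
      using ab by (auto simp: Long)
    then show "curve (F (a, b)) a b \<inter> curve (F (a', b')) a' b' = {}"
      using glue_disjoint[OF dj] F by (metis Int_commute prod.inject)
  qed
  then show ?thesis by blast
qed

lemma allowed_type_B:
  assumes "(a, b) \<in> lpairs n"
  shows "allowed Lpts Rpts (type_B n (rt Rpts) (a, b))"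
proof -
  have LR': "i \<in> labels n \<and> 0 < i \<and> \<not> rt Rpts i" if "i \<in> Lpts" for i
  proof -
    have "i \<in> {1..int n - 1}" using that LR by blast
    then show ?thesis using rt_pos(2)[OF that] by (auto simp: labels_iff)
  qed
  have RR': "i \<in> labels n \<and> 0 < i \<and> rt Rpts i" if "i \<in> Rpts" for i
  proof -
    have "i \<in> {1..int n - 1}" using that LR by blast
    then show ?thesis using rt_pos(1)[OF that] by (auto simp: labels_iff)
  qed
  have "\<not> passes_left_of (type_B n (rt Rpts) (a, b)) i" if "i \<in> Lpts" for i
    using LR'[OF that] assms by (auto simp: type_B_def lft_def rgt_def Let_def lpairs_iff)
  moreover have "\<not> passes_right_of (type_B n (rt Rpts) (a, b)) i" if "i \<in> Rpts" for i
    using RR'[OF that] assms by (auto simp: type_B_def lft_def rgt_def Let_def lpairs_iff)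
  ultimately show ?thesis by (simp add: allowed_def)
qed

lemma lifts_uminus: "(a, b) \<in> lifts \<beta> \<Longrightarrow> (- b, - a) \<in> lifts \<beta>"
  by (cases \<beta>) auto

text \<open>A common point of preimages of different arcs projects to a common point of the arcs,
  hence lies over a numbered point. So lifted curves meet only at labels, and
  \<open>std_curves_noncrossing\<close> yields compatibility.\<close>

lemma diagram_lifts:
  assumes D: "noncrossing_diagram_B n D" and al: "\<And>\<beta>. \<beta> \<in> D \<Longrightarrow> allowed Lpts Rpts \<beta>"
  shows "compatible n (rt Rpts) (\<Union> (lifts ` D))" "type_B n (rt Rpts) ` (\<Union> (lifts ` D)) = D"
proof -
  let ?R = "rt Rpts"
  obtain c where c: "\<forall>\<alpha> \<in> D. represents_arc_B n (c \<alpha>) \<alpha>"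
    "\<forall>\<alpha> \<in> D. \<forall>\<beta> \<in> D. \<alpha> \<noteq> \<beta> \<longrightarrow> c \<alpha> \<inter> c \<beta> \<subseteq> (\<lambda>i. Upper (0, real_of_int i)) ` {1..int n}"
    using D unfolding noncrossing_diagram_B_def by (elim conjE exE) (rule that)
  then have rep: "\<And>\<beta>. \<beta> \<in> D \<Longrightarrow> represents_arc_B n (c \<beta>) \<beta>"
    and disj: "\<And>\<alpha> \<beta>. \<alpha> \<in> D \<Longrightarrow> \<beta> \<in> D \<Longrightarrow> \<alpha> \<noteq> \<beta> \<Longrightarrow> c \<alpha> \<inter> c \<beta> \<subseteq> (\<lambda>i. Upper (0, real_of_int i)) ` {1..int n}"
    by simp_all
  have ends: "\<And>\<alpha> \<beta>. \<alpha> \<in> D \<Longrightarrow> \<beta> \<in> D \<Longrightarrow> \<alpha> \<noteq> \<beta> \<Longrightarrow>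
      down_endpoints \<alpha> \<inter> down_endpoints \<beta> = {} \<and> up_endpoints \<alpha> \<inter> up_endpoints \<beta> = {}"
    using D by (simp add: noncrossing_diagram_B_def)
  have "\<exists>F. \<forall>\<beta> \<in> D. lifting n ?R (c \<beta>) \<beta> (F \<beta>)"
    by (rule bchoice) (use allowed_lifting rep al in blast)
  then obtain F where F: "\<And>\<beta>. \<beta> \<in> D \<Longrightarrow> lifting n ?R (c \<beta>) \<beta> (F \<beta>)" by blast
  have std: "std_curve n ?R (F \<beta> (a, b)) a b" and sub: "orb_proj ` curve (F \<beta> (a, b)) a b \<subseteq> c \<beta>"
    and ty: "type_B n ?R (a, b) = \<beta>" if "\<beta> \<in> D" "(a, b) \<in> lifts \<beta>" for \<beta> a b
    using F[OF that(1)] that(2) unfolding lifting_def by blast+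
  have lp: "(a, b) \<in> lpairs n" if "\<beta> \<in> D" "(a, b) \<in> lifts \<beta>" for \<beta> a b
    using std[OF that] by (simp add: std_curve_def lpairs_iff)
  have "lifts \<beta> \<noteq> {}" for \<beta> by (cases \<beta>) auto
  then show "type_B n ?R ` (\<Union> (lifts ` D)) = D" using ty by force
  have I: "curve (F \<beta> (a, b)) a b \<inter> curve (F \<beta>' (a', b')) a' b' \<subseteq> label_points n"
    if h: "\<beta> \<in> D" "(a, b) \<in> lifts \<beta>" "\<beta>' \<in> D" "(a', b') \<in> lifts \<beta>'" "(a, b) \<noteq> (a', b')" for \<beta> \<beta>' a b a' b'
  proof (cases "\<beta> = \<beta>'")
    case True
    then have "curve (F \<beta> (a, b)) a b \<inter> curve (F \<beta>' (a', b')) a' b' = {}"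
      using F[OF h(1)] h unfolding lifting_def by blast
    then show ?thesis by simp
  next
    case False
    show ?thesis
    proof
      fix u assume "u \<in> curve (F \<beta> (a, b)) a b \<inter> curve (F \<beta>' (a', b')) a' b'"
      then have "orb_proj u \<in> c \<beta> \<inter> c \<beta>'" using sub[OF h(1,2)] sub[OF h(3,4)] by blast
      then obtain i where i: "i \<in> {1..int n}" "orb_proj u = Upper (0, real_of_int i)"
        using disj[OF h(1,3) False] by blast
      then have "orb_proj u = orb_proj (0, real_of_int i)" by simp
      then have "u = (0, real_of_int i) \<or> u = (0, real_of_int (- i))"
        unfolding orb_proj_eq_iff by (auto simp: zero_prod_def)
      moreover have "i \<in> labels n" "- i \<in> labels n" using i by (auto simp: labels_iff)
      ultimately show "u \<in> label_points n" unfolding label_points_def by blast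
    qed
  qed
  have uni: "p = p' \<longleftrightarrow> q = q'"
    if h: "\<beta> \<in> D" "(p, q) \<in> lifts \<beta>" "\<beta>' \<in> D" "(p', q') \<in> lifts \<beta>'" for \<beta> \<beta>' p q p' q'
  proof -
    note l = lp[OF h(1,2)] and l' = lp[OF h(3,4)]
    have same: "\<beta> = \<beta>'" if "p = p' \<or> q = q'"
    proof (rule ccontr)
      assume "\<beta> \<noteq> \<beta>'"
      note e = ends[OF h(1,3) this]
      have "p \<noteq> 0" "q \<noteq> 0" using l by (auto simp: lpairs_iff labels_iff)
      moreover have "x \<in> down_endpoints \<beta> \<longleftrightarrow> 0 < x \<and> (x = q \<or> x = - p)"
        "x \<in> down_endpoints \<beta>' \<longleftrightarrow> 0 < x \<and> (x = q' \<or> x = - p')"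
        "x \<in> up_endpoints \<beta> \<longleftrightarrow> 0 < x \<and> (x = p \<or> x = - q)"
        "x \<in> up_endpoints \<beta>' \<longleftrightarrow> 0 < x \<and> (x = p' \<or> x = - q')" for x
        using down_endpoints_type_B[OF l, of x ?R] down_endpoints_type_B[OF l', of x ?R]
          up_endpoints_type_B[OF l, of x ?R] up_endpoints_type_B[OF l', of x ?R]
        unfolding ty[OF h(1,2)] ty[OF h(3,4)] by blast+
      \<comment> \<open>A shared lower endpoint \<open>p\<close> becomes an upward endpoint if it is
        positive and the downward endpoint \<open>-p\<close> if it is negative; for a shared
        \<open>q\<close> it is the other way round.\<close>
      ultimately have "(if p = p' then \<bar>p\<bar> else \<bar>q\<bar>) \<in>
          down_endpoints \<beta> \<inter> down_endpoints \<beta>' \<union> up_endpoints \<beta> \<inter> up_endpoints \<beta>'"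
        using that by (auto simp: abs_if)
      then show False using e by blast
    qed
    have "(p', q') = (p, q) \<or> (p', q') = (- q, - p)" if "\<beta> = \<beta>'"
      using lifts_type_B[OF l, of ?R] h that ty[OF h(1,2)] by auto
    then show ?thesis using same by auto
  qed
  show "compatible n ?R (\<Union> (lifts ` D))"
    unfolding compatible_def
  proof (intro conjI allI impI)
    show "\<Union> (lifts ` D) \<subseteq> lpairs n" using lp by auto
    show "(- q, - p) \<in> \<Union> (lifts ` D)" if "(p, q) \<in> \<Union> (lifts ` D)" for p q
      using that lifts_uminus by blast
    fix p q p' q' assume "(p, q) \<in> \<Union> (lifts ` D)" "(p', q') \<in> \<Union> (lifts ` D)"
    then obtain \<beta> \<beta>' where h: "\<beta> \<in> D" "(p, q) \<in> lifts \<beta>" "\<beta>' \<in> D" "(p', q') \<in> lifts \<beta>'" by blast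
    show "p = p' \<longleftrightarrow> q = q'" by (rule uni[OF h])
    note nc = std_curves_noncrossing[OF std[OF h(1,2)] std[OF h(3,4)] I[OF h]]
    show "?R p' = ?R q'" if "p < p'" "p' < q'" "q' < q" using nc(1) that by auto
    show "?R p' \<noteq> ?R q" if "p < p'" "p' < q" "q < q'" using nc(2) that by auto
  qed
qed

section \<open>Assembling the bijection\<close>

theorem delta_orb_bij:
  "bij_betw (delta_orb n)
     {\<pi> \<in> signed_perms n. \<not> contracts (weak_order_B n) (cambrian_congruence n Lpts Rpts) \<pi>}
     {D. noncrossing_diagram_B n D \<and> (\<forall>\<alpha> \<in> D. allowed Lpts Rpts \<alpha>)}"
proof -
  let ?R = "rt Rpts"
  define A where "A = {\<pi> \<in> signed_perms n. camb n ?R (invs n \<pi>) = invs n \<pi>}"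
  have A: "{\<pi> \<in> signed_perms n. \<not> contracts (weak_order_B n) (cambrian_congruence n Lpts Rpts) \<pi>} = A"
    using uncontracted_iff by (auto simp: A_def)
  have orb: "delta_orb n \<pi> = type_B n ?R ` desc_pairs n \<pi>" if "\<pi> \<in> A" for \<pi>
    using that delta_orb_eq[where R = ?R, OF _ _ rt_labels] by (simp add: A_def)
  have lp: "desc_pairs n \<pi> \<subseteq> lpairs n" if "\<pi> \<in> A" for \<pi>
    using that desc_pairs_invs[of \<pi> n] invs_sub[of n \<pi>] by (fastforce simp: A_def)
  \<comment> \<open>\<open>lifts\<close> returns an endpoint pair together with its mirror image,
    and \<open>desc_pairs\<close> is closed under mirror images; so the diagram determines the
    descents, which gives injectivity.\<close>
  have recover: "\<Union> (lifts ` delta_orb n \<pi>) = desc_pairs n \<pi>" if "\<pi> \<in> A" for \<pi>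
  proof -
    have "lifts (type_B n ?R d) = {d, (- snd d, - fst d)}" if "d \<in> desc_pairs n \<pi>" for d
      using lifts_type_B[of "fst d" "snd d" n ?R] lp[OF \<open>\<pi> \<in> A\<close>] that by auto
    moreover have "(- snd d, - fst d) \<in> desc_pairs n \<pi>" if "d \<in> desc_pairs n \<pi>" for d
      using desc_pairs_uminus[of \<pi> n "fst d" "snd d"] that \<open>\<pi> \<in> A\<close> by (simp add: A_def)
    ultimately show ?thesis unfolding orb[OF that] by auto
  qed
  have "inj_on (delta_orb n) A"
  proof (rule inj_onI)
    fix \<pi> \<sigma> assume "\<pi> \<in> A" "\<sigma> \<in> A" "delta_orb n \<pi> = delta_orb n \<sigma>"
    then have "desc_pairs n \<pi> = desc_pairs n \<sigma>" using recover by metis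
    then show "\<pi> = \<sigma>" using desc_pairs_inject \<open>\<pi> \<in> A\<close> \<open>\<sigma> \<in> A\<close> by (auto simp: A_def)
  qed
  moreover have "delta_orb n \<pi> \<in> {D. noncrossing_diagram_B n D \<and> (\<forall>\<alpha> \<in> D. allowed Lpts Rpts \<alpha>)}" if \<pi>: "\<pi> \<in> A" for \<pi>
  proof -
    have sp: "\<pi> \<in> signed_perms n" "camb n ?R (invs n \<pi>) = invs n \<pi>" using \<pi> by (auto simp: A_def)
    obtain c where "symmetric_drawing n (std_arc n ?R ` desc_pairs n \<pi>) c" using drawing_exists[OF sp] by blast
    then have "noncrossing_diagram_B n (type_B n ?R ` desc_pairs n \<pi>)"
      using noncrossing_type_B[where R = ?R, OF rt_labels lp[OF \<pi>]] desc_pairs_unique[OF sp(1)] by blast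
    moreover have "allowed Lpts Rpts (type_B n ?R d)" if "d \<in> desc_pairs n \<pi>" for d
      using allowed_type_B[of "fst d" "snd d"] lp[OF \<pi>] that by auto
    ultimately show ?thesis by (auto simp: orb[OF \<pi>])
  qed
  moreover have "\<exists>\<pi> \<in> A. delta_orb n \<pi> = D"
    if D: "noncrossing_diagram_B n D" "\<forall>\<alpha> \<in> D. allowed Lpts Rpts \<alpha>" for D
  proof -
    note dl = diagram_lifts[OF D(1)]
    obtain \<pi> where "\<pi> \<in> signed_perms n" "camb n ?R (invs n \<pi>) = invs n \<pi>" "desc_pairs n \<pi> = \<Union> (lifts ` D)"
      using compatible_realize[where R = ?R, OF dl(1) rt_labels] D(2) by blast
    then have "\<pi> \<in> A" "delta_orb n \<pi> = D" using orb[of \<pi>] dl(2) D(2) by (auto simp: A_def)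
    then show ?thesis by blast
  qed
  ultimately have "bij_betw (delta_orb n) A {D. noncrossing_diagram_B n D \<and> (\<forall>\<alpha> \<in> D. allowed Lpts Rpts \<alpha>)}"
    unfolding bij_betw_def by (intro conjI subset_antisym image_subsetI subsetI) (simp_all, metis image_eqI)
  then show ?thesis unfolding A .
qed

end

theorem theorem6p4:
  fixes n :: nat and Lpts Rpts :: "int set"
  assumes "2 \<le> n"
    and "Lpts \<union> Rpts = {1..int n - 1}" and "Lpts \<inter> Rpts = {}"
  shows "bij_betw (delta_orb n)
           {\<pi> \<in> signed_perms n. \<not> contracts (weak_order_B n) (cambrian_congruence n Lpts Rpts) \<pi>}
           {D. noncrossing_diagram_B n D \<and>
               (\<forall>\<alpha> \<in> D. (\<forall>i \<in> Lpts. \<not> passes_left_of \<alpha> i) \<and> (\<forall>i \<in> Rpts. \<not> passes_right_of \<alpha> i))}"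
proof -
  interpret designation n Lpts Rpts by unfold_locales (use assms in auto)
  show ?thesis using delta_orb_bij by (simp add: allowed_def)
qed

end
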